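(* Let $\mu,\nu\in\mathrm{M}_0(\mathbb{R}^d)$ and assume $\mu$ vanishes on sets of Hausdorff dimension at most $d-1$. Let $\gamma_1,\gamma_2\in\Gamma_{0,\mathrm{cm}}(\mu,\nu)$ and let $\psi_1,\psi_2:\mathbb{R}^d\to\mathbb{R}\cup\{\infty\}$ be closed convex functions such that $\mathrm{spt}\,\gamma_i\subset\partial\psi_i$ for $i\in\{1,2\}$. If $(0,0)\in\partial\psi_1\cap\partial\psi_2$, then $\nabla\psi_1=\nabla\psi_2$ $\mu$-almost everywhere and thus $\gamma_1=\gamma_2$. In particular, if at least one of $\mu$ or $\nu$ has infinite mass, then $\Gamma_{0,\mathrm{cm}}(\mu,\nu)$ is a singleton.
   Context: $\mathrm{M}_0(\mathbb{R}^k)$ denotes the set of nonnegative Borel measures $\mu$ on $\mathbb{R}^k\setminus\{0\}$ such that $\mu(B)<\infty$ for every Borel set $B\subset\mathbb{R}^k\setminus\{0\}$ with $0\notin \mathrm{cl}(B)$ (closure in $\mathbb{R}^k$). The support $\mathrm{spt}\,\mu$ is the set of $x\in\mathbb{R}^k$ such that $\mu(U\setminus\{0\})>0$ for every open $U\subset\mathbb{R}^k$ containing $x$ (so $0$ may belong to $\mathrm{spt}\,\mu$). "$\mu$ vanishes on sets of Hausdorff dimension at most $d-1$" means $\mu(A)=0$ for every Borel $A\subset\mathbb{R}^d\setminus\{0\}$ of Hausdorff dimension at most $d-1$. For $\mu,\nu\in\mathrm{M}_0(\mathbb{R}^d)$, a zero-coupling between $\mu$ and $\nu$ is a nonnegative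 Borel measure $\gamma$ on $(\mathbb{R}^d\times\mathbb{R}^d)\setminus\{(0,0)\}$ such that $\gamma(A\times\mathbb{R}^d)=\mu(A)$ and $\gamma(\mathbb{R}^d\times A)=\nu(A)$ for all Borel $A\subset\mathbb{R}^d\setminus\{0\}$; any such $\gamma$ belongs to $\mathrm{M}_0(\mathbb{R}^d\times\mathbb{R}^d)=\mathrm{M}_0(\mathbb{R}^{2d})$. $\Gamma_{0,\mathrm{cm}}(\mu,\nu)$ is the set of zero-couplings $\gamma$ such that $\mathrm{spt}\,\gamma$ is cyclically monotone. A set $T\subset\mathbb{R}^d\times\mathbb{R}^d$ is cyclically monotone if for every integer $n\ge 2$ and all $(x_1,y_1),\dots,(x_n,y_n)\in T$, with $y_{n+1}:=y_1$, one has $\sum_{i=1}^n\langle x_i,y_i\rangle\ge\sum_{i=1}^n\langle x_i,y_{i+1}\rangle$. A convex function $\psi:\mathbb{R}^d\to\mathbb{R}\cup\{\infty\}$ is closed if its epigraph is closed; $\mathrm{dom}\,\psi=\{\psi<\infty\}$; $\partial\psi=\{(x,v)\in\mathrm{dom}\,\psi\times\mathbb{R}^d:\forall y\in\mathbb{R}^d,\ \psi(y)\ge\psi(x)+\langle y-x,v\rangle\}$; $\nabla\psi$ is defined at the points where $\psi$ is (finite and) differentiable. The assertion "$\nabla\psi_1=\nabla\psi_2$ $\mu$-almost everywhere" includes that both gradients are defined $\mu$-almost everywhere. *)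

theory Defs
  imports "HOL-Analysis.Analysis"
begin

text \<open>
  The space \<open>\<real>\<^sup>d\<close> is rendered as a type \<open>'a::euclidean_space\<close> with \<open>d = DIM('a)\<close>, and
  \<open>\<real>\<^sup>d \<times> \<real>\<^sup>d\<close> as \<open>'a \<times> 'a\<close>, whose zero vector is \<open>(0, 0)\<close>.
\<close>

subsection \<open>Measures on the punctured space\<close>

text \<open>
  The \<open>sets\<close> condition determines the space as well, so equality of two such measures in type
  \<open>'a measure\<close> is equality of their values on all Borel subsets of the punctured space.
\<close>

definition punctured_measure :: "'a::euclidean_space measure \<Rightarrow> bool" where
  "punctured_measure \<mu> \<longleftrightarrow> sets \<mu> = sets (restrict_space borel (- {0}))"

definition M0 :: "'a::euclidean_space measure set" where
  "M0 = {\<mu>. punctured_measure \<mu> \<and>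
     (\<forall>B \<in> sets borel. B \<subseteq> - {0} \<longrightarrow> 0 \<notin> closure B \<longrightarrow> emeasure \<mu> B < \<infinity>)}"

definition spt :: "'a::euclidean_space measure \<Rightarrow> 'a set" where
  "spt \<mu> = {x. \<forall>U. open U \<longrightarrow> x \<in> U \<longrightarrow> emeasure \<mu> (U - {0}) > 0}"


subsection \<open>Hausdorff dimension\<close>

text \<open>
  The library's \<open>diameter\<close> is not meaningful for unbounded sets, hence the requirement that the
  covering sets be bounded. The exponent is only used for \<open>s > 0\<close> (where \<open>0 powr s = 0\<close> is the
  right value), which avoids conventions for \<open>0\<^sup>0\<close> and does not affect the infimum defining the
  dimension. The empty set gets dimension \<open>0\<close>.
\<close>

definition hausdorff_premeasure :: "real \<Rightarrow> real \<Rightarrow> 'a::metric_space set \<Rightarrow> ennreal" where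
  "hausdorff_premeasure s \<delta> A =
     (INF U \<in> {U :: nat \<Rightarrow> 'a set. A \<subseteq> (\<Union>i. U i) \<and> (\<forall>i. bounded (U i) \<and> diameter (U i) \<le> \<delta>)}.
        \<Sum>i. ennreal (diameter (U i) powr s))"

definition hausdorff_measure :: "real \<Rightarrow> 'a::metric_space set \<Rightarrow> ennreal" where
  "hausdorff_measure s A = (SUP \<delta> \<in> {0<..}. hausdorff_premeasure s \<delta> A)"

definition hausdorff_dim :: "'a::metric_space set \<Rightarrow> ereal" where
  "hausdorff_dim A = (INF s \<in> {s. s > 0 \<and> hausdorff_measure s A = 0}. ereal s)"

definition vanishes_on_codim_one :: "'a::euclidean_space measure \<Rightarrow> bool" where
  "vanishes_on_codim_one \<mu> \<longleftrightarrow>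
     (\<forall>A \<in> sets borel. A \<subseteq> - {0} \<longrightarrow> hausdorff_dim A \<le> ereal (real DIM('a) - 1)
        \<longrightarrow> emeasure \<mu> A = 0)"


subsection \<open>Zero-couplings\<close>

definition zero_coupling ::
  "'a::euclidean_space measure \<Rightarrow> 'a measure \<Rightarrow> ('a \<times> 'a) measure \<Rightarrow> bool" where
  "zero_coupling \<mu> \<nu> \<gamma> \<longleftrightarrow> punctured_measure \<gamma> \<and>
     (\<forall>A \<in> sets borel. A \<subseteq> - {0} \<longrightarrow>
        emeasure \<gamma> (A \<times> UNIV) = emeasure \<mu> A \<and> emeasure \<gamma> (UNIV \<times> A) = emeasure \<nu> A)"

definition cyclically_monotone :: "('a::real_inner \<times> 'a) set \<Rightarrow> bool" where
  "cyclically_monotone T \<longleftrightarrow>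
     (\<forall>(n::nat) x y. n \<ge> 2 \<longrightarrow> (\<forall>i<n. (x i, y i) \<in> T) \<longrightarrow>
        (\<Sum>i<n. x i \<bullet> y i) \<ge> (\<Sum>i<n. x i \<bullet> y (Suc i mod n)))"

definition Gamma0cm ::
  "'a::euclidean_space measure \<Rightarrow> 'a measure \<Rightarrow> ('a \<times> 'a) measure set" where
  "Gamma0cm \<mu> \<nu> = {\<gamma>. zero_coupling \<mu> \<nu> \<gamma> \<and> cyclically_monotone (spt \<gamma>)}"


subsection \<open>Extended-valued convex functions\<close>

text \<open>
  In the convexity inequality \<open>0 * \<infinity> = 0\<close>, and \<open>\<infinity> - \<infinity>\<close> cannot occur since \<open>-\<infinity>\<close> is excluded.
\<close>

definition closed_convex :: "('a::real_normed_vector \<Rightarrow> ereal) \<Rightarrow> bool" where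
  "closed_convex \<psi> \<longleftrightarrow>
     (\<forall>x. \<psi> x \<noteq> -\<infinity>) \<and>
     (\<forall>x y u v. 0 \<le> u \<longrightarrow> 0 \<le> v \<longrightarrow> u + v = 1 \<longrightarrow>
        \<psi> (u *\<^sub>R x + v *\<^sub>R y) \<le> ereal u * \<psi> x + ereal v * \<psi> y) \<and>
     closed {(x, r::real). \<psi> x \<le> ereal r}"

definition subdifferential :: "('a::real_inner \<Rightarrow> ereal) \<Rightarrow> ('a \<times> 'a) set" where
  "subdifferential \<psi> = {(x, v). \<psi> x < \<infinity> \<and> (\<forall>y. \<psi> y \<ge> \<psi> x + ereal ((y - x) \<bullet> v))}"

text \<open>
  Since \<open>real_of_ereal \<infinity> = 0\<close>, finiteness near \<open>x\<close> (which differentiability of an extended-valued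
  function at \<open>x\<close> entails) has to be required separately.
\<close>

definition has_gradient :: "('a::real_inner \<Rightarrow> ereal) \<Rightarrow> 'a \<Rightarrow> 'a \<Rightarrow> bool" where
  "has_gradient \<psi> v x \<longleftrightarrow>
     (\<forall>\<^sub>F y in nhds x. \<bar>\<psi> y\<bar> \<noteq> \<infinity>) \<and> (GDERIV (\<lambda>y. real_of_ereal (\<psi> y)) x :> v)"

definition gradient_defined :: "('a::real_inner \<Rightarrow> ereal) \<Rightarrow> 'a \<Rightarrow> bool" where
  "gradient_defined \<psi> x \<longleftrightarrow> (\<exists>v. has_gradient \<psi> v x)"

definition gradient :: "('a::real_inner \<Rightarrow> ereal) \<Rightarrow> 'a \<Rightarrow> 'a" where
  "gradient \<psi> x = (THE v. has_gradient \<psi> v x)"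

end

(*
  Uniqueness compares distributions. Normalise the potentials by psi_i(0) = 0 and put
  u = psi_1 - psi_2 on the first and v = psi_2* - psi_1* on the second coordinate. The Fenchel-Young
  inequality gives u(x) <= v(y) almost everywhere for gamma_1 and u(x) >= v(y) almost everywhere for
  gamma_2. As the marginals agree, the level sets {u > t} and {v > t} have the same mass. It is finite
  for t > 0: along gamma_1, psi_1(x) > t forces <x,y> > t, which keeps (x,y) away from the origin.
  Hence u(x) = v(y) almost everywhere, so gamma_1 is carried by the graph of the subdifferential of
  psi_2 as well. Points with several subgradients form a set of dimension at most d - 1, because
  x + v |-> x is 1-Lipschitz on the graph; elsewhere the common subgradient is the gradient.

  Existence: for any finite family of Borel sets away from the origin, finite optimal transport yields
  a finitely supported, cyclically monotone plan whose marginals are exact on that family. By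
  Tychonoff these plans have a cluster point among the set functions; its restriction to compact sets
  is a content, and the measure induced by that content is the desired coupling.
  If a marginal has infinite mass, the support of every coupling contains the origin, and
  Rockafellar's theorem provides the potentials.
*)

theory Submission
  imports Defs
begin

subsection \<open>Subdifferentials and gradients\<close>

text \<open>The usual uniqueness argument integrates the potentials against the marginals. Here both
  masses may be infinite, so those integrals need not make sense; distributions are compared height
  by height, where only finite masses occur. The point \<open>(0, 0)\<close> in both
  subdifferentials drives this: the normalised potentials are nonnegative on their domains, and they
  and the conjugates vanish at 0, hence the sets above a positive height avoid the origin, which the
  marginals do not see. Coordinates equal to 0 need care throughout: a coupling may charge
  \<open>{0} \<times> UNIV\<close>, which \<mu> does not control, and this mass is recovered from
  \<nu> by subtraction. In the existence part, mass can be lost at two places. What concentrates at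
  the origin is simply discarded. What escapes to infinity in one coordinate, over a compact set in
  the other, is at most the mass of the corresponding marginal outside a large ball, which is finite
  and tends to 0.\<close>

lemma supporting_hyperplane_not_interior:
  fixes S :: "'a::euclidean_space set"
  assumes "convex S" "x \<notin> interior S"
  obtains a where "a \<noteq> 0" "\<And>y. y \<in> S \<Longrightarrow> a \<bullet> y \<le> a \<bullet> x"
proof (cases "interior S = {}")
  case True
  obtain a b where ab: "a \<noteq> 0" "S \<subseteq> {y. a \<bullet> y = b}"
    using empty_interior_subset_hyperplane[OF assms(1) True] by blast
  show ?thesis
  proof (cases "b \<le> a \<bullet> x")
    case True
    then show ?thesis using ab by (intro that[of a]) auto
  next
    case False
    then show ?thesis using ab by (intro that[of "-a"]) auto
  qed
next
  case False
  obtain a b where ab: "a \<noteq> 0" "\<forall>y\<in>interior S. a \<bullet> y \<le> b" "\<forall>y\<in>{x}. b \<le> a \<bullet> y"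
    using separating_hyperplane_sets[of "interior S" "{x}"] assms False by auto
  \<comment> \<open>The separation of the open interior passes to its closure, and for a convex set
    with nonempty interior this closure contains \<open>S\<close>.\<close>
  have "closure (interior S) \<subseteq> {y. a \<bullet> y \<le> b}"
    using ab by (intro closure_minimal closed_halfspace_le) auto
  then have "S \<subseteq> {y. a \<bullet> y \<le> b}"
    using convex_closure_interior[OF assms(1) False] closure_subset[of S] by blast
  then show ?thesis using ab by (intro that[of a]) auto
qed

lemma subdifferentialD:
  assumes "(x, v) \<in> subdifferential \<psi>"
  shows "\<psi> x < \<infinity>" "\<psi> y \<ge> \<psi> x + ereal ((y - x) \<bullet> v)"
  using assms by (auto simp: subdifferential_def)

lemma closed_convexD:
  assumes "closed_convex \<psi>"
  shows "\<psi> x \<noteq> -\<infinity>" "0 \<le> u \<Longrightarrow> 0 \<le> v \<Longrightarrow> u + v = 1 \<Longrightarrow>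
        \<psi> (u *\<^sub>R x + v *\<^sub>R y) \<le> ereal u * \<psi> x + ereal v * \<psi> y"
    "closed {(x, r::real). \<psi> x \<le> ereal r}"
  using assms by (auto simp: closed_convex_def)

text \<open>Moves the subgradient inequality from \<open>ereal\<close> to \<open>real\<close>, where
  linear arithmetic is available; points of infinite value impose no condition.\<close>

lemma subdifferential_iff_real:
  assumes "\<And>x. \<psi> x \<noteq> -\<infinity>"
  shows "(x, v) \<in> subdifferential \<psi> \<longleftrightarrow> \<psi> x < \<infinity> \<and>
    (\<forall>y. \<psi> y < \<infinity> \<longrightarrow> real_of_ereal (\<psi> x) + (y - x) \<bullet> v \<le> real_of_ereal (\<psi> y))"
proof -
  have "\<psi> x + ereal ((y - x) \<bullet> v) \<le> \<psi> y \<longleftrightarrow>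
     (\<psi> y < \<infinity> \<longrightarrow> real_of_ereal (\<psi> x) + (y - x) \<bullet> v \<le> real_of_ereal (\<psi> y))"
    if "\<psi> x < \<infinity>" for y
    using that assms[of x] assms[of y] by (cases "\<psi> x"; cases "\<psi> y") auto
  then show ?thesis by (auto simp: subdifferential_def)
qed

lemma subdifferential_realD:
  assumes "closed_convex \<psi>" "(x, v) \<in> subdifferential \<psi>" "\<psi> y < \<infinity>"
  shows "real_of_ereal (\<psi> x) + (y - x) \<bullet> v \<le> real_of_ereal (\<psi> y)"
  using subdifferential_iff_real[OF closed_convexD(1)[OF assms(1)], THEN iffD1, OF assms(2)] assms(3)
  by simp

lemma subdifferential_realI:
  assumes "closed_convex \<psi>" "\<psi> x < \<infinity>"
    "\<And>y. \<psi> y < \<infinity> \<Longrightarrow> real_of_ereal (\<psi> x) + (y - x) \<bullet> v \<le> real_of_ereal (\<psi> y)"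
  shows "(x, v) \<in> subdifferential \<psi>"
  using assms(2,3)
  by (intro subdifferential_iff_real[OF closed_convexD(1)[OF assms(1)], THEN iffD2]) simp

lemma subdifferential_monotone:
  assumes "closed_convex \<psi>" "(x, v) \<in> subdifferential \<psi>" "(y, w) \<in> subdifferential \<psi>"
  shows "0 \<le> (x - y) \<bullet> (v - w)"
proof -
  have "real_of_ereal (\<psi> x) + (y - x) \<bullet> v \<le> real_of_ereal (\<psi> y)"
    "real_of_ereal (\<psi> y) + (x - y) \<bullet> w \<le> real_of_ereal (\<psi> x)"
    using subdifferential_realD[OF assms(1,2) subdifferentialD(1)[OF assms(3)]]
      subdifferential_realD[OF assms(1,3) subdifferentialD(1)[OF assms(2)]] .
  then show ?thesis by (simp add: inner_diff_left inner_diff_right inner_commute)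
qed

text \<open>For fixed \<open>z\<close>, the subgradient inequality puts a point depending
  continuously on \<open>(x, v)\<close> into the epigraph, so the graph is an intersection of closed
  preimages. Membership also encodes \<open>\<psi> x < \<infinity>\<close>, provided that some
  \<open>z\<close> occurs; this is why a function that is infinite everywhere is split off.\<close>

lemma closed_subdifferential:
  fixes \<psi> :: "'a::euclidean_space \<Rightarrow> ereal"
  assumes "closed_convex \<psi>"
  shows "closed (subdifferential \<psi>)"
proof (cases "\<exists>z. \<psi> z < \<infinity>")
  case False
  then have "subdifferential \<psi> = {}" by (auto simp: subdifferential_def)
  then show ?thesis by simp
next
  case True
  let ?epi = "{(x, r::real). \<psi> x \<le> ereal r}"
  let ?h = "\<lambda>z (p::'a\<times>'a). (fst p, real_of_ereal (\<psi> z) - (z - fst p) \<bullet> snd p)"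
  have "closed (?h z -` ?epi)" for z
    by (intro closed_vimage closed_convexD(3) assms continuous_intros)
  then have "closed (\<Inter>z\<in>{z. \<psi> z < \<infinity>}. ?h z -` ?epi)" by auto
  moreover have "subdifferential \<psi> = (\<Inter>z\<in>{z. \<psi> z < \<infinity>}. ?h z -` ?epi)"
  proof -
    have "(x, v) \<in> subdifferential \<psi> \<longleftrightarrow> (x, v) \<in> (\<Inter>z\<in>{z. \<psi> z < \<infinity>}. ?h z -` ?epi)" for x v
    proof -
      have e: "\<psi> x \<le> ereal r \<longleftrightarrow> \<psi> x < \<infinity> \<and> real_of_ereal (\<psi> x) \<le> r" for r
        using closed_convexD(1)[OF assms, of x] by (cases "\<psi> x") auto
      show ?thesis
        using True subdifferential_iff_real[OF closed_convexD(1)[OF assms], of x v]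
        by (auto simp: e algebra_simps)
    qed
    then show ?thesis by auto
  qed
  ultimately show ?thesis by simp
qed

text \<open>Combined with a supporting hyperplane of the domain, this shows that a subgradient at a
  point outside the interior of the domain is never the only one.\<close>

lemma subdifferential_add_normal:
  assumes cc: "closed_convex \<psi>" and xv: "(x, v) \<in> subdifferential \<psi>"
    and a: "\<And>y. \<psi> y < \<infinity> \<Longrightarrow> a \<bullet> y \<le> a \<bullet> x"
  shows "(x, v + a) \<in> subdifferential \<psi>"
proof -
  have "real_of_ereal (\<psi> x) + (y - x) \<bullet> (v + a) \<le> real_of_ereal (\<psi> y)" if "\<psi> y < \<infinity>" for y
  proof -
    have "real_of_ereal (\<psi> x) + (y - x) \<bullet> v \<le> real_of_ereal (\<psi> y)" by (rule subdifferential_realD[OF cc xv that])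
    moreover have "(y - x) \<bullet> a \<le> 0" using a[OF that] by (simp add: inner_diff_right inner_commute[of _ a])
    ultimately show ?thesis by (simp add: inner_add_right)
  qed
  then show ?thesis using subdifferential_realI[OF cc] subdifferentialD(1)[OF xv] by blast
qed

lemma convex_dom:
  assumes cc: "closed_convex \<psi>"
  shows "convex {y. \<psi> y < \<infinity>}"
proof (rule convexI)
  fix x y and u v :: real
  assume *: "x \<in> {y. \<psi> y < \<infinity>}" "y \<in> {y. \<psi> y < \<infinity>}" "0 \<le> u" "0 \<le> v" "u + v = 1"
  have "\<psi> (u *\<^sub>R x + v *\<^sub>R y) \<le> ereal u * \<psi> x + ereal v * \<psi> y"
    using closed_convexD(2)[OF cc] * by blast
  also have "\<dots> < \<infinity>"
    using * closed_convexD(1)[OF cc, of x] closed_convexD(1)[OF cc, of y]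
    by (cases "\<psi> x"; cases "\<psi> y") auto
  finally show "u *\<^sub>R x + v *\<^sub>R y \<in> {y. \<psi> y < \<infinity>}" by simp
qed

lemma convex_epigraph_ereal:
  assumes cc: "closed_convex \<psi>"
  shows "convex {(x, r::real). \<psi> x \<le> ereal r}"
proof (rule convexI)
  fix p q :: "'a \<times> real" and u v :: real
  assume *: "p \<in> {(x, r::real). \<psi> x \<le> ereal r}" "q \<in> {(x, r::real). \<psi> x \<le> ereal r}"
    "0 \<le> u" "0 \<le> v" "u + v = 1"
  have "\<psi> (u *\<^sub>R fst p + v *\<^sub>R fst q) \<le> ereal u * \<psi> (fst p) + ereal v * \<psi> (fst q)"
    using closed_convexD(2)[OF cc] * by blast
  also have "\<dots> \<le> ereal u * ereal (snd p) + ereal v * ereal (snd q)"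
    using * by (intro add_mono ereal_mult_left_mono) auto
  finally show "u *\<^sub>R p + v *\<^sub>R q \<in> {(x, r::real). \<psi> x \<le> ereal r}"
    by (cases p; cases q) auto
qed

lemma convex_on_dom:
  assumes cc: "closed_convex \<psi>"
  shows "convex_on {y. \<psi> y < \<infinity>} (\<lambda>y. real_of_ereal (\<psi> y))"
proof (rule convex_onI)
  show "convex {y. \<psi> y < \<infinity>}" by (rule convex_dom[OF cc])
  fix t :: real and x y
  assume *: "x \<in> {y. \<psi> y < \<infinity>}" "y \<in> {y. \<psi> y < \<infinity>}" "0 < t" "t < 1"
  have "\<psi> ((1 - t) *\<^sub>R x + t *\<^sub>R y) \<le> ereal (1 - t) * \<psi> x + ereal t * \<psi> y"
    using closed_convexD(2)[OF cc, of "1 - t" t x y] * by auto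
  then show "real_of_ereal (\<psi> ((1 - t) *\<^sub>R x + t *\<^sub>R y)) \<le>
      (1 - t) * real_of_ereal (\<psi> x) + t * real_of_ereal (\<psi> y)"
    using * closed_convexD(1)[OF cc, of x] closed_convexD(1)[OF cc, of y]
      closed_convexD(1)[OF cc, of "(1 - t) *\<^sub>R x + t *\<^sub>R y"]
    by (cases "\<psi> x"; cases "\<psi> y"; cases "\<psi> ((1 - t) *\<^sub>R x + t *\<^sub>R y)") auto
qed

text \<open>The slope of a supporting hyperplane of the epigraph at \<open>(x, \<psi> x)\<close> is
  the subgradient. The functional cannot grow upwards, so \<open>\<alpha> \<le> 0\<close>; and a
  vertical hyperplane, \<open>\<alpha> = 0\<close>, would bound the domain in direction
  \<open>a\<close>, although \<open>x\<close> can be moved a little in that direction.\<close>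

lemma subdifferential_nonempty_interior:
  fixes \<psi> :: "'a::euclidean_space \<Rightarrow> ereal"
  assumes cc: "closed_convex \<psi>" and x: "x \<in> interior {y. \<psi> y < \<infinity>}"
  obtains v where "(x, v) \<in> subdifferential \<psi>"
proof -
  let ?epi = "{(x, r::real). \<psi> x \<le> ereal r}"
  let ?p = "\<lambda>y. real_of_ereal (\<psi> y)"
  have xD: "\<psi> x < \<infinity>" using x interior_subset by blast
  have epi: "(y, r) \<in> ?epi \<longleftrightarrow> \<psi> y < \<infinity> \<and> ?p y \<le> r" for y r
    using closed_convexD(1)[OF cc, of y] by (cases "\<psi> y") auto
  have "(x, ?p x) \<notin> interior ?epi"
  proof
    assume "(x, ?p x) \<in> interior ?epi"
    then obtain e where e: "e > 0" "ball (x, ?p x) e \<subseteq> ?epi" by (auto simp: mem_interior)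
    have "(x, ?p x - e / 2) \<in> ball (x, ?p x) e" using e(1) by (simp add: dist_Pair_Pair dist_real_def)
    then have "?p x \<le> ?p x - e / 2" using e(2) epi by blast
    with e(1) show False by simp
  qed
  then obtain A where A: "A \<noteq> 0" "\<And>q. q \<in> ?epi \<Longrightarrow> A \<bullet> q \<le> A \<bullet> (x, ?p x)"
    using supporting_hyperplane_not_interior[OF convex_epigraph_ereal[OF cc]] by blast
  obtain a \<alpha> where Aeq: "A = (a, \<alpha>)" by (cases A)
  have ineq: "a \<bullet> y + \<alpha> * r \<le> a \<bullet> x + \<alpha> * ?p x" if "\<psi> y < \<infinity>" "?p y \<le> r" for y r
    using A(2)[of "(y, r)"] epi that by (auto simp: Aeq)
  have "\<alpha> \<le> 0" using ineq[OF xD, of "?p x + 1"] by (simp add: algebra_simps)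
  moreover have "\<alpha> \<noteq> 0"
  proof
    assume 0: "\<alpha> = 0"
    obtain e where e: "e > 0" "cball x e \<subseteq> {y. \<psi> y < \<infinity>}" using x by (auto simp: mem_interior_cball)
    have "a \<noteq> 0" using A(1) Aeq 0 by (auto simp: zero_prod_def)
    define y where "y = x + (e / norm a) *\<^sub>R a"
    have "y \<in> cball x e" using e(1) \<open>a \<noteq> 0\<close> by (simp add: y_def dist_norm)
    then have "a \<bullet> y \<le> a \<bullet> x" using e(2) ineq[of y "?p y"] 0 by auto
    then have "(e / norm a) * (a \<bullet> a) \<le> 0" by (simp add: y_def inner_add_right)
    moreover have "(e / norm a) * (a \<bullet> a) > 0" using e(1) \<open>a \<noteq> 0\<close> by (intro mult_pos_pos) auto
    ultimately show False by simp
  qed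
  ultimately have \<alpha>: "\<alpha> < 0" by simp
  define v where "v = (1 / (-\<alpha>)) *\<^sub>R a"
  have av: "a = (-\<alpha>) *\<^sub>R v" using \<alpha> by (simp add: v_def)
  have "?p x + (y - x) \<bullet> v \<le> ?p y" if "\<psi> y < \<infinity>" for y
  proof -
    have "(-\<alpha>) * (v \<bullet> y) + \<alpha> * ?p y \<le> (-\<alpha>) * (v \<bullet> x) + \<alpha> * ?p x"
      using ineq[OF that order_refl] unfolding av by simp
    then have "(-\<alpha>) * (?p x + (y - x) \<bullet> v) \<le> (-\<alpha>) * ?p y"
      by (simp add: algebra_simps inner_diff_left inner_commute)
    then show ?thesis using \<alpha> by (simp only: mult_le_cancel_left_pos neg_0_less_iff_less)
  qed
  then show ?thesis using that subdifferential_realI[OF cc xD] by blast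
qed

lemma has_gradient_unique:
  assumes "has_gradient \<psi> v x" "has_gradient \<psi> w x"
  shows "v = w"
proof -
  have "(\<bullet>) v = (\<bullet>) w"
    using assms unfolding has_gradient_def gderiv_def
    by (metis (no_types, lifting) has_derivative_unique inner_commute ext)
  then show ?thesis by (metis inner_eq_zero_iff inner_diff_left right_minus_eq)
qed

lemma gradient_eqI: "has_gradient \<psi> v x \<Longrightarrow> gradient \<psi> x = v"
  unfolding gradient_def using has_gradient_unique by blast

text \<open>Uniqueness puts \<open>x\<close> into the interior of the domain, since otherwise a
  normal could be added. Any selection \<open>g\<close> of subgradients is then bounded near
  \<open>x\<close>, and its limit points at \<open>x\<close> are subgradients because the graph is
  closed; hence \<open>g\<close> tends to \<open>v\<close>, and this controls the remainder of the
  linear approximation.\<close>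

lemma has_gradient_of_unique_subgradient:
  fixes \<psi> :: "'a::euclidean_space \<Rightarrow> ereal"
  assumes cc: "closed_convex \<psi>" and xv: "(x, v) \<in> subdifferential \<psi>"
    and uniq: "\<And>w. (x, w) \<in> subdifferential \<psi> \<Longrightarrow> w = v"
  shows "has_gradient \<psi> v x"
proof -
  let ?D = "{y. \<psi> y < \<infinity>}"
  let ?p = "\<lambda>y. real_of_ereal (\<psi> y)"
  have xint: "x \<in> interior ?D"
  proof (rule ccontr)
    assume "x \<notin> interior ?D"
    then obtain a where "a \<noteq> 0" "\<And>y. y \<in> ?D \<Longrightarrow> a \<bullet> y \<le> a \<bullet> x"
      using supporting_hyperplane_not_interior[OF convex_dom[OF cc]] by blast
    then have "v + a = v" using uniq subdifferential_add_normal[OF cc xv] by blast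
    with \<open>a \<noteq> 0\<close> show False by simp
  qed
  have ev: "\<forall>\<^sub>F y in nhds x. \<bar>\<psi> y\<bar> \<noteq> \<infinity>"
  proof -
    have "\<forall>\<^sub>F y in nhds x. y \<in> interior ?D" using xint by (simp add: eventually_nhds_in_open)
    then show ?thesis
      by eventually_elim (use interior_subset[of ?D] closed_convexD(1)[OF cc] in fastforce)
  qed
  have cont: "continuous_on (interior ?D) ?p"
    by (intro convex_on_continuous open_interior
        convex_on_subset[OF convex_on_dom[OF cc] interior_subset convex_interior[OF convex_dom[OF cc]]])
  obtain e where e: "e > 0" "cball x e \<subseteq> interior ?D"
    using xint open_contains_cball[of "interior ?D"] by auto
  have "compact (?p ` cball x e)"
    by (intro compact_continuous_image continuous_on_subset[OF cont] e) auto
  then obtain M where M: "\<And>y. y \<in> cball x e \<Longrightarrow> \<bar>?p y\<bar> \<le> M"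
    using compact_imp_bounded[of "?p ` cball x e"] unfolding bounded_iff by (metis imageI real_norm_def)
  define g where "g y = (SOME w. (y, w) \<in> subdifferential \<psi>)" for y
  have g: "(y, g y) \<in> subdifferential \<psi>" if "y \<in> interior ?D" for y
    unfolding g_def by (rule someI_ex) (meson subdifferential_nonempty_interior[OF cc that])
  \<comment> \<open>Moving from \<open>y\<close> by \<open>e / 2\<close> in the direction of
    \<open>g y\<close> stays in the ball where \<psi> is bounded by \<open>M\<close>, so the
    subgradient inequality gives \<open>e / 2 * norm (g y) \<le> 2 * M\<close>.\<close>
  have gb: "norm (g y) \<le> 4 * M / e" if "y \<in> cball x (e/2)" for y
  proof (cases "g y = 0")
    case True
    have "x \<in> cball x e" using e by simp
    then have "0 \<le> M" using order_trans[OF abs_ge_zero M] by blast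
    then show ?thesis using True e by simp
  next
    case False
    define z where "z = y + (e / 2 / norm (g y)) *\<^sub>R g y"
    have zy: "dist y z = e / 2" using False e by (simp add: z_def dist_norm)
    have "z \<in> cball x e" using that zy dist_triangle[of x z y] by auto
    moreover have yc: "y \<in> cball x e" using that e by auto
    ultimately have *: "?p z - ?p y \<le> 2 * M" using M[of z] M[of y] by linarith
    have "?p y + (z - y) \<bullet> g y \<le> ?p z"
      using subdifferential_realD[OF cc g[of y], of z] yc e(2) \<open>z \<in> cball x e\<close> interior_subset[of ?D] by blast
    moreover have "(z - y) \<bullet> g y = e / 2 * norm (g y)"
      using False by (simp add: z_def power2_norm_eq_inner[symmetric] power2_eq_square)
    ultimately have "e / 2 * norm (g y) \<le> 2 * M" using * by linarith
    then show ?thesis using e by (simp add: field_simps)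
  qed
  have gtend: "(g \<longlongrightarrow> v) (at x)"
  proof (rule ccontr)
    assume "\<not> (g \<longlongrightarrow> v) (at x)"
    then obtain d where d: "d > 0" "\<exists>\<^sub>F y in at x. dist (g y) v \<ge> d"
      unfolding tendsto_iff frequently_def not_le by blast
    have "\<exists>y. y \<in> cball x (e/2) \<and> dist y x < inverse (Suc n) \<and> dist (g y) v \<ge> d" for n
    proof -
      have "\<forall>\<^sub>F y in at x. dist y x < min (e/2) (inverse (Suc n))"
        unfolding eventually_at using e by (intro exI[of _ "min (e/2) (inverse (Suc n))"]) auto
      with d(2) have "\<exists>\<^sub>F y in at x. dist (g y) v \<ge> d \<and> dist y x < min (e/2) (inverse (Suc n))"
        by (auto elim!: frequently_rev_mp eventually_mono)
      then obtain y where "dist (g y) v \<ge> d" "dist y x < min (e/2) (inverse (Suc n))"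
        by (auto dest: frequently_ex)
      then show ?thesis by (intro exI[of _ y]) (auto simp: dist_commute)
    qed
    then obtain y where y: "\<And>n. y n \<in> cball x (e/2)" "\<And>n. dist (y n) x < inverse (Suc n)"
        "\<And>n. dist (g (y n)) v \<ge> d"
      by metis
    have ylim: "y \<longlonglongrightarrow> x"
    proof (rule tendsto_dist_iff[THEN iffD2],
        rule tendsto_sandwich[OF _ _ tendsto_const LIMSEQ_inverse_real_of_nat])
      show "\<forall>\<^sub>F n in sequentially. 0 \<le> dist (y n) x" by simp
      show "\<forall>\<^sub>F n in sequentially. dist (y n) x \<le> inverse (real (Suc n))"
        by (intro always_eventually allI less_imp_le y)
    qed
    have "\<forall>n. g (y n) \<in> cball 0 (4 * M / e)" using gb y(1) by auto
    then obtain w r where w: "w \<in> cball 0 (4 * M / e)" "strict_mono r" "((\<lambda>n. g (y n)) \<circ> r) \<longlonglongrightarrow> w"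
      by (rule seq_compactE[OF compact_imp_seq_compact[OF compact_cball]])
    have "(\<lambda>n. (y (r n), g (y (r n)))) \<longlonglongrightarrow> (x, w)"
      using LIMSEQ_subseq_LIMSEQ[OF ylim w(2)] w(3) by (intro tendsto_Pair) (auto simp: o_def)
    moreover have "(y (r n), g (y (r n))) \<in> subdifferential \<psi>" for n
      using g[of "y (r n)"] y(1)[of "r n"] subset_cball[of "e/2" e x] e by (simp add: subset_iff)
    ultimately have "(x, w) \<in> subdifferential \<psi>"
      using closed_sequentially[OF closed_subdifferential[OF cc], of "\<lambda>n. (y (r n), g (y (r n)))"] by blast
    then have "w = v" using uniq by blast
    then have "(\<lambda>n. dist (g (y (r n))) v) \<longlonglongrightarrow> 0"
      using tendsto_dist_iff[THEN iffD1, OF w(3)] by (simp add: o_def)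
    then have "d \<le> 0" by (rule LIMSEQ_le_const) (use y(3) in auto)
    with d(1) show False by simp
  qed
  have "(?p has_derivative (\<lambda>h. h \<bullet> v)) (at x)"
    unfolding has_derivative_at2
  proof (intro conjI)
    show "bounded_linear (\<lambda>h. h \<bullet> v)" by (rule bounded_linear_inner_left)
    have "((\<lambda>y. norm (g y - v)) \<longlongrightarrow> 0) (at x)"
      by (rule tendsto_norm_zero[OF LIM_zero[OF gtend]])
    moreover have "\<forall>\<^sub>F y in at x. norm ((1 / norm (y - x)) *\<^sub>R (?p y - (?p x + (y - x) \<bullet> v))) \<le> norm (g y - v)"
    proof -
      have "\<forall>\<^sub>F y in at x. y \<in> ball x e - {x}"
        using e(1) by (intro eventually_at_in_open) auto
      then show ?thesis
      proof eventually_elim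
        case (elim y)
        have "y \<in> interior ?D" using elim e(2) ball_subset_cball[of x e] by blast
        then have yD: "y \<in> interior ?D" "\<psi> y < \<infinity>" "\<psi> x < \<infinity>"
          using interior_subset[of ?D] xint by blast+
        \<comment> \<open>The subgradient inequality at \<open>x\<close> bounds the remainder below
          by 0; the one at \<open>y\<close> bounds it above by
          \<open>(y - x) \<bullet> (g y - v)\<close>.\<close>
        have lo: "?p x + (y - x) \<bullet> v \<le> ?p y" using subdifferential_realD[OF cc xv yD(2)] .
        have "?p y + (x - y) \<bullet> g y \<le> ?p x" using subdifferential_realD[OF cc g[OF yD(1)] yD(3)] .
        then have "?p y - (?p x + (y - x) \<bullet> v) \<le> (y - x) \<bullet> (g y - v)"
          by (simp add: inner_diff_left inner_diff_right)
        also have "\<dots> \<le> norm (y - x) * norm (g y - v)" by (rule norm_cauchy_schwarz)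
        finally show ?case using lo elim by (simp add: divide_simps mult.commute)
      qed
    qed
    ultimately show "(\<lambda>y. (1 / norm (y - x)) *\<^sub>R (?p y - (?p x + (y - x) \<bullet> v))) \<midarrow>x\<rightarrow> 0"
      by (rule Lim_null_comparison[rotated])
  qed
  then show ?thesis using ev by (simp add: has_gradient_def gderiv_def inner_commute)
qed

subsection \<open>Rockafellar's theorem\<close>

(* The chain starts at p and the list has its latest point first, which matches the index shift in
   the definition of cyclical monotonicity. *)
fun chain_value :: "'a::real_inner \<times> 'a \<Rightarrow> 'a \<Rightarrow> ('a \<times> 'a) list \<Rightarrow> real" where
  "chain_value p x [] = (x - fst p) \<bullet> snd p"
| "chain_value p x (q # zs) = (x - fst q) \<bullet> snd q + chain_value p (fst q) zs"

text \<open>Regroups the chain into the two sums that cyclical monotonicity compares. The shifted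
  sum has one summand less here; the missing wrap-around term is
  \<open>x \<bullet> snd (ws zs p ! 0)\<close> as soon as \<open>x = fst p\<close>.\<close>

lemma chain_value_eq_sum:
  defines "ws \<equiv> \<lambda>zs p. zs @ [p]"
  shows "chain_value p x zs = x \<bullet> snd (ws zs p ! 0)
    + (\<Sum>i<length zs. fst (ws zs p ! i) \<bullet> snd (ws zs p ! Suc i))
    - (\<Sum>i<Suc (length zs). fst (ws zs p ! i) \<bullet> snd (ws zs p ! i))"
proof (induction zs arbitrary: x)
  case Nil
  show ?case by (simp add: ws_def inner_diff_left)
next
  case (Cons q zs)
  show ?case
    unfolding chain_value.simps Cons.IH ws_def
    by (simp add: sum.lessThan_Suc_shift inner_diff_left del: sum.lessThan_Suc)
qed

text \<open>Ending the chain at \<open>fst p\<close> closes it to a cycle. The empty list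
  corresponds to a cycle of length 1, which the definition of cyclical monotonicity leaves out, and
  is computed directly.\<close>

lemma chain_value_le_0:
  assumes "cyclically_monotone T" "p \<in> T" "set zs \<subseteq> T"
  shows "chain_value p (fst p) zs \<le> 0"
proof (cases "zs = []")
  case False
  define ws where "ws = zs @ [p]"
  define m where "m = length zs"
  have m: "Suc m \<ge> 2" "ws ! m = p" using False by (auto simp: m_def ws_def Suc_le_eq)
  have "\<forall>i<Suc m. ws ! i \<in> set ws" by (intro allI impI nth_mem) (simp add: ws_def m_def)
  then have T: "\<forall>i<Suc m. (fst (ws ! i), snd (ws ! i)) \<in> T"
    using assms(2,3) by (auto simp: ws_def)
  have "(\<Sum>i<Suc m. fst (ws ! i) \<bullet> snd (ws ! (Suc i mod Suc m)))
      = (\<Sum>i<m. fst (ws ! i) \<bullet> snd (ws ! Suc i)) + fst p \<bullet> snd (ws ! 0)"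
    using m by simp
  moreover have "(\<Sum>i<Suc m. fst (ws ! i) \<bullet> snd (ws ! (Suc i mod Suc m)))
      \<le> (\<Sum>i<Suc m. fst (ws ! i) \<bullet> snd (ws ! i))"
    using assms(1)[unfolded cyclically_monotone_def, rule_format,
        of "Suc m" "\<lambda>i. fst (ws ! i)" "\<lambda>i. snd (ws ! i)"] T m(1) by blast
  ultimately show ?thesis
    unfolding chain_value_eq_sum ws_def[symmetric] m_def[symmetric] by linarith
qed simp

lemma chain_value_affine:
  assumes "u + v = 1"
  shows "chain_value p (u *\<^sub>R x + v *\<^sub>R y) zs = u * chain_value p x zs + v * chain_value p y zs"
proof -
  have *: "(u *\<^sub>R x + v *\<^sub>R y - a) \<bullet> b = u * ((x - a) \<bullet> b) + v * ((y - a) \<bullet> b)" for a b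
  proof -
    have "a \<bullet> b = u * (a \<bullet> b) + v * (a \<bullet> b)" using assms by (metis distrib_right mult_1)
    then show ?thesis by (simp add: inner_diff_left inner_add_left algebra_simps)
  qed
  have **: "c = u * c + v * c" for c :: real using assms by (metis distrib_right mult_1)
  show ?thesis
  proof (cases zs)
    case (Cons q zs')
    show ?thesis using **[of "chain_value p (fst q) zs'"]
      unfolding Cons chain_value.simps * distrib_left by linarith
  qed (simp add: *)
qed

text \<open>The potential at \<open>x\<close> is the supremum of the values of all chains in
  \<open>T\<close> from \<open>p\<close> to \<open>x\<close>. Each value is affine in
  \<open>x\<close>, whence closedness and convexity; extending a chain by a further point of
  \<open>T\<close> yields the subgradient inequality there.\<close>

theorem rockafellar:
  fixes T :: "('a::euclidean_space \<times> 'a) set"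
  assumes cm: "cyclically_monotone T" and "p \<in> T"
  obtains \<psi> where "closed_convex \<psi>" "T \<subseteq> subdifferential \<psi>"
proof -
  define L where "L = {zs. set zs \<subseteq> T}"
  define \<psi> where "\<psi> x = (SUP zs\<in>L. ereal (chain_value p x zs))" for x
  have L: "[] \<in> L" by (simp add: L_def)
  have le: "ereal (chain_value p x zs) \<le> \<psi> x" if "zs \<in> L" for x zs
    unfolding \<psi>_def using that by (rule SUP_upper)
  have nm: "\<psi> x \<noteq> -\<infinity>" for x
    using le[OF L, of x] by auto
  have cc: "closed_convex \<psi>"
    unfolding closed_convex_def
  proof (intro conjI allI impI nm)
    fix x y and u v :: real
    assume uv: "0 \<le> u" "0 \<le> v" "u + v = 1"
    show "\<psi> (u *\<^sub>R x + v *\<^sub>R y) \<le> ereal u * \<psi> x + ereal v * \<psi> y"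
      unfolding \<psi>_def[of "u *\<^sub>R x + v *\<^sub>R y"]
    proof (rule SUP_least)
      fix zs assume "zs \<in> L"
      have "ereal (chain_value p (u *\<^sub>R x + v *\<^sub>R y) zs)
          = ereal u * ereal (chain_value p x zs) + ereal v * ereal (chain_value p y zs)"
        by (simp add: chain_value_affine[OF uv(3)])
      also have "\<dots> \<le> ereal u * \<psi> x + ereal v * \<psi> y"
        using uv le[OF \<open>zs \<in> L\<close>] by (intro add_mono ereal_mult_left_mono) auto
      finally show "ereal (chain_value p (u *\<^sub>R x + v *\<^sub>R y) zs) \<le> ereal u * \<psi> x + ereal v * \<psi> y" .
    qed
  next
    have "{(x, r::real). \<psi> x \<le> ereal r} = (\<Inter>zs\<in>L. {q. chain_value p (fst q) zs \<le> snd q})"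
      by (auto simp: \<psi>_def SUP_le_iff)
    also have "closed \<dots>"
    proof (intro closed_INT ballI)
      fix zs
      have "continuous_on UNIV (\<lambda>q :: 'a \<times> real. chain_value p (fst q) zs)"
        by (cases zs) (auto intro!: continuous_intros)
      then show "closed {q :: 'a \<times> real. chain_value p (fst q) zs \<le> snd q}"
        by (intro closed_Collect_le) (auto intro!: continuous_intros)
    qed
    finally show "closed {(x, r::real). \<psi> x \<le> ereal r}" .
  qed
  have at: "\<psi> (fst p) \<le> 0"
    unfolding \<psi>_def using chain_value_le_0[OF cm \<open>p \<in> T\<close>] by (intro SUP_least) (auto simp: L_def)
  have step: "\<psi> x + ereal ((y - x) \<bullet> v) \<le> \<psi> y" if "(x, v) \<in> T" for x v y
  proof -
    have "\<psi> x \<le> \<psi> y - ereal ((y - x) \<bullet> v)"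
      unfolding \<psi>_def[of x]
    proof (rule SUP_least)
      fix zs assume "zs \<in> L"
      then have "(x, v) # zs \<in> L" using that by (auto simp: L_def)
      from le[OF this, of y] show "ereal (chain_value p x zs) \<le> \<psi> y - ereal ((y - x) \<bullet> v)"
        by (cases "\<psi> y") (auto simp: algebra_simps)
    qed
    then show ?thesis by (cases "\<psi> y"; cases "\<psi> x") auto
  qed
  have "T \<subseteq> subdifferential \<psi>"
  proof clarify
    fix x v assume "(x, v) \<in> T"
    \<comment> \<open>Finiteness on \<open>T\<close> comes from stepping back to the starting point,
      where cyclical monotonicity bounds the potential by 0.\<close>
    have "\<psi> x + ereal ((fst p - x) \<bullet> v) \<le> 0" using step[OF \<open>(x, v) \<in> T\<close>] at order_trans by blast
    then have "\<psi> x < \<infinity>" by (cases "\<psi> x") auto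
    then show "(x, v) \<in> subdifferential \<psi>"
      using step[OF \<open>(x, v) \<in> T\<close>] by (simp add: subdifferential_def)
  qed
  then show ?thesis using that cc by blast
qed

subsection \<open>Hausdorff measure of monotone graphs\<close>

lemma hausdorff_measure_eq_0_iff:
  "hausdorff_measure s A = 0 \<longleftrightarrow> (\<forall>\<delta>>0. \<forall>\<epsilon>>0. \<exists>U::nat \<Rightarrow> 'a::metric_space set.
     A \<subseteq> (\<Union>i. U i) \<and> (\<forall>i. bounded (U i) \<and> diameter (U i) \<le> \<delta>) \<and>
     (\<Sum>i. ennreal (diameter (U i) powr s)) < \<epsilon>)"
proof -
  have "hausdorff_measure s A = 0 \<longleftrightarrow> (\<forall>\<delta>>0. hausdorff_premeasure s \<delta> A \<le> 0)"
    unfolding hausdorff_measure_def by (simp only: le_zero_eq[symmetric] SUP_le_iff) auto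
  moreover have "hausdorff_premeasure s \<delta> A \<le> 0 \<longleftrightarrow>
      (\<forall>\<epsilon>>0. \<exists>U::nat \<Rightarrow> 'a::metric_space set.
        A \<subseteq> (\<Union>i. U i) \<and> (\<forall>i. bounded (U i) \<and> diameter (U i) \<le> \<delta>) \<and>
        (\<Sum>i. ennreal (diameter (U i) powr s)) < \<epsilon>)" for \<delta>
    unfolding hausdorff_premeasure_def INF_le_iff by auto
  ultimately show ?thesis by simp
qed

lemma hausdorff_measure_UN_eq_0:
  fixes A :: "nat \<Rightarrow> 'a::metric_space set"
  assumes "\<And>n. hausdorff_measure s (A n) = 0"
  shows "hausdorff_measure s (\<Union>n. A n) = 0"
  unfolding hausdorff_measure_eq_0_iff
proof (intro allI impI)
  fix \<delta> :: real and \<epsilon> :: ennreal assume "\<delta> > 0" "\<epsilon> > 0"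
  \<comment> \<open>The gap between \<open>e\<close> and \<epsilon> restores the strict inequality,
    which is lost when the strict bounds are summed.\<close>
  obtain e where e: "0 < e" "e < \<epsilon>" using dense[OF \<open>\<epsilon> > 0\<close>] by blast
  have "\<exists>U::nat \<Rightarrow> 'a set. A n \<subseteq> (\<Union>i. U i) \<and> (\<forall>i. bounded (U i) \<and> diameter (U i) \<le> \<delta>) \<and>
        (\<Sum>i. ennreal (diameter (U i) powr s)) < e * (1/2) ^ Suc n" for n
  proof -
    have "(1/2 :: ennreal) ^ Suc n \<noteq> 0"
      by (rule power_not_zero) (simp add: divide_ennreal_def)
    then have "0 < e * (1/2) ^ Suc n"
      using e(1) by (metis ennreal_zero_less_mult_iff not_gr_zero)
    then show ?thesis
      using assms[of n] \<open>\<delta> > 0\<close> unfolding hausdorff_measure_eq_0_iff by blast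
  qed
  then obtain U :: "nat \<Rightarrow> nat \<Rightarrow> 'a set" where U: "\<And>n. A n \<subseteq> (\<Union>i. U n i)"
    "\<And>n i. bounded (U n i)" "\<And>n i. diameter (U n i) \<le> \<delta>"
    "\<And>n. (\<Sum>i. ennreal (diameter (U n i) powr s)) < e * (1/2) ^ Suc n"
    by metis
  define V where "V k = case_prod U (prod_decode k)" for k
  have "(\<Sum>k. ennreal (diameter (V k) powr s)) =
      (\<Sum>k. (\<lambda>p. ennreal (diameter (case_prod U p) powr s)) (prod_decode k))"
    by (simp add: V_def)
  also have "\<dots> = (\<Sum>n. \<Sum>i. ennreal (diameter (U n i) powr s))"
    by (subst suminf_ennreal_2dimen[where g = "\<lambda>n. \<Sum>i. ennreal (diameter (U n i) powr s)"]) auto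
  also have "\<dots> \<le> (\<Sum>n. e * (1/2) ^ Suc n)"
    using U(4) by (intro suminf_le summableI) (auto intro: less_imp_le)
  also have "\<dots> = e"
  proof -
    have "(1/2 :: ennreal) = ennreal (1/2)" using divide_ennreal[of 1 2] by simp
    then have "(\<Sum>n. (1/2 :: ennreal) ^ Suc n) = (\<Sum>n. ennreal ((1/2) ^ Suc n))"
      by (simp only: ennreal_power zero_le_divide_1_iff zero_le_numeral)
    also have "\<dots> = ennreal 1"
      by (rule suminf_ennreal_eq[OF _ power_half_series]) simp
    finally show ?thesis by (simp only: ennreal_suminf_cmult ennreal_1 mult_1_right)
  qed
  finally have "(\<Sum>k. ennreal (diameter (V k) powr s)) < \<epsilon>" using e by simp
  moreover have "(\<Union>n. A n) \<subseteq> (\<Union>k. V k)"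
  proof
    fix x assume "x \<in> (\<Union>n. A n)"
    then obtain n i where "x \<in> U n i" using U(1) by blast
    then have "x \<in> V (prod_encode (n, i))" by (simp add: V_def)
    then show "x \<in> (\<Union>k. V k)" by blast
  qed
  moreover have "\<forall>k. bounded (V k) \<and> diameter (V k) \<le> \<delta>"
    using U(2,3) by (auto simp: V_def split: prod.split)
  ultimately show "\<exists>U::nat \<Rightarrow> 'a set. (\<Union>n. A n) \<subseteq> (\<Union>i. U i) \<and>
      (\<forall>i. bounded (U i) \<and> diameter (U i) \<le> \<delta>) \<and> (\<Sum>i. ennreal (diameter (U i) powr s)) < \<epsilon>"
    by blast
qed

text \<open>Minty's observation: monotonicity makes the cross term nonnegative when the square of
  the right-hand norm is expanded.\<close>

lemma norm_diff_le_norm_add_monotone: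
  fixes x y v w :: "'a::real_inner"
  assumes "0 \<le> (x - y) \<bullet> (v - w)"
  shows "norm (x - y) \<le> norm ((x + v) - (y + w))"
proof -
  have "(norm ((x + v) - (y + w)))\<^sup>2 = (norm (x - y))\<^sup>2 + 2 * ((x - y) \<bullet> (v - w)) + (norm (v - w))\<^sup>2"
    unfolding power2_norm_eq_inner
    by (simp add: inner_diff_left inner_diff_right inner_add_left inner_add_right inner_commute)
  then have "(norm (x - y))\<^sup>2 \<le> (norm ((x + v) - (y + w)))\<^sup>2" using assms by simp
  then show ?thesis by (rule power2_le_imp_le) simp
qed

text \<open>Within the hyperplane and the box, \<open>x + v\<close> has \<open>DIM('a) - 1\<close>
  free coordinates. A grid of mesh \<open>1 / k\<close> has of order
  \<open>k ^ (DIM('a) - 1)\<close> cells there, and by the Lipschitz bound each accounts for points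
  \<open>x\<close> in a set of diameter at most \<open>DIM('a) / k\<close>. The sum of the powers is
  of order \<open>k powr (DIM('a) - 1 - s)\<close>, which tends to 0.\<close>

lemma hausdorff_measure_monotone_slice:
  fixes G :: "('a::euclidean_space \<times> 'a) set" and R :: nat
  assumes mono: "\<And>x v y w. (x, v) \<in> G \<Longrightarrow> (y, w) \<in> G \<Longrightarrow> 0 \<le> (x - y) \<bullet> (v - w)"
    and e: "e \<in> Basis" and s: "s > real DIM('a) - 1"
  shows "hausdorff_measure s
     {x. \<exists>v. (x, v) \<in> G \<and> (x + v) \<bullet> e = q \<and> (\<forall>b\<in>Basis. \<bar>(x + v) \<bullet> b\<bar> \<le> real R)} = 0"
    (is "hausdorff_measure s ?A = 0")
  unfolding hausdorff_measure_eq_0_iff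
proof (intro allI impI)
  fix \<delta> :: real and \<epsilon> :: ennreal assume "\<delta> > 0" "\<epsilon> > 0"
  obtain \<eta> where \<eta>: "0 < \<eta>" "ennreal \<eta> < \<epsilon>"
    using dense[OF \<open>\<epsilon> > 0\<close>] by (metis ennreal_cases ennreal_less_zero_iff less_top_ennreal not_less_iff_gr_or_eq top.extremum_strict)
  let ?d = "real DIM('a)"
  \<comment> \<open>\<open>c\<close> collects the factors independent of \<open>k\<close>: the
    number of cells will be at most \<open>(3 * (R + 1) * k) ^ (DIM('a) - 1)\<close>, and each
    diameter contributes \<open>DIM('a) powr s\<close>.\<close>
  define c where "c = (3 * (real R + 1)) ^ (DIM('a) - 1) * ?d powr s"
  have d1: "DIM('a) \<ge> 1" using DIM_positive[where 'a='a] by linarith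
  have "((\<lambda>k. c * real k powr (?d - 1 - s)) \<longlongrightarrow> c * 0) sequentially"
    using s by (intro tendsto_intros tendsto_neg_powr filterlim_real_sequentially) auto
  then have "\<forall>\<^sub>F k in sequentially. c * real k powr (?d - 1 - s) < \<eta>"
    using \<eta>(1) by (intro order_tendstoD(2)) auto
  moreover have "((\<lambda>k. ?d / real k) \<longlongrightarrow> 0) sequentially"
    by (rule lim_const_over_n)
  then have "\<forall>\<^sub>F k in sequentially. ?d / real k < \<delta>"
    using \<open>\<delta> > 0\<close> by (rule order_tendstoD(2))
  ultimately have "\<forall>\<^sub>F k in sequentially. c * real k powr (?d - 1 - s) < \<eta> \<and> ?d / real k < \<delta> \<and> k > 0"
    by (intro eventually_conj eventually_gt_at_top)
  then obtain k :: nat where k: "c * real k powr (?d - 1 - s) < \<eta>" "?d / real k < \<delta>" "k > 0"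
    by (auto simp: eventually_sequentially)
  \<comment> \<open>Cells are labelled by the floors of the scaled coordinates other than
    \<open>e\<close>; each floor takes one of \<open>2 * k * R + 1\<close> values.\<close>
  define C where "C = PiE (Basis - {e}) (\<lambda>_. {- int (k * R)..int (k * R)})"
  have "finite C" by (auto simp: C_def intro!: finite_PiE)
  have cardC: "card C = (2 * k * R + 1) ^ (DIM('a) - 1)"
  proof -
    have "card C = (\<Prod>b\<in>Basis - {e}. card {- int (k * R)..int (k * R)})"
      unfolding C_def by (rule card_PiE) simp
    also have "\<dots> = (2 * k * R + 1) ^ (DIM('a) - 1)"
      using e by (simp add: nat_add_distrib nat_mult_distrib algebra_simps)
    finally show ?thesis .
  qed
  define U where "U f = {x. \<exists>v. (x, v) \<in> G \<and> (x + v) \<bullet> e = q \<and>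
      (\<forall>b\<in>Basis - {e}. \<lfloor>real k * ((x + v) \<bullet> b)\<rfloor> = f b)}" for f :: "'a \<Rightarrow> int"
  have dist: "norm (x - y) \<le> ?d / real k" if "x \<in> U f" "y \<in> U f" for x y f
  proof -
    from that(1) obtain v where v: "(x, v) \<in> G" "(x + v) \<bullet> e = q"
      "\<forall>b\<in>Basis - {e}. \<lfloor>real k * ((x + v) \<bullet> b)\<rfloor> = f b"
      unfolding U_def by blast
    from that(2) obtain w where w: "(y, w) \<in> G" "(y + w) \<bullet> e = q"
      "\<forall>b\<in>Basis - {e}. \<lfloor>real k * ((y + w) \<bullet> b)\<rfloor> = f b"
      unfolding U_def by blast
    note vw = v w
    have "norm (x - y) \<le> norm ((x + v) - (y + w))"
      using mono vw by (intro norm_diff_le_norm_add_monotone) blast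
    also have "\<dots> \<le> (\<Sum>b\<in>Basis. \<bar>((x + v) - (y + w)) \<bullet> b\<bar>)" by (rule norm_le_l1)
    also have "\<dots> \<le> (\<Sum>b\<in>(Basis::'a set). 1 / real k)"
    proof (rule sum_mono)
      fix b :: 'a assume b: "b \<in> Basis"
      show "\<bar>((x + v) - (y + w)) \<bullet> b\<bar> \<le> 1 / real k"
      proof (cases "b = e")
        case True
        then show ?thesis using vw by (simp add: inner_diff_left)
      next
        case False
        then have "\<lfloor>real k * ((x + v) \<bullet> b)\<rfloor> = \<lfloor>real k * ((y + w) \<bullet> b)\<rfloor>" using vw b by auto
        then have "\<bar>real k * ((x + v) \<bullet> b) - real k * ((y + w) \<bullet> b)\<bar> \<le> 1" by linarith
        then have "real k * \<bar>((x + v) - (y + w)) \<bullet> b\<bar> \<le> 1"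
          by (simp add: inner_diff_left abs_mult flip: right_diff_distrib)
        then show ?thesis using k(3) by (simp add: field_simps)
      qed
    qed
    also have "\<dots> = ?d / real k" by simp
    finally show ?thesis .
  qed
  have bd: "bounded (U f)" for f
    unfolding bounded_two_points using dist by (auto simp: dist_norm)
  have diam: "diameter (U f) \<le> ?d / real k" for f
    using dist by (intro diameter_le) auto
  obtain h where h: "bij_betw h {0..<card C} C" using ex_bij_betw_nat_finite[OF \<open>finite C\<close>] by blast
  \<comment> \<open>The finite family is padded with empty sets, each contributing
    \<open>0 powr s = 0\<close>.\<close>
  define V where "V i = (if i < card C then U (h i) else {})" for i
  have "?A \<subseteq> (\<Union>i. V i)"
  proof
    fix x assume "x \<in> ?A"
    then obtain v where v: "(x, v) \<in> G" "(x + v) \<bullet> e = q" "\<And>b. b \<in> Basis \<Longrightarrow> \<bar>(x + v) \<bullet> b\<bar> \<le> real R"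
      by blast
    define f where "f = restrict (\<lambda>b. \<lfloor>real k * ((x + v) \<bullet> b)\<rfloor>) (Basis - {e})"
    have "f \<in> C"
    proof -
      have "\<lfloor>real k * ((x + v) \<bullet> b)\<rfloor> \<in> {- int (k * R)..int (k * R)}" if "b \<in> Basis" for b
      proof -
        have "\<bar>real k * ((x + v) \<bullet> b)\<bar> \<le> real k * real R"
          using v(3)[OF that] by (simp add: abs_mult mult_left_mono)
        then have "- real (k * R) \<le> real k * ((x + v) \<bullet> b)" "real k * ((x + v) \<bullet> b) \<le> real (k * R)"
          by auto
        then show ?thesis by (simp add: le_floor_iff floor_le_iff)
      qed
      then show ?thesis by (auto simp: C_def f_def)
    qed
    then obtain i where "i < card C" "h i = f" using h unfolding bij_betw_def by (metis atLeastLessThan_iff imageE)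
    moreover have "x \<in> U f" using v by (auto simp: U_def f_def)
    ultimately have "x \<in> V i" by (simp add: V_def)
    then show "x \<in> (\<Union>i. V i)" by blast
  qed
  moreover have "\<forall>i. bounded (V i) \<and> diameter (V i) \<le> \<delta>"
    using bd diam k(2) \<open>\<delta> > 0\<close> by (auto simp: V_def intro: order_trans[OF diam])
  moreover have "(\<Sum>i. ennreal (diameter (V i) powr s)) < \<epsilon>"
  proof -
    have s0: "s > 0" using s d1 by linarith
    have "(\<Sum>i. ennreal (diameter (V i) powr s)) = (\<Sum>i<card C. ennreal (diameter (V i) powr s))"
      using s0 by (intro suminf_finite) (auto simp: V_def)
    also have "\<dots> \<le> (\<Sum>i<card C. ennreal ((?d / real k) powr s))"
      using bd diam s0 by (intro sum_mono ennreal_leI powr_mono2) (auto simp: V_def diameter_ge_0)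
    also have "\<dots> = ennreal (real (card C) * (?d / real k) powr s)"
      by (simp add: ennreal_mult ennreal_of_nat_eq_real_of_nat)
    also have "\<dots> \<le> ennreal (c * real k powr (?d - 1 - s))"
    proof (rule ennreal_leI)
      have "real (2 * k * R + 1) \<le> 3 * (real R + 1) * real k"
      proof -
        have "1 \<le> real k" "0 \<le> real R * real k" using k(3) by auto
        moreover have eq: "3 * (real R + 1) * real k = 3 * (real R * real k) + 3 * real k"
          "real (2 * k * R + 1) = 2 * (real R * real k) + 1" by (simp_all add: algebra_simps)
        ultimately show ?thesis unfolding eq by linarith
      qed
      then have "real (card C) \<le> (3 * (real R + 1) * real k) ^ (DIM('a) - 1)"
        unfolding cardC of_nat_power by (intro power_mono) auto
      also have "\<dots> = (3 * (real R + 1)) ^ (DIM('a) - 1) * real k powr (?d - 1)"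
        using k(3) d1 by (simp add: power_mult_distrib powr_realpow[symmetric] of_nat_diff)
      finally have "real (card C) * (?d / real k) powr s \<le>
          (3 * (real R + 1)) ^ (DIM('a) - 1) * real k powr (?d - 1) * (?d powr s / real k powr s)"
        by (intro mult_mono) (auto simp: powr_divide)
      also have "\<dots> = c * real k powr (?d - 1 - s)"
        by (simp add: c_def powr_diff)
      finally show "real (card C) * (?d / real k) powr s \<le> c * real k powr (?d - 1 - s)" .
    qed
    also have "\<dots> < \<epsilon>" using k(1) \<eta> by (meson ennreal_leI less_imp_le order_le_less_trans)
    finally show ?thesis .
  qed
  ultimately show "\<exists>U::nat \<Rightarrow> 'a set. ?A \<subseteq> (\<Union>i. U i) \<and>
      (\<forall>i. bounded (U i) \<and> diameter (U i) \<le> \<delta>) \<and> (\<Sum>i. ennreal (diameter (U i) powr s)) < \<epsilon>"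
    by blast
qed

lemma hausdorff_dim_le:
  fixes A :: "'a::metric_space set"
  assumes "\<And>s. s > t \<Longrightarrow> s > 0 \<Longrightarrow> hausdorff_measure s A = 0" "t \<ge> 0"
  shows "hausdorff_dim A \<le> ereal t"
proof (rule ereal_le_epsilon2)
  fix e :: real assume "e > 0"
  then have "hausdorff_dim A \<le> ereal (t + e)"
    unfolding hausdorff_dim_def using assms by (intro INF_lower) auto
  then show "hausdorff_dim A \<le> ereal t + ereal e" by simp
qed

subsection \<open>The Borel measure induced by a content on compact sets\<close>

definition inner_content :: "('b::topological_space set \<Rightarrow> ennreal) \<Rightarrow> 'b set \<Rightarrow> ennreal" where
  "inner_content \<rho> U = (SUP K\<in>{K. compact K \<and> K \<subseteq> U}. \<rho> K)"

text \<open>The two-step extension familiar from Haar measure: open sets are measured from inside by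
  compact sets, arbitrary sets from outside by open sets.\<close>

definition content_outer :: "('b::topological_space set \<Rightarrow> ennreal) \<Rightarrow> 'b set \<Rightarrow> ennreal" where
  "content_outer \<rho> A = (INF U\<in>{U. open U \<and> A \<subseteq> U}. inner_content \<rho> U)"

text \<open>The axioms are relations between finitely many values and hence survive pointwise
  limits; countable subadditivity is supplied later by compactness.\<close>

locale compact_content =
  fixes \<rho> :: "'b::euclidean_space set \<Rightarrow> ennreal"
  assumes content_empty: "\<rho> {} = 0"
    and content_mono: "compact K \<Longrightarrow> compact L \<Longrightarrow> K \<subseteq> L \<Longrightarrow> \<rho> K \<le> \<rho> L"
    and content_Un_le: "compact K \<Longrightarrow> compact L \<Longrightarrow> \<rho> (K \<union> L) \<le> \<rho> K + \<rho> L"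
    and content_Un_disjoint: "compact K \<Longrightarrow> compact L \<Longrightarrow> K \<inter> L = {} \<Longrightarrow> \<rho> K + \<rho> L \<le> \<rho> (K \<union> L)"
begin

lemma inner_content_mono: "U \<subseteq> V \<Longrightarrow> inner_content \<rho> U \<le> inner_content \<rho> V"
  unfolding inner_content_def by (intro SUP_subset_mono) auto

lemma inner_content_upper: "compact K \<Longrightarrow> K \<subseteq> U \<Longrightarrow> \<rho> K \<le> inner_content \<rho> U"
  unfolding inner_content_def by (intro SUP_upper) auto

lemma content_outer_open: "open U \<Longrightarrow> content_outer \<rho> U = inner_content \<rho> U"
  unfolding content_outer_def by (intro antisym INF_lower INF_greatest inner_content_mono) auto

lemma content_outer_mono: "A \<subseteq> B \<Longrightarrow> content_outer \<rho> A \<le> content_outer \<rho> B"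
  unfolding content_outer_def by (intro INF_superset_mono) auto

lemma content_outer_lower: "open U \<Longrightarrow> A \<subseteq> U \<Longrightarrow> content_outer \<rho> A \<le> inner_content \<rho> U"
  unfolding content_outer_def by (intro INF_lower) auto

lemma content_outer_compact: "compact K \<Longrightarrow> \<rho> K \<le> content_outer \<rho> K"
  unfolding content_outer_def by (intro INF_greatest inner_content_upper) auto

text \<open>\<open>K - U\<close> and \<open>K - V\<close> are disjoint compact sets. Removing from
  \<open>K\<close> one of two disjoint neighbourhoods of them leaves a part in \<open>U\<close>,
  removing the other a part in \<open>V\<close>, and together the parts exhaust
  \<open>K\<close>.\<close>

lemma compact_split:
  fixes K :: "'b set"
  assumes "compact K" "open U" "open V" "K \<subseteq> U \<union> V"
  obtains K1 K2 where "compact K1" "compact K2" "K1 \<subseteq> U" "K2 \<subseteq> V" "K = K1 \<union> K2"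
proof -
  have "compact (K - U)" "compact (K - V)" "(K - U) \<inter> (K - V) = {}"
    using assms by (auto simp: compact_diff)
  then obtain U' V' where "open U'" "open V'" "K - U \<subseteq> U'" "K - V \<subseteq> V'" "U' \<inter> V' = {}"
    using separation_normal_compact[of "K - U" "K - V"] compact_imp_closed by metis
  then show ?thesis
    using assms by (intro that[of "K - U'" "K - V'"]) (auto simp: compact_diff)
qed

lemma inner_content_Un:
  assumes "open U" "open V"
  shows "inner_content \<rho> (U \<union> V) \<le> inner_content \<rho> U + inner_content \<rho> V"
  unfolding inner_content_def[of \<rho> "U \<union> V"]
proof (rule SUP_least)
  fix K assume "K \<in> {K. compact K \<and> K \<subseteq> U \<union> V}"
  then obtain K1 K2 where K: "compact K1" "compact K2" "K1 \<subseteq> U" "K2 \<subseteq> V" "K = K1 \<union> K2"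
    using compact_split[of K U V] assms by blast
  have "\<rho> K \<le> \<rho> K1 + \<rho> K2" using content_Un_le K by simp
  also have "\<dots> \<le> inner_content \<rho> U + inner_content \<rho> V"
    using K by (intro add_mono inner_content_upper)
  finally show "\<rho> K \<le> inner_content \<rho> U + inner_content \<rho> V" .
qed

lemma inner_content_UN_finite:
  fixes n :: nat
  assumes "\<And>i. open (U i)"
  shows "inner_content \<rho> (\<Union>i<n. U i) \<le> (\<Sum>i<n. inner_content \<rho> (U i))"
proof (induction n)
  case 0
  show ?case using content_empty by (auto simp: inner_content_def)
next
  case (Suc n)
  have "inner_content \<rho> (\<Union>i<Suc n. U i) = inner_content \<rho> ((\<Union>i<n. U i) \<union> U n)"
    by (simp add: lessThan_Suc Un_commute)
  also have "\<dots> \<le> inner_content \<rho> (\<Union>i<n. U i) + inner_content \<rho> (U n)"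
    using assms by (intro inner_content_Un) auto
  also have "\<dots> \<le> (\<Sum>i<Suc n. inner_content \<rho> (U i))" using Suc.IH by (simp add: add_right_mono)
  finally show ?case .
qed

text \<open>This is where countable subadditivity originates: a compact subset of the union is
  already covered by finitely many of the open sets.\<close>

lemma inner_content_UN:
  assumes "\<And>i::nat. open (U i)"
  shows "inner_content \<rho> (\<Union>i. U i) \<le> (\<Sum>i. inner_content \<rho> (U i))"
  unfolding inner_content_def[of \<rho> "\<Union>i. U i"]
proof (rule SUP_least)
  fix K assume K: "K \<in> {K. compact K \<and> K \<subseteq> (\<Union>i. U i)}"
  then obtain C where C: "finite C" "K \<subseteq> (\<Union>i\<in>C. U i)"
    using compactE_image[of K UNIV U] assms by auto
  obtain n where "C \<subseteq> {..<n}" using finite_nat_iff_bounded[THEN iffD1, OF C(1)] by blast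
  then have "K \<subseteq> (\<Union>i<n. U i)" using C by blast
  then have "\<rho> K \<le> inner_content \<rho> (\<Union>i<n. U i)" using K inner_content_upper by blast
  also have "\<dots> \<le> (\<Sum>i<n. inner_content \<rho> (U i))" by (rule inner_content_UN_finite[OF assms])
  also have "\<dots> \<le> (\<Sum>i. inner_content \<rho> (U i))" by (rule sum_le_suminf) auto
  finally show "\<rho> K \<le> (\<Sum>i. inner_content \<rho> (U i))" .
qed

lemma content_outer_UN:
  fixes A :: "nat \<Rightarrow> 'b set"
  shows "content_outer \<rho> (\<Union>i. A i) \<le> (\<Sum>i. content_outer \<rho> (A i))"
proof (rule ennreal_le_epsilon)
  fix e :: real assume fin: "(\<Sum>i. content_outer \<rho> (A i)) < top" and e: "0 < e"
  have "\<exists>U. open U \<and> A i \<subseteq> U \<and> inner_content \<rho> U \<le> content_outer \<rho> (A i) + ennreal (e * (1/2) ^ Suc i)" for i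
  proof -
    have "content_outer \<rho> (A i) < top"
      using fin ennreal_suminf_lessD by blast
    then have "content_outer \<rho> (A i) < content_outer \<rho> (A i) + ennreal (e * (1/2) ^ Suc i)"
      using e by (cases "content_outer \<rho> (A i)")
        (auto simp flip: ennreal_plus simp: ennreal_less_iff)
    then show ?thesis
      unfolding content_outer_def[of \<rho> "A i"] INF_less_iff by (auto intro: less_imp_le)
  qed
  then obtain U where U: "\<And>i. open (U i)" "\<And>i. A i \<subseteq> U i"
    "\<And>i. inner_content \<rho> (U i) \<le> content_outer \<rho> (A i) + ennreal (e * (1/2) ^ Suc i)"
    by metis
  have "content_outer \<rho> (\<Union>i. A i) \<le> inner_content \<rho> (\<Union>i. U i)"
    using U by (intro content_outer_lower) auto
  also have "\<dots> \<le> (\<Sum>i. inner_content \<rho> (U i))" by (rule inner_content_UN[OF U(1)])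
  also have "\<dots> \<le> (\<Sum>i. content_outer \<rho> (A i) + ennreal (e * (1/2) ^ Suc i))"
    using U(3) by (intro suminf_le summableI) auto
  also have "\<dots> = (\<Sum>i. content_outer \<rho> (A i)) + (\<Sum>i. ennreal (e * (1/2) ^ Suc i))"
    by (rule suminf_add[symmetric]) auto
  also have "(\<Sum>i. ennreal (e * (1/2) ^ Suc i)) = ennreal (e * 1)"
    using e by (intro suminf_ennreal_eq sums_mult power_half_series) auto
  finally show "content_outer \<rho> (\<Union>i. A i) \<le> (\<Sum>i. content_outer \<rho> (A i)) + ennreal e" by simp
qed

lemma content_outer_empty: "content_outer \<rho> {} = 0"
  using content_empty content_outer_open[of "{}"] by (simp add: inner_content_def)

lemma outer_measure_space_content: "outer_measure_space UNIV (content_outer \<rho>)"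
  by (auto simp: outer_measure_space_def positive_def increasing_def countably_subadditive_def
      content_outer_empty content_outer_mono content_outer_UN)

text \<open>Caratheodory's inequality for an open test set. For compact \<open>K\<close> inside
  \<open>V \<inter> U\<close>, the open set \<open>V - K\<close> contains \<open>V - U\<close>, and
  every compact \<open>L\<close> in it is disjoint from \<open>K\<close>, so additivity applies;
  then suprema are taken over \<open>L\<close> and over \<open>K\<close>.\<close>

lemma inner_content_split:
  assumes "open U" "open V"
  shows "inner_content \<rho> (V \<inter> U) + content_outer \<rho> (V - U) \<le> inner_content \<rho> V"
proof -
  have *: "\<rho> K + content_outer \<rho> (V - U) \<le> inner_content \<rho> V" if K: "compact K" "K \<subseteq> V \<inter> U" for K
  proof -
    have "\<rho> K + content_outer \<rho> (V - U) \<le> \<rho> K + inner_content \<rho> (V - K)"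
      using K assms by (intro add_mono content_outer_lower order_refl open_Diff compact_imp_closed) auto
    also have "\<dots> = (SUP L\<in>{L. compact L \<and> L \<subseteq> V - K}. \<rho> K + \<rho> L)"
      unfolding inner_content_def
      by (subst ennreal_SUP_add_right) (auto intro: exI[of _ "{}"])
    also have "\<dots> \<le> inner_content \<rho> V"
    proof (rule SUP_least)
      fix L assume "L \<in> {L. compact L \<and> L \<subseteq> V - K}"
      then have L: "compact L" "K \<inter> L = {}" "K \<union> L \<subseteq> V" using K by auto
      have "\<rho> K + \<rho> L \<le> \<rho> (K \<union> L)" using content_Un_disjoint K L by simp
      also have "\<dots> \<le> inner_content \<rho> V" using K L by (intro inner_content_upper) auto
      finally show "\<rho> K + \<rho> L \<le> inner_content \<rho> V" .
    qed
    finally show ?thesis .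
  qed
  have "inner_content \<rho> (V \<inter> U) + content_outer \<rho> (V - U)
      = (SUP K\<in>{K. compact K \<and> K \<subseteq> V \<inter> U}. \<rho> K + content_outer \<rho> (V - U))"
    unfolding inner_content_def[of \<rho> "V \<inter> U"]
    by (subst ennreal_SUP_add_left) (auto intro: exI[of _ "{}"])
  also have "\<dots> \<le> inner_content \<rho> V" using * by (intro SUP_least) auto
  finally show ?thesis .
qed

lemma open_in_lambda_system:
  assumes "open U"
  shows "U \<in> lambda_system UNIV UNIV (content_outer \<rho>)"
proof -
  have "content_outer \<rho> (A \<inter> U) + content_outer \<rho> (A - U) = content_outer \<rho> A" for A
  proof (rule antisym)
    show "content_outer \<rho> (A \<inter> U) + content_outer \<rho> (A - U) \<le> content_outer \<rho> A"
      unfolding content_outer_def[of \<rho> A]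
    proof (rule INF_greatest)
      fix V assume V: "V \<in> {V. open V \<and> A \<subseteq> V}"
      have "content_outer \<rho> (A \<inter> U) + content_outer \<rho> (A - U)
          \<le> inner_content \<rho> (V \<inter> U) + content_outer \<rho> (V - U)"
        using V assms by (intro add_mono content_outer_lower content_outer_mono) auto
      also have "\<dots> \<le> inner_content \<rho> V" using V assms by (intro inner_content_split) auto
      finally show "content_outer \<rho> (A \<inter> U) + content_outer \<rho> (A - U) \<le> inner_content \<rho> V" .
    qed
    have "content_outer \<rho> A = content_outer \<rho> (\<Union>i. binaryset (A \<inter> U) (A - U) i)"
      by (simp add: UN_binaryset_eq Un_Diff_Int Int_Un_distrib Un_commute)
    also have "\<dots> \<le> (\<Sum>i. content_outer \<rho> (binaryset (A \<inter> U) (A - U) i))"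
      by (rule content_outer_UN)
    also have "\<dots> = content_outer \<rho> (A \<inter> U) + content_outer \<rho> (A - U)"
      by (rule suminf_binaryset_eq[where f = "content_outer \<rho>", OF content_outer_empty])
    finally show "content_outer \<rho> A \<le> content_outer \<rho> (A \<inter> U) + content_outer \<rho> (A - U)" .
  qed
  then show ?thesis
    unfolding lambda_system_def by (auto simp: Int_commute Diff_eq)
qed

text \<open>On compact sets only an inequality comes out: the induced measure is outer regular,
  while a content may jump up on every neighbourhood of a compact set.\<close>

lemma content_measure:
  obtains M :: "'b measure" where "sets M = sets borel"
    "\<And>U. open U \<Longrightarrow> emeasure M U = (SUP K\<in>{K. compact K \<and> K \<subseteq> U}. \<rho> K)"
    "\<And>K. compact K \<Longrightarrow> \<rho> K \<le> emeasure M K"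
proof -
  let ?L = "lambda_system UNIV UNIV (content_outer \<rho>)"
  interpret P: sigma_algebra "UNIV :: 'b set" "UNIV"
    using sigma_algebra_Pow[of "UNIV :: 'b set"] by simp
  have ms: "measure_space UNIV ?L (content_outer \<rho>)"
    by (rule P.caratheodory_lemma[OF outer_measure_space_content])
  interpret L: sigma_algebra UNIV ?L
    using ms by (simp add: measure_space_def)
  have sub: "sets borel \<subseteq> ?L"
    unfolding borel_def
    using L.sigma_sets_subset[of "{S. open S}"] open_in_lambda_system by auto
  have "measure_space UNIV (sets borel) (content_outer \<rho>)"
    using measure_down[OF ms _ sub] sets.sigma_algebra_axioms[of borel] by simp
  define M where "M = measure_of UNIV (sets borel) (content_outer \<rho>)"
  have M: "sets M = sets borel" using sets.sigma_sets_eq[of borel] by (simp add: M_def)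
  have em: "emeasure M A = content_outer \<rho> A" if "A \<in> sets borel" for A
    unfolding M_def using \<open>measure_space UNIV (sets borel) (content_outer \<rho>)\<close> that
    by (intro emeasure_measure_of_sigma) (auto simp: measure_space_def)
  show ?thesis
  proof (rule that[of M])
    show "emeasure M U = (SUP K\<in>{K. compact K \<and> K \<subseteq> U}. \<rho> K)" if "open U" for U
      using that by (simp add: em content_outer_open inner_content_def)
    show "\<rho> K \<le> emeasure M K" if "compact K" for K
      using that by (simp add: em content_outer_compact compact_imp_closed borel_closed)
  qed (rule M)
qed

end

subsection \<open>Optimal transport between finite sets\<close>

text \<open>Tychonoff's theorem for the topology of the function type; it serves both for finite
  plans and for the space of all set functions.\<close>

lemma compact_PiE_UNIV:
  fixes S :: "'i \<Rightarrow> 'b::topological_space set"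
  assumes "\<And>i. compact (S i)"
  shows "compact (PiE UNIV S)"
proof -
  have "compactin (product_topology (\<lambda>i. euclidean) UNIV) (PiE UNIV S)"
    using assms unfolding compactin_PiE by simp
  then show ?thesis unfolding euclidean_product_topology by simp
qed

text \<open>The cyclic shift permutes the indices; this is why moving mass along a cycle preserves
  the second marginal.\<close>

lemma sum_Suc_mod_eq:
  fixes f :: "nat \<Rightarrow> 'c::comm_monoid_add"
  shows "(\<Sum>i<n. f (Suc i mod n)) = (\<Sum>i<n. f i)"
proof (cases n)
  case (Suc m)
  have "(\<Sum>i<Suc m. f (Suc i mod Suc m)) = (\<Sum>i<m. f (Suc i)) + f 0" by simp
  also have "\<dots> = (\<Sum>i<Suc m. f i)"
    by (simp only: sum.lessThan_Suc_shift add.commute)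
  finally show ?thesis using Suc by simp
qed simp

text \<open>Plans are total functions vanishing off \<open>I \<times> J\<close>, so that they form a
  closed subset of a compact product of intervals.\<close>

definition transport_plans :: "'a set \<Rightarrow> 'b set \<Rightarrow> ('a \<Rightarrow> real) \<Rightarrow> ('b \<Rightarrow> real) \<Rightarrow> ('a \<times> 'b \<Rightarrow> real) set" where
  "transport_plans I J a b = {w. (\<forall>z. 0 \<le> w z) \<and> (\<forall>z. z \<notin> I \<times> J \<longrightarrow> w z = 0) \<and>
     (\<forall>p\<in>I. (\<Sum>q\<in>J. w (p, q)) = a p) \<and> (\<forall>q\<in>J. (\<Sum>p\<in>I. w (p, q)) = b q)}"

lemma compact_transport_plans:
  assumes "finite I" "finite J"
  shows "compact (transport_plans I J a b)"
proof -
  let ?B = "PiE UNIV (\<lambda>z. {0..\<Sum>p\<in>I. \<bar>a p\<bar>}) :: ('a \<times> 'b \<Rightarrow> real) set"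
  have cont: "continuous_on UNIV (\<lambda>w. w z)" for z :: "'a \<times> 'b"
    by (rule continuous_on_product_coordinates)
  have "transport_plans I J a b = (\<Inter>z. {w. 0 \<le> w z}) \<inter> (\<Inter>z\<in>- (I \<times> J). {w. w z = 0}) \<inter>
     (\<Inter>p\<in>I. {w. (\<Sum>q\<in>J. w (p, q)) = a p}) \<inter> (\<Inter>q\<in>J. {w. (\<Sum>p\<in>I. w (p, q)) = b q})"
    by (auto simp: transport_plans_def)
  also have "closed \<dots>"
    by (intro closed_Int closed_INT ballI closed_Collect_le closed_Collect_eq continuous_on_sum cont
        continuous_on_const)
  finally have "closed (transport_plans I J a b)" .
  moreover have "transport_plans I J a b \<subseteq> ?B"
  proof
    fix w assume w: "w \<in> transport_plans I J a b"
    have "w z \<le> (\<Sum>p\<in>I. \<bar>a p\<bar>)" for z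
    proof (cases "z \<in> I \<times> J")
      case True
      then obtain p q where z: "z = (p, q)" "p \<in> I" "q \<in> J" by blast
      have "w (p, q) \<le> (\<Sum>q\<in>J. w (p, q))"
        using w z assms by (intro member_le_sum) (auto simp: transport_plans_def)
      also have "\<dots> \<le> \<bar>a p\<bar>" using w z by (auto simp: transport_plans_def)
      also have "\<dots> \<le> (\<Sum>p\<in>I. \<bar>a p\<bar>)" using z assms by (intro member_le_sum) auto
      finally show ?thesis using z by simp
    next
      case False
      then have "w z = 0" using w unfolding transport_plans_def by blast
      then show ?thesis by (simp add: sum_nonneg)
    qed
    then show "w \<in> ?B" using w by (auto simp: transport_plans_def)
  qed
  moreover have "compact ?B" by (intro compact_PiE_UNIV) simp
  ultimately show ?thesis using compact_Int_closed[of ?B "transport_plans I J a b"] by (simp add: Int_absorb1)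
qed

lemma transport_plans_nonempty:
  assumes "finite I" "finite J" "\<And>p. 0 \<le> a p" "\<And>q. 0 \<le> b q" "sum a I = sum b J"
  shows "transport_plans I J a b \<noteq> {}"
proof (cases "sum a I = 0")
  case True
  then have "a p = 0" if "p \<in> I" for p
    using assms that sum_nonneg_eq_0_iff[of I a] by simp
  moreover have "b q = 0" if "q \<in> J" for q
    using assms that True sum_nonneg_eq_0_iff[of J b] by simp
  ultimately have "(\<lambda>z. 0) \<in> transport_plans I J a b" by (auto simp: transport_plans_def)
  then show ?thesis by blast
next
  case False
  \<comment> \<open>The product plan, normalised by the common total mass; total mass 0 has been
    split off.\<close>
  define w where "w z = (if z \<in> I \<times> J then a (fst z) * b (snd z) / sum a I else 0)" for z
  have pos: "0 \<le> sum a I" using assms by (intro sum_nonneg)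
  have "(\<Sum>q\<in>J. w (p, q)) = a p" if "p \<in> I" for p
  proof -
    have "(\<Sum>q\<in>J. w (p, q)) = (\<Sum>q\<in>J. a p * b q / sum a I)"
      using that by (intro sum.cong) (auto simp: w_def)
    also have "\<dots> = a p * sum b J / sum a I" by (simp add: sum_distrib_left sum_divide_distrib)
    finally show ?thesis using False assms(5) by simp
  qed
  moreover have "(\<Sum>p\<in>I. w (p, q)) = b q" if "q \<in> J" for q
  proof -
    have "(\<Sum>p\<in>I. w (p, q)) = (\<Sum>p\<in>I. a p * b q / sum a I)"
      using that by (intro sum.cong) (auto simp: w_def)
    also have "\<dots> = sum a I * b q / sum a I" by (simp add: sum_distrib_right sum_divide_distrib)
    finally show ?thesis using False by simp
  qed
  moreover have "0 \<le> w z" for z using assms pos by (auto simp: w_def)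
  moreover have "w z = 0" if "z \<notin> I \<times> J" for z using that by (auto simp: w_def)
  ultimately have "w \<in> transport_plans I J a b" unfolding transport_plans_def by blast
  then show ?thesis by blast
qed

lemma sum_count_fst:
  fixes x :: "nat \<Rightarrow> 'a" and y :: "nat \<Rightarrow> 'b"
  assumes "finite J" "\<And>i. i < n \<Longrightarrow> y i \<in> J"
  shows "(\<Sum>q\<in>J. \<Sum>i<n. if (x i, y i) = (p, q) then 1 else (0::real)) = (\<Sum>i<n. if x i = p then 1 else 0)"
proof -
  have "(\<Sum>q\<in>J. if (x i, y i) = (p, q) then 1 else (0::real)) = (if x i = p then 1 else 0)" if "i < n" for i
    using assms that by (cases "x i = p") auto
  then show ?thesis by (subst sum.swap) simp
qed

lemma sum_count_snd:
  fixes x :: "nat \<Rightarrow> 'a" and y :: "nat \<Rightarrow> 'b"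
  assumes "finite I" "\<And>i. i < n \<Longrightarrow> x i \<in> I"
  shows "(\<Sum>p\<in>I. \<Sum>i<n. if (x i, y i) = (p, q) then 1 else (0::real)) = (\<Sum>i<n. if y i = q then 1 else 0)"
proof -
  have "(\<Sum>p\<in>I. if (x i, y i) = (p, q) then 1 else (0::real)) = (if y i = q then 1 else 0)" if "i < n" for i
    using assms that by (cases "y i = q") auto
  then show ?thesis by (subst sum.swap) simp
qed

lemma sum_count_weighted:
  fixes z :: "nat \<Rightarrow> 'a" and c :: "'a \<Rightarrow> real"
  assumes "finite Z" "\<And>i. i < n \<Longrightarrow> z i \<in> Z"
  shows "(\<Sum>t\<in>Z. (\<Sum>i<n. if z i = t then 1 else 0) * c t) = (\<Sum>i<n. c (z i))"
proof -
  have "(\<Sum>t\<in>Z. (\<Sum>i<n. if z i = t then 1 else 0) * c t)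
      = (\<Sum>t\<in>Z. \<Sum>i<n. if z i = t then c t else 0)"
    unfolding sum_distrib_right by (intro sum.cong refl) auto
  also have "\<dots> = (\<Sum>i<n. \<Sum>t\<in>Z. if z i = t then c t else 0)" by (rule sum.swap)
  also have "\<dots> = (\<Sum>i<n. c (z i))" using assms by (intro sum.cong refl) auto
  finally show ?thesis .
qed

(* Moving a little mass along a cycle of the support gives another plan, so it cannot increase the
   objective; counting multiplicities covers cycles that visit a point repeatedly. *)
lemma optimal_plan_cyclically_monotone:
  fixes I J :: "'a::real_inner set"
  assumes fin: "finite I" "finite J" and w: "w \<in> transport_plans I J a b"
    and opt: "\<And>w'. w' \<in> transport_plans I J a b \<Longrightarrow>
      (\<Sum>z\<in>I \<times> J. w' z * (fst z \<bullet> snd z)) \<le> (\<Sum>z\<in>I \<times> J. w z * (fst z \<bullet> snd z))"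
  shows "cyclically_monotone {z \<in> I \<times> J. 0 < w z}"
  unfolding cyclically_monotone_def
proof (intro allI impI)
  fix n :: nat and x y :: "nat \<Rightarrow> 'a"
  assume n: "2 \<le> n" and xy: "\<forall>i<n. (x i, y i) \<in> {z \<in> I \<times> J. 0 < w z}"
  let ?s = "\<lambda>i. y (Suc i mod n)"
  define N where "N z = (\<Sum>i<n. if (x i, y i) = z then 1 else (0::real))" for z
  define N' where "N' z = (\<Sum>i<n. if (x i, ?s i) = z then 1 else (0::real))" for z
  \<comment> \<open>A point of the support is visited at most \<open>n\<close> times, so after
    division by \<open>n\<close> no weight becomes negative.\<close>
  define \<epsilon> where "\<epsilon> = Min ((\<lambda>i. w (x i, y i)) ` {..<n}) / real n"
  have w0: "0 \<le> w z" and wz: "z \<notin> I \<times> J \<Longrightarrow> w z = 0"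
    and rows: "p \<in> I \<Longrightarrow> (\<Sum>q\<in>J. w (p, q)) = a p" and cols: "q \<in> J \<Longrightarrow> (\<Sum>p\<in>I. w (p, q)) = b q"
    for z p q using w unfolding transport_plans_def by blast+
  have xI: "x i \<in> I" and yJ: "y i \<in> J" if "i < n" for i using xy that by auto
  have sJ: "?s i \<in> J" if "i < n" for i using yJ[of "Suc i mod n"] that by simp
  have "Min ((\<lambda>i. w (x i, y i)) ` {..<n}) \<in> (\<lambda>i. w (x i, y i)) ` {..<n}"
    using n by (intro Min_in) (auto simp: lessThan_empty_iff)
  then have e: "\<epsilon> > 0" using xy n by (auto simp: \<epsilon>_def)
  have en: "\<epsilon> * real n \<le> w (x i, y i)" if "i < n" for i
    using n that by (auto simp: \<epsilon>_def)
  have N'0: "0 \<le> N' z" for z by (auto simp: N'_def intro: sum_nonneg)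
  have Nn: "\<epsilon> * N z \<le> w z" for z
  proof (cases "\<exists>i<n. (x i, y i) = z")
    case True
    have "N z \<le> (\<Sum>i<n. 1)" unfolding N_def by (intro sum_mono) auto
    then have "\<epsilon> * N z \<le> \<epsilon> * real n" using e by simp
    then show ?thesis using True en by (metis order_trans)
  next
    case False
    then have "N z = 0" by (auto simp: N_def)
    then show ?thesis using w0 by simp
  qed
  define w' where "w' z = w z + \<epsilon> * (N' z - N z)" for z
  have "w' \<in> transport_plans I J a b"
    unfolding transport_plans_def
  proof (intro CollectI conjI allI ballI impI)
    fix z
    have "0 \<le> \<epsilon> * N' z" using e N'0 by simp
    then show "0 \<le> w' z" using Nn[of z] by (simp add: w'_def algebra_simps)
    assume z: "z \<notin> I \<times> J"
    then have "N z = 0" "N' z = 0"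
      using xI yJ sJ unfolding N_def N'_def by (auto intro!: sum.neutral)
    then show "w' z = 0" using wz[OF z] by (simp add: w'_def)
  next
    fix p assume "p \<in> I"
    have "(\<Sum>q\<in>J. N (p, q)) = (\<Sum>q\<in>J. N' (p, q))"
      unfolding N_def N'_def using sum_count_fst[OF fin(2), of n y x p] yJ
        sum_count_fst[OF fin(2), of n ?s x p] sJ by simp
    then have "(\<Sum>q\<in>J. w' (p, q)) = (\<Sum>q\<in>J. w (p, q))"
      by (simp add: w'_def sum.distrib sum_subtractf flip: sum_distrib_left)
    then show "(\<Sum>q\<in>J. w' (p, q)) = a p" using rows[OF \<open>p \<in> I\<close>] by simp
  next
    fix q assume "q \<in> J"
    have "(\<Sum>p\<in>I. N (p, q)) = (\<Sum>p\<in>I. N' (p, q))"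
      unfolding N_def N'_def using sum_count_snd[OF fin(1), of n x y q] xI
        sum_count_snd[OF fin(1), of n x ?s q]
        sum_Suc_mod_eq[of "\<lambda>i. if y i = q then 1 else (0::real)" n] by simp
    then have "(\<Sum>p\<in>I. w' (p, q)) = (\<Sum>p\<in>I. w (p, q))"
      by (simp add: w'_def sum.distrib sum_subtractf flip: sum_distrib_left)
    then show "(\<Sum>p\<in>I. w' (p, q)) = b q" using cols[OF \<open>q \<in> J\<close>] by simp
  qed
  from opt[OF this] have "\<epsilon> * ((\<Sum>z\<in>I \<times> J. N' z * (fst z \<bullet> snd z)) - (\<Sum>z\<in>I \<times> J. N z * (fst z \<bullet> snd z))) \<le> 0"
    unfolding w'_def by (simp add: algebra_simps sum.distrib sum_subtractf sum_distrib_left)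
  then have "(\<Sum>z\<in>I \<times> J. N' z * (fst z \<bullet> snd z)) \<le> (\<Sum>z\<in>I \<times> J. N z * (fst z \<bullet> snd z))"
    using e by (simp add: mult_le_0_iff)
  moreover have "(\<Sum>z\<in>I \<times> J. N' z * (fst z \<bullet> snd z)) = (\<Sum>i<n. x i \<bullet> ?s i)"
    unfolding N'_def using sum_count_weighted[of "I \<times> J" n "\<lambda>i. (x i, ?s i)" "\<lambda>z. fst z \<bullet> snd z"] fin xI sJ
    by simp
  moreover have "(\<Sum>z\<in>I \<times> J. N z * (fst z \<bullet> snd z)) = (\<Sum>i<n. x i \<bullet> y i)"
    unfolding N_def using sum_count_weighted[of "I \<times> J" n "\<lambda>i. (x i, y i)" "\<lambda>z. fst z \<bullet> snd z"] fin xI yJ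
    by simp
  ultimately show "(\<Sum>i<n. x i \<bullet> ?s i) \<le> (\<Sum>i<n. x i \<bullet> y i)" by simp
qed

lemma cyclically_monotone_plan_exists:
  fixes I J :: "'a::real_inner set"
  assumes "finite I" "finite J" "\<And>p. 0 \<le> a p" "\<And>q. 0 \<le> b q" "sum a I = sum b J"
  obtains w where "w \<in> transport_plans I J a b" "cyclically_monotone {z \<in> I \<times> J. 0 < w z}"
proof -
  have "continuous_on (transport_plans I J a b) (\<lambda>w. \<Sum>z\<in>I \<times> J. w z * (fst z \<bullet> snd z))"
    by (intro continuous_on_sum continuous_on_mult continuous_on_const
        continuous_on_subset[OF continuous_on_product_coordinates]) auto
  then obtain w where "w \<in> transport_plans I J a b"
    "\<And>w'. w' \<in> transport_plans I J a b \<Longrightarrow>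
      (\<Sum>z\<in>I \<times> J. w' z * (fst z \<bullet> snd z)) \<le> (\<Sum>z\<in>I \<times> J. w z * (fst z \<bullet> snd z))"
    using continuous_attains_sup[OF compact_transport_plans[OF assms(1,2)] transport_plans_nonempty[OF assms]]
    by blast
  then show ?thesis using that optimal_plan_cyclically_monotone[OF assms(1,2)] by blast
qed

text \<open>Points are classified by the members of \<open>F\<close> that contain them. There are
  finitely many classes, and every member of \<open>F\<close> is a disjoint union of them, so
  concentrating each class in one representative changes no mass of a set in
  \<open>F\<close>.\<close>

lemma finite_sampling:
  assumes "finite F" and F: "\<And>A. A \<in> F \<Longrightarrow> A \<in> sets M" "\<And>A. A \<in> F \<Longrightarrow> emeasure M A < \<infinity>"
  obtains I and a :: "'a \<Rightarrow> real" where "finite I" "I \<subseteq> \<Union>F" "\<And>p. 0 \<le> a p"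
    "\<And>A. A \<in> F \<Longrightarrow> emeasure M A = (\<Sum>p\<in>I \<inter> A. ennreal (a p))"
proof -
  define c where "c x = {A \<in> F. x \<in> A}" for x
  define rep where "rep K = (SOME x. x \<in> \<Union>F \<and> c x = K)" for K
  define I where "I = rep ` c ` \<Union>F"
  define cell where "cell p = {y. c y = c p}" for p
  have rep: "rep (c x) \<in> \<Union>F \<and> c (rep (c x)) = c x" if "x \<in> \<Union>F" for x
    unfolding rep_def using that by (intro someI_ex[of "\<lambda>y. y \<in> \<Union>F \<and> c y = c x"]) blast
  have "c ` \<Union>F \<subseteq> Pow F" by (auto simp: c_def)
  then have "finite (c ` \<Union>F)" by (rule finite_subset) (simp add: \<open>finite F\<close>)
  then have finI: "finite I" unfolding I_def by simp
  have IF: "I \<subseteq> \<Union>F" unfolding I_def using rep by blast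
  have inj: "p = q" if "p \<in> I" "q \<in> I" "c p = c q" for p q
  proof -
    have "rep (c p) = p" if p: "p \<in> I" for p using p rep unfolding I_def by force
    then show ?thesis using that by metis
  qed
  have cell_eq: "cell p = (\<Inter>A\<in>c p. A) - (\<Union>A\<in>F - c p. A)" for p
    by (auto simp: cell_def c_def)
  have cellM: "cell p \<in> sets M" if "p \<in> I" for p
  proof -
    \<comment> \<open>An empty intersection would be \<open>UNIV\<close>, which need not be
      measurable for \<open>M\<close>; representatives lie in some member of
      \<open>F\<close>.\<close>
    have "c p \<noteq> {}" using that IF by (auto simp: c_def)
    moreover have "finite (c p)" "c p \<subseteq> F" using \<open>finite F\<close> by (auto simp: c_def)
    ultimately show ?thesis
      unfolding cell_eq using F(1) \<open>finite F\<close>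
      by (intro sets.Diff sets.finite_INT sets.finite_UN) auto
  qed
  have A_eq: "A = (\<Union>p\<in>I \<inter> A. cell p)" if "A \<in> F" for A
  proof
    show "A \<subseteq> (\<Union>p\<in>I \<inter> A. cell p)"
    proof
      fix x assume x: "x \<in> A"
      then have r: "rep (c x) \<in> I" "c (rep (c x)) = c x"
        using that rep[of x] by (auto simp: I_def)
      moreover have "A \<in> c x" using x that by (simp add: c_def)
      ultimately have "A \<in> c (rep (c x))" by simp
      then have "rep (c x) \<in> A" by (simp add: c_def)
      then show "x \<in> (\<Union>p\<in>I \<inter> A. cell p)" using r by (auto simp: cell_def)
    qed
    show "(\<Union>p\<in>I \<inter> A. cell p) \<subseteq> A"
      using that by (auto simp: cell_def c_def)
  qed
  have "emeasure M A = (\<Sum>p\<in>I \<inter> A. ennreal (measure M (cell p)))" if "A \<in> F" for A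
  proof -
    have "(\<Sum>p\<in>I \<inter> A. emeasure M (cell p)) = emeasure M (\<Union>p\<in>I \<inter> A. cell p)"
      using cellM finI inj
      by (intro sum_emeasure) (auto simp: disjoint_family_on_def cell_def)
    also have "\<dots> = emeasure M A" using A_eq[OF that] by simp
    finally have eq: "(\<Sum>p\<in>I \<inter> A. emeasure M (cell p)) = emeasure M A" .
    have "emeasure M (cell p) = ennreal (measure M (cell p))" if "p \<in> I \<inter> A" for p
    proof (rule emeasure_eq_ennreal_measure)
      have "cell p \<subseteq> A" using A_eq[OF \<open>A \<in> F\<close>] that by blast
      then have "emeasure M (cell p) \<le> emeasure M A" using F(1) \<open>A \<in> F\<close> by (intro emeasure_mono)
      then show "emeasure M (cell p) \<noteq> top" using F(2)[OF \<open>A \<in> F\<close>] by auto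
    qed
    then show ?thesis using eq by simp
  qed
  then show ?thesis using that[of I "\<lambda>p. measure M (cell p)"] finI IF by simp
qed

subsection \<open>Measures on the punctured space\<close>

lemma punctured_sets_iff:
  assumes "punctured_measure \<mu>"
  shows "A \<in> sets \<mu> \<longleftrightarrow> A \<in> sets borel \<and> 0 \<notin> A"
  unfolding assms[unfolded punctured_measure_def]
  by (subst sets_restrict_space_iff) auto

lemma space_punctured: "punctured_measure \<mu> \<Longrightarrow> space \<mu> = - {0}"
  unfolding punctured_measure_def by (drule sets_eq_imp_space_eq) simp

lemma M0_D:
  assumes "\<mu> \<in> M0"
  shows "punctured_measure \<mu>" "A \<in> sets borel \<Longrightarrow> 0 \<notin> closure A \<Longrightarrow> emeasure \<mu> A < \<infinity>"
proof -
  show "punctured_measure \<mu>" using assms by (simp add: M0_def)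
  show "emeasure \<mu> A < \<infinity>" if "A \<in> sets borel" "0 \<notin> closure A"
    using assms that closure_subset[of A] unfolding M0_def by blast
qed

text \<open>An open set without the origin is a countable union of closed boxes inside it, so boxes
  avoiding the origin generate everything.\<close>

lemma sigma_sets_cboxes_punctured:
  fixes E :: "'c::euclidean_space set set"
  defines "E \<equiv> {cbox a b |a b. 0 \<notin> cbox a b}"
  shows "sets (restrict_space borel (- {0})) = sigma_sets (- {0}) E"
proof
  have "A \<inter> - {0} \<in> sigma_sets (- {0}) E" if "A \<in> sigma_sets UNIV {S. open S}" for A :: "'c set"
    using that
  proof induction
    case (Basic U)
    then have "open (U \<inter> - {0})" by auto
    then obtain D where D: "countable D" "D \<subseteq> Pow (U \<inter> - {0})"
      "\<And>X. X \<in> D \<Longrightarrow> \<exists>a b. X = cbox a b" "\<Union>D = U \<inter> - {0}"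
      using open_countable_Union_open_cbox by metis
    then have "D \<subseteq> E" unfolding E_def by blast
    then have "\<Union>D \<in> sigma_sets (- {0}) E"
      using D(1) by (intro sigma_sets_UNION) auto
    then show ?case using D(4) by simp
  next
    case Empty
    then show ?case by (simp add: sigma_sets.Empty)
  next
    case (Compl A)
    have "(UNIV - A) \<inter> - {0} = - {0} - (A \<inter> - {0})" by auto
    then show ?case using sigma_sets.Compl[OF Compl.IH] by simp
  next
    case (Union A)
    have "(\<Union>i. A i) \<inter> - {0} = (\<Union>i. A i \<inter> - {0})" by auto
    then show ?case using sigma_sets.Union[of "\<lambda>i. A i \<inter> - {0}"] Union.IH by simp
  qed
  then show "sets (restrict_space borel (- {0})) \<subseteq> sigma_sets (- {0}) E"
    unfolding sets_restrict_space borel_def by (auto simp: Int_commute)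
  have "E \<subseteq> sets (restrict_space borel (- {0}))"
    by (auto simp: E_def sets_restrict_space_iff)
  then show "sigma_sets (- {0}) E \<subseteq> sets (restrict_space borel (- {0}))"
    using sets.sigma_sets_subset[of E "restrict_space borel (- {0})"] by (simp add: space_restrict_space)
qed

text \<open>The generator is stable under intersection and contains a countable cover of the
  punctured space by sets of finite mass, which replaces finiteness of the measures.\<close>

lemma punctured_measure_eqI:
  fixes M N :: "'c::euclidean_space measure"
  assumes "punctured_measure M" "punctured_measure N"
    and eq: "\<And>a b. 0 \<notin> cbox a b \<Longrightarrow> emeasure M (cbox a b) = emeasure N (cbox a b)"
    and fin: "\<And>a b. 0 \<notin> cbox a b \<Longrightarrow> emeasure M (cbox a b) < \<infinity>"
  shows "M = N"
proof -
  let ?E = "{cbox a b |a b. (0::'c) \<notin> cbox a b}"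
  have "open (- {0::'c})" by auto
  then obtain D :: "'c set set" where D: "countable D" "D \<subseteq> Pow (- {0})"
    "\<And>X. X \<in> D \<Longrightarrow> \<exists>a b. X = cbox a b" "\<Union>D = - {0}"
    using open_countable_Union_open_cbox by metis
  show ?thesis
  proof (rule measure_eqI_generator_eq_countable[where E = ?E and \<Omega> = "- {0}" and A = D])
    show "Int_stable ?E"
      unfolding Int_stable_def
    proof clarify
      fix a b c d :: 'c assume 0: "0 \<notin> cbox a b" "0 \<notin> cbox c d"
      have "\<exists>u v. cbox a b \<inter> cbox c d = cbox u v" unfolding Int_interval by blast
      then obtain u v where uv: "cbox a b \<inter> cbox c d = cbox u v" by blast
      moreover have "0 \<notin> cbox u v" unfolding uv[symmetric] using 0 by blast
      ultimately show "\<exists>u v. cbox a b \<inter> cbox c d = cbox u v \<and> 0 \<notin> cbox u v" by blast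
    qed
    show "sets M = sigma_sets (- {0}) ?E" "sets N = sigma_sets (- {0}) ?E"
      using assms(1,2) sigma_sets_cboxes_punctured by (auto simp: punctured_measure_def)
    show DE: "D \<subseteq> ?E" using D(2,3) by blast
    show "countable D" "\<Union>D = - {0}" using D by auto
    show "emeasure M A \<noteq> \<infinity>" if "A \<in> D" for A using fin DE that by (force simp: subset_iff)
  qed (use eq in auto)
qed

subsection \<open>Existence of cyclically monotone zero-couplings\<close>

text \<open>Kept as a set function on all sets rather than as a measure, because the cluster point
  is taken in the compact space of all set functions.\<close>

definition point_masses :: "'b set \<Rightarrow> ('b \<Rightarrow> real) \<Rightarrow> 'b set \<Rightarrow> ennreal" where
  "point_masses Z w S = (\<Sum>z\<in>Z \<inter> S. ennreal (w z))"

lemma point_masses_empty: "point_masses Z w {} = 0"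
  by (simp add: point_masses_def)

lemma point_masses_mono: "finite Z \<Longrightarrow> S \<subseteq> T \<Longrightarrow> point_masses Z w S \<le> point_masses Z w T"
  unfolding point_masses_def by (intro sum_mono2) auto

lemma point_masses_Un_disjoint:
  "finite Z \<Longrightarrow> S \<inter> T = {} \<Longrightarrow> point_masses Z w (S \<union> T) = point_masses Z w S + point_masses Z w T"
  unfolding point_masses_def Int_Un_distrib by (intro sum.union_disjoint) auto

lemma point_masses_Un_le:
  assumes "finite Z"
  shows "point_masses Z w (S \<union> T) \<le> point_masses Z w S + point_masses Z w T"
proof -
  have "point_masses Z w (S \<union> (T - S)) = point_masses Z w S + point_masses Z w (T - S)"
    using assms by (intro point_masses_Un_disjoint) auto
  also have "\<dots> \<le> point_masses Z w S + point_masses Z w T"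
    using assms by (intro add_left_mono point_masses_mono) auto
  finally show ?thesis by simp
qed

text \<open>As \<open>ennreal\<close> sends negative weights to 0, the points with
  \<open>0 < w z\<close> are exactly those of \<open>Z\<close> that \<open>point_masses\<close>
  counts.\<close>

definition cyclic_masses :: "('a::real_inner \<times> 'a) set \<Rightarrow> ('a \<times> 'a \<Rightarrow> real) \<Rightarrow> bool" where
  "cyclic_masses Z w \<longleftrightarrow> finite Z \<and> cyclically_monotone {z \<in> Z. 0 < w z}"

(* Both sample sets are completed by the origin, whose mass balances the totals and is not seen by
   the sets in F. *)
lemma cyclic_masses_exist:
  fixes \<mu> \<nu> :: "'a::euclidean_space measure"
  assumes \<mu>: "\<mu> \<in> M0" and \<nu>: "\<nu> \<in> M0"
    and F: "finite F" "F \<subseteq> {A \<in> sets borel. 0 \<notin> closure A}"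
  obtains Z w where "cyclic_masses Z w"
    "\<And>A. A \<in> F \<Longrightarrow> point_masses Z w (A \<times> UNIV) = emeasure \<mu> A"
    "\<And>A. A \<in> F \<Longrightarrow> point_masses Z w (UNIV \<times> A) = emeasure \<nu> A"
proof -
  have F0: "0 \<notin> A" if "A \<in> F" for A using F(2) closure_subset that by blast
  have sampling: "\<exists>I a. finite I \<and> 0 \<notin> I \<and> (\<forall>p. 0 \<le> a p) \<and>
      (\<forall>A\<in>F. emeasure \<kappa> A = (\<Sum>p\<in>I \<inter> A. ennreal (a p)))" if "\<kappa> \<in> M0" for \<kappa> :: "'a measure"
  proof -
    have M: "A \<in> sets \<kappa>" "emeasure \<kappa> A < \<infinity>" if "A \<in> F" for A
      using M0_D[OF \<open>\<kappa> \<in> M0\<close>] that F(2) F0[OF that] by (auto simp: punctured_sets_iff)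
    obtain I and a :: "'a \<Rightarrow> real" where *: "finite I" "I \<subseteq> \<Union>F" "\<And>p. 0 \<le> a p"
      "\<And>A. A \<in> F \<Longrightarrow> emeasure \<kappa> A = (\<Sum>p\<in>I \<inter> A. ennreal (a p))"
      using finite_sampling[OF F(1) M] by blast
    then show ?thesis using F0 by blast
  qed
  obtain I0 a0 where I0: "finite I0" "0 \<notin> I0" "\<And>p. 0 \<le> a0 p"
    "\<And>A. A \<in> F \<Longrightarrow> emeasure \<mu> A = (\<Sum>p\<in>I0 \<inter> A. ennreal (a0 p))"
    using sampling[OF \<mu>] by blast
  obtain J0 b0 where J0: "finite J0" "0 \<notin> J0" "\<And>p. 0 \<le> b0 p"
    "\<And>A. A \<in> F \<Longrightarrow> emeasure \<nu> A = (\<Sum>p\<in>J0 \<inter> A. ennreal (b0 p))"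
    using sampling[OF \<nu>] by blast
  define I where "I = insert 0 I0"
  define J where "J = insert 0 J0"
  define a where "a = a0(0 := max 0 (sum b0 J0 - sum a0 I0))"
  define b where "b = b0(0 := max 0 (sum a0 I0 - sum b0 J0))"
  have fin: "finite I" "finite J" using I0 J0 by (auto simp: I_def J_def)
  have ne: "p \<noteq> 0" if "p \<in> I0 \<or> p \<in> J0" for p using that I0(2) J0(2) by metis
  have "sum a I0 = sum a0 I0" by (rule sum.cong) (use ne in \<open>auto simp: a_def\<close>)
  moreover have "sum b J0 = sum b0 J0" by (rule sum.cong) (use ne in \<open>auto simp: b_def\<close>)
  ultimately have sums: "sum a I = sum b J"
    using I0 J0 by (auto simp: I_def J_def a_def b_def max_def)
  have pos: "0 \<le> a p" "0 \<le> b p" for p using I0(3) J0(3) by (auto simp: a_def b_def)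
  obtain w where w: "w \<in> transport_plans I J a b" "cyclically_monotone {z \<in> I \<times> J. 0 < w z}"
    using cyclically_monotone_plan_exists[of I J a b] fin pos sums by metis
  have w0: "0 \<le> w z" and rows: "p \<in> I \<Longrightarrow> (\<Sum>q\<in>J. w (p, q)) = a p"
    and cols: "q \<in> J \<Longrightarrow> (\<Sum>p\<in>I. w (p, q)) = b q"
    for z p q using w(1) unfolding transport_plans_def by blast+
  show ?thesis
  proof (rule that[of "I \<times> J" w])
    show "cyclic_masses (I \<times> J) w" using w(2) fin by (simp add: cyclic_masses_def)
    fix A assume A: "A \<in> F"
    have "point_masses (I \<times> J) w (A \<times> UNIV) = (\<Sum>p\<in>I \<inter> A. \<Sum>q\<in>J. ennreal (w (p, q)))"
      unfolding point_masses_def by (subst sum.cartesian_product) (auto intro!: sum.cong)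
    also have "\<dots> = (\<Sum>p\<in>I \<inter> A. ennreal (a p))"
      using rows by (intro sum.cong refl) (simp add: sum_ennreal w0)
    also have "\<dots> = (\<Sum>p\<in>I0 \<inter> A. ennreal (a0 p))"
      using F0[OF A] ne by (intro sum.cong) (auto simp: I_def a_def)
    finally show "point_masses (I \<times> J) w (A \<times> UNIV) = emeasure \<mu> A" using I0(4)[OF A] by simp
    have "point_masses (I \<times> J) w (UNIV \<times> A) = (\<Sum>p\<in>I. \<Sum>q\<in>J \<inter> A. ennreal (w (p, q)))"
      unfolding point_masses_def by (subst sum.cartesian_product) (auto intro!: sum.cong)
    also have "\<dots> = (\<Sum>q\<in>J \<inter> A. \<Sum>p\<in>I. ennreal (w (p, q)))" by (rule sum.swap)
    also have "\<dots> = (\<Sum>q\<in>J \<inter> A. ennreal (b q))"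
      using cols by (intro sum.cong refl) (simp add: sum_ennreal w0)
    also have "\<dots> = (\<Sum>q\<in>J0 \<inter> A. ennreal (b0 q))"
      using F0[OF A] ne by (intro sum.cong) (auto simp: J_def b_def)
    finally show "point_masses (I \<times> J) w (UNIV \<times> A) = emeasure \<nu> A" using J0(4)[OF A] by simp
  qed
qed

text \<open>\<open>X F\<close> consists of the set functions of finite cyclic plans with exact
  marginals on \<open>F\<close>. Finitely many of these sets always meet, in a plan that is exact on
  the union of the families, so they generate a proper filter. \<open>G\<close> refines it and
  converges to a cluster point \<rho>; relations between finitely many values that hold along
  \<open>G\<close> are inherited by \<rho>.\<close>

lemma cluster_plan:
  fixes \<mu> \<nu> :: "'a::euclidean_space measure"
  assumes "\<mu> \<in> M0" "\<nu> \<in> M0"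
  obtains G :: "(('a \<times> 'a) set \<Rightarrow> ennreal) filter" and \<rho> where "G \<noteq> bot"
    "\<And>S. ((\<lambda>f. f S) \<longlongrightarrow> \<rho> S) G"
    "eventually (\<lambda>f. \<exists>Z w. cyclic_masses Z w \<and> f = point_masses Z w) G"
    "\<And>A. A \<in> sets borel \<Longrightarrow> 0 \<notin> closure A \<Longrightarrow>
       eventually (\<lambda>f. f (A \<times> UNIV) = emeasure \<mu> A \<and> f (UNIV \<times> A) = emeasure \<nu> A) G"
proof -
  define C where "C = {A :: 'a set. A \<in> sets borel \<and> 0 \<notin> closure A}"
  define X where "X F = {f. (\<exists>Z w. cyclic_masses Z w \<and> f = point_masses Z w) \<and>
     (\<forall>A\<in>F. f (A \<times> UNIV) = emeasure \<mu> A \<and> f (UNIV \<times> A) = emeasure \<nu> A)}" for F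
  define H where "H = (INF F\<in>{F. finite F \<and> F \<subseteq> C}. principal (X F))"
  have "H \<noteq> bot"
    unfolding H_def
  proof (rule INF_filter_not_bot)
    fix B assume B: "B \<subseteq> {F. finite F \<and> F \<subseteq> C}" "finite B"
    then have "finite (\<Union>B)" "\<Union>B \<subseteq> C" by auto
    then obtain Z w where "cyclic_masses Z w"
      "\<And>A. A \<in> \<Union>B \<Longrightarrow> point_masses Z w (A \<times> UNIV) = emeasure \<mu> A"
      "\<And>A. A \<in> \<Union>B \<Longrightarrow> point_masses Z w (UNIV \<times> A) = emeasure \<nu> A"
      using cyclic_masses_exist[OF assms, of "\<Union>B"] unfolding C_def by metis
    then have "point_masses Z w \<in> (\<Inter>F\<in>B. X F)" by (auto simp: X_def)
    then have "(\<Inter>F\<in>B. X F) \<noteq> {}" by blast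
    then show "(INF F\<in>B. principal (X F)) \<noteq> bot"
      using B(2) by (simp add: INF_principal_finite principal_eq_bot_iff)
  qed
  moreover have "compact (UNIV :: (('a \<times> 'a) set \<Rightarrow> ennreal) set)"
    using compact_PiE_UNIV[of "\<lambda>_::('a \<times> 'a) set. UNIV :: ennreal set"] compact_UNIV by simp
  ultimately obtain \<rho> where \<rho>: "inf (nhds \<rho>) H \<noteq> bot"
    unfolding compact_filter by auto
  define G where "G = inf (nhds \<rho>) H"
  have XG: "eventually (\<lambda>f. f \<in> X F) G" if "finite F" "F \<subseteq> C" for F
  proof -
    have "H \<le> principal (X F)" unfolding H_def using that by (intro INF_lower) auto
    then have "G \<le> principal (X F)" unfolding G_def by (rule le_infI2)
    then show ?thesis by (rule filter_leD) (simp add: eventually_principal)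
  qed
  show ?thesis
  proof (rule that[of G \<rho>])
    show "G \<noteq> bot" using \<rho> by (simp add: G_def)
    show "((\<lambda>f. f S) \<longlongrightarrow> \<rho> S) G" for S
    proof -
      have "((\<lambda>f. f S) \<longlongrightarrow> \<rho> S) (at \<rho>)"
        using continuous_on_product_coordinates[of S] unfolding continuous_on_def by blast
      then have "((\<lambda>f. f S) \<longlongrightarrow> \<rho> S) (nhds \<rho>)" using tendsto_at_iff_tendsto_nhds[of "\<lambda>f. f S" \<rho>] by simp
      then show ?thesis unfolding G_def by (rule tendsto_mono[rotated]) simp
    qed
    show "eventually (\<lambda>f. \<exists>Z w. cyclic_masses Z w \<and> f = point_masses Z w) G"
      using XG[of "{}"] by (auto simp: X_def elim: eventually_mono)
    show "eventually (\<lambda>f. f (A \<times> UNIV) = emeasure \<mu> A \<and> f (UNIV \<times> A) = emeasure \<nu> A) G"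
      if "A \<in> sets borel" "0 \<notin> closure A" for A
      using XG[of "{A}"] that by (auto simp: X_def C_def elim: eventually_mono)
  qed
qed

section \<open>From the cluster point to a measure with the prescribed marginals\<close>

lemma punctured_measure_eqI_compact:
  fixes M N :: "'c::euclidean_space measure"
  assumes "M \<in> M0" "punctured_measure N"
    and eq: "\<And>K. compact K \<Longrightarrow> 0 \<notin> K \<Longrightarrow> emeasure M K = emeasure N K"
  shows "M = N"
proof (rule punctured_measure_eqI[OF M0_D(1)[OF assms(1)] assms(2)])
  show "emeasure M (cbox a b) = emeasure N (cbox a b)" if "0 \<notin> cbox a b" for a b :: 'c
    using eq that by simp
  show "emeasure M (cbox a b) < \<infinity>" if "0 \<notin> cbox a b" for a b :: 'c
    using that by (intro M0_D(2)[OF assms(1)]) auto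
qed

text \<open>Continuity from above requires finite masses, hence neighbourhoods whose closures avoid
  the origin. The origin has distance \<open>d\<close> from \<open>K\<close>, and the shift in
  \<open>d / real (n + 2)\<close> keeps even the first radius below \<open>d\<close>.\<close>

lemma emeasure_shrinking_neighbourhoods:
  fixes \<mu> :: "'a::euclidean_space measure"
  assumes \<mu>: "\<mu> \<in> M0" and K: "compact K" "0 \<notin> K" "K \<noteq> {}"
  obtains U :: "nat \<Rightarrow> 'a set" where "\<And>n. open (U n)" "\<And>n. K \<subseteq> U n" "\<And>n. 0 \<notin> closure (U n)"
    "(\<lambda>n. emeasure \<mu> (U n)) \<longlonglongrightarrow> emeasure \<mu> K"
proof -
  have cl: "closed K" using K by (simp add: compact_imp_closed)
  define d where "d = infdist 0 K"
  have d: "d > 0" using infdist_pos_not_in_closed[OF cl K(3,2)] by (simp add: d_def)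
  define U where "U n = {x. infdist x K < d / real (n + 2)}" for n
  have op: "open (U n)" for n
    unfolding U_def by (intro open_Collect_less continuous_intros)
  have KU: "K \<subseteq> U n" for n using d by (auto simp: U_def)
  have cl0: "0 \<notin> closure (U n)" for n
  proof -
    have "closure (U n) \<subseteq> {x. infdist x K \<le> d / real (n + 2)}"
      by (intro closure_minimal closed_Collect_le continuous_intros) (auto simp: U_def)
    moreover have "d / real (n + 2) < d" using d by (simp add: divide_less_eq)
    ultimately show ?thesis by (force simp: d_def)
  qed
  have dec: "decseq U"
  proof (rule decseq_SucI)
    fix n
    have "d / real (Suc n + 2) \<le> d / real (n + 2)" using d by (intro divide_left_mono) auto
    then show "U (Suc n) \<subseteq> U n" by (auto simp: U_def)
  qed
  have Int: "(\<Inter>n. U n) = K"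
  proof
    show "(\<Inter>n. U n) \<subseteq> K"
    proof
      fix x assume "x \<in> (\<Inter>n. U n)"
      then have *: "infdist x K \<le> d / real (n + 2)" for n by (auto simp: U_def intro: less_imp_le)
      have "(\<lambda>n. d / real (n + 2)) \<longlonglongrightarrow> 0"
        using LIMSEQ_ignore_initial_segment[OF lim_const_over_n[of d], of 2] by simp
      then have "infdist x K \<le> 0" by (rule LIMSEQ_le_const) (use * in auto)
      then have "infdist x K = 0" using infdist_nonneg[of x K] by simp
      then show "x \<in> K" using in_closed_iff_infdist_zero[OF cl K(3)] by simp
    qed
  qed (use KU in auto)
  have "(\<lambda>n. emeasure \<mu> (U n)) \<longlonglongrightarrow> emeasure \<mu> (\<Inter>n. U n)"
  proof (rule Lim_emeasure_decseq[OF _ dec])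
    show "range U \<subseteq> sets \<mu>"
      using op cl0 closure_subset by (fastforce simp: punctured_sets_iff[OF M0_D(1)[OF \<mu>]])
    show "emeasure \<mu> (U i) \<noteq> \<infinity>" for i using M0_D(2)[OF \<mu> _ cl0] op by (simp add: less_top)
  qed
  then show ?thesis using that[of U] op KU cl0 Int by simp
qed

text \<open>Only inequalities link \<rho> and \<open>M\<close>: \<open>M\<close> dominates \<rho> on
  compact sets and, by monotonicity, is dominated by it on open sets. The marginals are squeezed
  between the two.\<close>

locale cluster_measure =
  fixes M :: "('a::euclidean_space \<times> 'a) measure" and \<rho> :: "('a \<times> 'a) set \<Rightarrow> ennreal"
  assumes sets_M: "sets M = sets borel"
    and \<rho>_mono: "\<And>S T. S \<subseteq> T \<Longrightarrow> \<rho> S \<le> \<rho> T"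
    and \<rho>_Un: "\<And>S T. \<rho> (S \<union> T) \<le> \<rho> S + \<rho> T"
    and M_open: "\<And>U. open U \<Longrightarrow> emeasure M U = (SUP K\<in>{K. compact K \<and> K \<subseteq> U}. \<rho> K)"
    and M_compact: "\<And>K. compact K \<Longrightarrow> \<rho> K \<le> emeasure M K"
begin

(* Stated for a pair of coordinate maps f, g so as to serve both marginals. *)
lemma marginal:
  fixes f g :: "'a \<times> 'a \<Rightarrow> 'a"
  assumes \<mu>: "\<mu> \<in> M0" and \<nu>: "\<nu> \<in> M0"
    and cont: "continuous_on UNIV f" "continuous_on UNIV g"
    and cpt: "\<And>K L. compact K \<Longrightarrow> compact L \<Longrightarrow> compact (f -` K \<inter> g -` L)"
    and \<rho>f: "\<And>A. A \<in> sets borel \<Longrightarrow> 0 \<notin> closure A \<Longrightarrow> \<rho> (f -` A) = emeasure \<mu> A"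
    and \<rho>g: "\<And>A. A \<in> sets borel \<Longrightarrow> 0 \<notin> closure A \<Longrightarrow> \<rho> (g -` A) = emeasure \<nu> A"
    and A: "A \<in> sets borel" "0 \<notin> A"
  shows "emeasure M (f -` A) = emeasure \<mu> A"
proof -
  have f: "f \<in> M \<rightarrow>\<^sub>M borel" and g: "g \<in> M \<rightarrow>\<^sub>M borel"
    using cont[THEN borel_measurable_continuous_onI] measurable_cong_sets[OF sets_M refl] by blast+
  have fM: "f -` B \<in> sets M" if "B \<in> sets borel" for B
    using measurable_sets[OF f that] sets_eq_imp_space_eq[OF sets_M] by simp
  let ?P = "- {0} :: 'a set"
  have cl: "closed K" if "compact K" for K :: "'a set" using that by (rule compact_imp_closed)
  \<comment> \<open>From above through open neighbourhoods of \<open>K\<close>: there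
    \<open>M\<close> is at most \<rho>, whose marginal is exact.\<close>
  have upper: "emeasure M (f -` K) \<le> emeasure \<mu> K" if K: "compact K" "0 \<notin> K" for K
  proof (cases "K = {}")
    case False
    obtain U :: "nat \<Rightarrow> 'a set" where U: "\<And>n. open (U n)" "\<And>n. K \<subseteq> U n" "\<And>n. 0 \<notin> closure (U n)"
      "(\<lambda>n. emeasure \<mu> (U n)) \<longlonglongrightarrow> emeasure \<mu> K"
      using emeasure_shrinking_neighbourhoods[OF \<mu> K False] by metis
    have "emeasure M (f -` K) \<le> emeasure \<mu> (U n)" for n
    proof -
      have "emeasure M (f -` K) \<le> emeasure M (f -` U n)"
        using U(1,2)[of n] fM by (intro emeasure_mono vimage_mono) auto
      also have "\<dots> = (SUP L\<in>{L. compact L \<and> L \<subseteq> f -` U n}. \<rho> L)"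
        using U(1) cont(1) by (intro M_open open_vimage)
      also have "\<dots> \<le> \<rho> (f -` U n)" by (intro SUP_least \<rho>_mono) auto
      also have "\<dots> = emeasure \<mu> (U n)" using U by (intro \<rho>f) auto
      finally show ?thesis .
    qed
    then show ?thesis using LIMSEQ_le_const[OF U(4)] by blast
  qed simp
  \<comment> \<open>The preimage of \<open>K\<close> need not be compact, so it is cut by a ball in
    the other coordinate; the part cut off has \<rho>-value at most the \<nu>-mass outside the
    ball.\<close>
  have lower: "emeasure \<mu> K \<le> emeasure M (f -` K)" if K: "compact K" "0 \<notin> K" for K
  proof -
    \<comment> \<open>With radius 0 the closure of the complement would contain the origin, hence
      \<open>Suc n\<close>.\<close>
    define B where "B n = - cball (0::'a) (real (Suc n))" for n
    have B0: "0 \<notin> closure (B n)" for n by (simp add: B_def closure_complement interior_cball)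
    have Bb: "B n \<in> sets borel" for n by (simp add: B_def)
    have "emeasure \<mu> K \<le> emeasure M (f -` K) + emeasure \<nu> (B n)" for n
    proof -
      have "emeasure \<mu> K = \<rho> (f -` K)" using K cl[OF K(1)] by (intro \<rho>f[symmetric]) auto
      also have "f -` K \<subseteq> (f -` K \<inter> g -` cball 0 (real (Suc n))) \<union> g -` B n"
        by (auto simp: B_def)
      then have "\<rho> (f -` K) \<le> \<rho> ((f -` K \<inter> g -` cball 0 (real (Suc n))) \<union> g -` B n)"
        by (rule \<rho>_mono)
      also have "\<dots> \<le> \<rho> (f -` K \<inter> g -` cball 0 (real (Suc n))) + \<rho> (g -` B n)" by (rule \<rho>_Un)
      also have "\<dots> \<le> emeasure M (f -` K) + emeasure \<nu> (B n)"
      proof (rule add_mono)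
        have "\<rho> (f -` K \<inter> g -` cball 0 (real (Suc n))) \<le> emeasure M (f -` K \<inter> g -` cball 0 (real (Suc n)))"
          using K by (intro M_compact cpt) auto
        also have "\<dots> \<le> emeasure M (f -` K)"
          using fM cl[OF K(1)] by (intro emeasure_mono) auto
        finally show "\<rho> (f -` K \<inter> g -` cball 0 (real (Suc n))) \<le> emeasure M (f -` K)" .
        show "\<rho> (g -` B n) \<le> emeasure \<nu> (B n)" using \<rho>g[OF Bb B0] by simp
      qed
      finally show ?thesis .
    qed
    moreover have "(\<lambda>n. emeasure M (f -` K) + emeasure \<nu> (B n)) \<longlonglongrightarrow> emeasure M (f -` K) + emeasure \<nu> (\<Inter>n. B n)"
    proof (intro tendsto_add tendsto_const Lim_emeasure_decseq)
      show "range B \<subseteq> sets \<nu>"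
        using Bb by (auto simp: punctured_sets_iff[OF M0_D(1)[OF \<nu>]] B_def)
      show "decseq B" by (rule decseq_SucI) (auto simp: B_def)
      show "emeasure \<nu> (B i) \<noteq> \<infinity>" for i using M0_D(2)[OF \<nu> Bb B0] by (simp add: less_top)
    qed
    moreover have "(\<Inter>n. B n) = {}"
    proof -
      have "\<exists>n. x \<notin> B n" for x
      proof -
        obtain n where "norm x \<le> real n" using real_arch_simple by blast
        then have "x \<notin> B n" by (simp add: B_def)
        then show ?thesis ..
      qed
      then show ?thesis by blast
    qed
    ultimately have "emeasure \<mu> K \<le> emeasure M (f -` K) + emeasure \<nu> {}"
      by (metis (no_types, lifting) LIMSEQ_le_const)
    then show ?thesis by simp
  qed
  \<comment> \<open>The image measure is formed only over the part that \<open>f\<close> maps off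
    the origin, so that it lives on the punctured space.\<close>
  define N where "N = distr (restrict_space M (f -` ?P)) (restrict_space borel ?P) f"
  have meas: "f \<in> restrict_space M (f -` ?P) \<rightarrow>\<^sub>M restrict_space borel ?P"
    by (intro measurable_restrict_space2 measurable_restrict_space1 f) (auto simp: space_restrict_space)
  have N: "emeasure N B = emeasure M (f -` B)" if "B \<in> sets borel" "0 \<notin> B" for B
  proof -
    have "B \<in> sets (restrict_space borel ?P)" using that by (subst sets_restrict_space_iff) auto
    then have "emeasure N B = emeasure (restrict_space M (f -` ?P)) (f -` B \<inter> space (restrict_space M (f -` ?P)))"
      unfolding N_def by (rule emeasure_distr[OF meas])
    also have "f -` B \<inter> space (restrict_space M (f -` ?P)) = f -` B"
      using that sets_eq_imp_space_eq[OF sets_M] by (auto simp: space_restrict_space)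
    also have "emeasure (restrict_space M (f -` ?P)) (f -` B) = emeasure M (f -` B)"
      using that fM[of ?P] sets_eq_imp_space_eq[OF sets_M] by (intro emeasure_restrict_space) auto
    finally show ?thesis .
  qed
  have "\<mu> = N"
  proof (rule punctured_measure_eqI_compact[OF \<mu>])
    show "punctured_measure N" by (simp add: N_def punctured_measure_def)
    show "emeasure \<mu> K = emeasure N K" if "compact K" "0 \<notin> K" for K
      using that upper lower cl by (subst N) (auto intro: antisym)
  qed
  then show ?thesis using N[OF A] by simp
qed

end

theorem Gamma0cm_nonempty:
  fixes \<mu> \<nu> :: "'a::euclidean_space measure"
  assumes \<mu>: "\<mu> \<in> M0" and \<nu>: "\<nu> \<in> M0"
  shows "Gamma0cm \<mu> \<nu> \<noteq> {}"
proof (rule cluster_plan[OF assms])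
  fix G :: "(('a \<times> 'a) set \<Rightarrow> ennreal) filter" and \<rho>
  assume G: "G \<noteq> bot"
    and lim: "\<And>S. ((\<lambda>f. f S) \<longlongrightarrow> \<rho> S) G"
    and pm: "eventually (\<lambda>f. \<exists>Z w. cyclic_masses Z w \<and> f = point_masses Z w) G"
    and marg: "\<And>A. A \<in> sets borel \<Longrightarrow> 0 \<notin> closure A \<Longrightarrow>
       eventually (\<lambda>f. f (A \<times> UNIV) = emeasure \<mu> A \<and> f (UNIV \<times> A) = emeasure \<nu> A) G"
  \<comment> \<open>The properties of a content hold for every finite plan and pass to the limit
    along \<open>G\<close>.\<close>
  have \<rho>_mono: "\<rho> S \<le> \<rho> T" if "S \<subseteq> T" for S T
  proof (rule tendsto_le[OF G lim lim])
    show "\<forall>\<^sub>F f in G. f S \<le> f T"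
      using pm by eventually_elim (auto simp: cyclic_masses_def intro: point_masses_mono[OF _ that])
  qed
  have \<rho>_Un: "\<rho> (S \<union> T) \<le> \<rho> S + \<rho> T" for S T
  proof (rule tendsto_le[OF G tendsto_add[OF lim lim] lim])
    show "\<forall>\<^sub>F f in G. f (S \<union> T) \<le> f S + f T"
      using pm by eventually_elim (auto simp: cyclic_masses_def intro: point_masses_Un_le)
  qed
  have \<rho>_eqI: "\<rho> S = c" if "\<forall>\<^sub>F f in G. f S = c" for S c
    by (rule tendsto_unique[OF G lim tendsto_eventually[OF that]])
  interpret compact_content \<rho>
  proof
    show "\<rho> {} = 0"
      by (rule \<rho>_eqI, use pm in eventually_elim) (auto simp: point_masses_empty)
    show "\<rho> K + \<rho> L \<le> \<rho> (K \<union> L)" if "K \<inter> L = {}" for K L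
    proof (rule tendsto_le[OF G lim tendsto_add[OF lim lim]])
      show "\<forall>\<^sub>F f in G. f K + f L \<le> f (K \<union> L)"
        using pm by eventually_elim (auto simp: cyclic_masses_def point_masses_Un_disjoint that)
    qed
  qed (rule \<rho>_mono \<rho>_Un; assumption?)+
  obtain M :: "('a \<times> 'a) measure" where M: "sets M = sets borel"
    "\<And>U. open U \<Longrightarrow> emeasure M U = (SUP K\<in>{K. compact K \<and> K \<subseteq> U}. \<rho> K)"
    "\<And>K. compact K \<Longrightarrow> \<rho> K \<le> emeasure M K"
    using content_measure by blast
  interpret cluster_measure M \<rho>
    by unfold_locales (use M \<rho>_mono \<rho>_Un in auto)
  have \<rho>1: "\<rho> (fst -` A) = emeasure \<mu> A" and \<rho>2: "\<rho> (snd -` A) = emeasure \<nu> A"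
    if "A \<in> sets borel" "0 \<notin> closure A" for A
    using marg[OF that] by (auto intro!: \<rho>_eqI elim: eventually_mono simp: vimage_fst vimage_snd)
  have marg1: "emeasure M (fst -` A) = emeasure \<mu> A" if "A \<in> sets borel" "0 \<notin> A" for A
  proof (rule marginal[OF \<mu> \<nu> _ _ _ \<rho>1 \<rho>2 that])
    show "compact (fst -` K \<inter> snd -` L)" if "compact K" "compact L" for K L :: "'a set"
    proof -
      have "fst -` K \<inter> snd -` L = K \<times> L" by auto
      then show ?thesis using that by (simp add: compact_Times)
    qed
  qed (auto intro: continuous_intros)
  have marg2: "emeasure M (snd -` A) = emeasure \<nu> A" if "A \<in> sets borel" "0 \<notin> A" for A
  proof (rule marginal[OF \<nu> \<mu> _ _ _ \<rho>2 \<rho>1 that])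
    show "compact (snd -` K \<inter> fst -` L)" if "compact K" "compact L" for K L :: "'a set"
    proof -
      have "snd -` K \<inter> fst -` L = L \<times> K" by auto
      then show ?thesis using that by (simp add: compact_Times)
    qed
  qed (auto intro: continuous_intros)
  \<comment> \<open>\<open>M\<close> may charge the origin: with a marginal of infinite mass, every
    neighbourhood of it has infinite mass, and so has the origin by outer regularity. The
    restriction removes this atom.\<close>
  define \<gamma> where "\<gamma> = restrict_space M (- {0})"
  have \<gamma>: "emeasure \<gamma> A = emeasure M A" if "0 \<notin> A" for A
    unfolding \<gamma>_def using that sets_eq_imp_space_eq[OF M(1)] M(1)
    by (intro emeasure_restrict_space) auto
  have zc: "zero_coupling \<mu> \<nu> \<gamma>"
    unfolding zero_coupling_def
  proof (intro conjI ballI impI)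
    show "punctured_measure \<gamma>"
      unfolding punctured_measure_def \<gamma>_def by (rule sets_restrict_space_cong[OF M(1)])
    fix A :: "'a set" assume A: "A \<in> sets borel" "A \<subseteq> - {0}"
    then have "0 \<notin> A \<times> (UNIV :: 'a set)" "0 \<notin> (UNIV :: 'a set) \<times> A" by (auto simp: zero_prod_def)
    then show "emeasure \<gamma> (A \<times> UNIV) = emeasure \<mu> A" "emeasure \<gamma> (UNIV \<times> A) = emeasure \<nu> A"
      using marg1[of A] marg2[of A] A \<gamma> by (auto simp: vimage_fst vimage_snd)
  qed
  have "cyclically_monotone (spt \<gamma>)"
    unfolding cyclically_monotone_def
  proof (intro allI impI)
    fix n :: nat and x y :: "nat \<Rightarrow> 'a"
    assume n: "2 \<le> n" and xy: "\<forall>i<n. (x i, y i) \<in> spt \<gamma>"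
    let ?s = "\<lambda>i. Suc i mod n"
    \<comment> \<open>Each support point has, in a small punctured ball, a compact set with positive
      \<rho>-value. Along \<open>G\<close> finitely many such sets are charged by one and the same
      finite plan, whose atoms there satisfy the cyclic inequality; closeness then carries it to the
      support points.\<close>
    have "\<exists>u v. (\<forall>i<n. dist (u i, v i) (x i, y i) < inverse (real (Suc k))) \<and>
        (\<Sum>i<n. u i \<bullet> v (?s i)) \<le> (\<Sum>i<n. u i \<bullet> v i)" for k
    proof -
      have "\<exists>K. K \<subseteq> ball (x i, y i) (inverse (real (Suc k))) \<and> 0 < \<rho> K" if "i < n" for i
      proof -
        let ?U = "ball (x i, y i) (inverse (real (Suc k))) - {0}"
        have "0 < emeasure \<gamma> ?U" using xy that unfolding spt_def by simp
        also have "emeasure \<gamma> ?U = emeasure M ?U" by (intro \<gamma>) auto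
        also have "\<dots> = (SUP K\<in>{K. compact K \<and> K \<subseteq> ?U}. \<rho> K)" by (intro M(2)) auto
        finally show ?thesis unfolding less_SUP_iff by auto
      qed
      then obtain K where K: "\<And>i. i < n \<Longrightarrow> K i \<subseteq> ball (x i, y i) (inverse (real (Suc k)))"
        "\<And>i. i < n \<Longrightarrow> 0 < \<rho> (K i)" by metis
      have "\<forall>\<^sub>F f in G. \<forall>i\<in>{..<n}. 0 < f (K i)"
        using K(2) by (intro eventually_ball_finite) (auto intro: order_tendstoD(1)[OF lim])
      with pm have "\<forall>\<^sub>F f in G. (\<forall>i\<in>{..<n}. 0 < f (K i)) \<and> (\<exists>Z w. cyclic_masses Z w \<and> f = point_masses Z w)"
        by eventually_elim auto
      from eventually_happens'[OF G this] obtain f Z w where f: "\<forall>i\<in>{..<n}. 0 < f (K i)"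
        and Z: "cyclic_masses Z w" "f = point_masses Z w" by blast
      then have Zw: "cyclic_masses Z w" "\<And>i. i < n \<Longrightarrow> 0 < point_masses Z w (K i)" by auto
      have "\<exists>z. z \<in> Z \<and> z \<in> K i \<and> 0 < w z" if "i < n" for i
      proof (rule ccontr)
        assume *: "\<not> ?thesis"
        have "point_masses Z w (K i) = 0"
          unfolding point_masses_def by (intro sum.neutral) (use * in \<open>auto simp: ennreal_eq_0_iff not_less\<close>)
        then show False using Zw(2)[OF that] by simp
      qed
      then obtain z where z: "\<And>i. i < n \<Longrightarrow> z i \<in> Z" "\<And>i. i < n \<Longrightarrow> z i \<in> K i" "\<And>i. i < n \<Longrightarrow> 0 < w (z i)"
        by metis
      have "cyclically_monotone {z \<in> Z. 0 < w z}" using Zw(1) by (simp add: cyclic_masses_def)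
      then have "(\<Sum>i<n. fst (z i) \<bullet> snd (z (?s i))) \<le> (\<Sum>i<n. fst (z i) \<bullet> snd (z i))"
        by (rule cyclically_monotone_def[THEN iffD1, rule_format, of _ n "\<lambda>i. fst (z i)" "\<lambda>i. snd (z i)"])
          (use n z in auto)
      moreover have "dist (fst (z i), snd (z i)) (x i, y i) < inverse (real (Suc k))" if "i < n" for i
        using K(1)[OF that] z(2)[OF that] by (auto simp: dist_commute)
      ultimately show ?thesis by (intro exI[of _ "\<lambda>i. fst (z i)"] exI[of _ "\<lambda>i. snd (z i)"]) auto
    qed
    note near = this
    define Q where "Q k p \<longleftrightarrow> (\<forall>i<n. dist (fst p i, snd p i) (x i, y i) < inverse (real (Suc k))) \<and>
        (\<Sum>i<n. fst p i \<bullet> snd p (?s i)) \<le> (\<Sum>i<n. fst p i \<bullet> snd p i)" for k and p :: "(nat \<Rightarrow> 'a) \<times> (nat \<Rightarrow> 'a)"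
    have "\<forall>k. \<exists>p. Q k p"
    proof
      fix k
      from near[of k] obtain u v where "(\<forall>i<n. dist (u i, v i) (x i, y i) < inverse (real (Suc k))) \<and>
        (\<Sum>i<n. u i \<bullet> v (?s i)) \<le> (\<Sum>i<n. u i \<bullet> v i)" by blast
      then have "Q k (u, v)" unfolding Q_def by simp
      then show "\<exists>p. Q k p" ..
    qed
    from choice[OF this] obtain p where p: "\<forall>k. Q k (p k)" ..
    define u v where "u k = fst (p k)" and "v k = snd (p k)" for k
    have uv: "(\<forall>i<n. dist (u k i, v k i) (x i, y i) < inverse (real (Suc k))) \<and>
        (\<Sum>i<n. u k i \<bullet> v k (?s i)) \<le> (\<Sum>i<n. u k i \<bullet> v k i)" for k
      using p unfolding Q_def u_def v_def by blast
    have uv_lim: "(\<lambda>k. (u k i, v k i)) \<longlonglongrightarrow> (x i, y i)" if "i < n" for i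
    proof (rule tendsto_dist_iff[THEN iffD2], rule tendsto_sandwich[OF _ _ tendsto_const LIMSEQ_inverse_real_of_nat])
      show "\<forall>\<^sub>F k in sequentially. 0 \<le> dist (u k i, v k i) (x i, y i)" by simp
      show "\<forall>\<^sub>F k in sequentially. dist (u k i, v k i) (x i, y i) \<le> inverse (real (Suc k))"
        using uv that by (intro always_eventually allI less_imp_le) blast
    qed
    have u: "(\<lambda>k. u k i) \<longlonglongrightarrow> x i" and v: "(\<lambda>k. v k i) \<longlonglongrightarrow> y i" if "i < n" for i
      using tendsto_fst[OF uv_lim[OF that]] tendsto_snd[OF uv_lim[OF that]] by simp_all
    show "(\<Sum>i<n. x i \<bullet> y (?s i)) \<le> (\<Sum>i<n. x i \<bullet> y i)"
    proof (rule LIMSEQ_le)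
      show "(\<lambda>k. \<Sum>i<n. u k i \<bullet> v k (?s i)) \<longlonglongrightarrow> (\<Sum>i<n. x i \<bullet> y (?s i))"
        using n by (intro tendsto_sum tendsto_inner u v) auto
      show "(\<lambda>k. \<Sum>i<n. u k i \<bullet> v k i) \<longlonglongrightarrow> (\<Sum>i<n. x i \<bullet> y i)"
        by (intro tendsto_sum tendsto_inner u v) auto
    qed (use uv in auto)
  qed
  then have "\<gamma> \<in> Gamma0cm \<mu> \<nu>" using zc by (simp add: Gamma0cm_def)
  then show ?thesis by blast
qed

subsection \<open>Points with several subgradients\<close>

text \<open>Closed sets are countable unions of compact sets here, so projections of closed graphs
  are Borel without recourse to analytic sets.\<close>

lemma closed_image_borel:
  fixes f :: "'a::euclidean_space \<Rightarrow> 'b::euclidean_space"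
  assumes "closed T" "continuous_on UNIV f"
  shows "f ` T \<in> sets borel"
proof -
  have "T = (\<Union>n. T \<inter> cball 0 (real n))"
    using real_arch_simple by auto
  then have "f ` T = (\<Union>n. f ` (T \<inter> cball 0 (real n)))" by (metis image_UN)
  also have "\<dots> \<in> sets borel"
  proof (intro sets.countable_UN)
    have "compact (f ` (T \<inter> cball 0 (real n)))" for n
      by (intro compact_continuous_image closed_Int_compact compact_cball assms(1)
          continuous_on_subset[OF assms(2)]) simp
    then show "range (\<lambda>n. f ` (T \<inter> cball 0 (real n))) \<subseteq> sets borel"
      using compact_imp_closed borel_closed by blast
  qed
  finally show ?thesis .
qed

lemma subdifferential_fibre_convex:
  assumes cc: "closed_convex \<psi>" and v: "(x, v) \<in> subdifferential \<psi>" and w: "(x, w) \<in> subdifferential \<psi>"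
    and t: "0 \<le> t" "t \<le> 1"
  shows "(x, (1 - t) *\<^sub>R v + t *\<^sub>R w) \<in> subdifferential \<psi>"
proof (rule subdifferential_realI[OF cc subdifferentialD(1)[OF v]])
  fix y assume y: "\<psi> y < \<infinity>"
  let ?p = "\<lambda>x. real_of_ereal (\<psi> x)"
  have "(1 - t) * (?p x + (y - x) \<bullet> v) + t * (?p x + (y - x) \<bullet> w) \<le> (1 - t) * ?p y + t * ?p y"
    using subdifferential_realD[OF cc v y] subdifferential_realD[OF cc w y] t
    by (intro add_mono mult_left_mono) auto
  then show "?p x + (y - x) \<bullet> ((1 - t) *\<^sub>R v + t *\<^sub>R w) \<le> ?p y"
    by (simp add: inner_add_right algebra_simps)
qed

definition singular_slice :: "('a::euclidean_space \<Rightarrow> ereal) \<Rightarrow> 'a \<Rightarrow> real \<Rightarrow> 'a set" where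
  "singular_slice \<psi> e q = fst ` (subdifferential \<psi> \<inter> {z. (fst z + snd z) \<bullet> e = q})"

(* A subdifferential with two elements contains a segment, which meets one of countably many
   hyperplanes in the Minty coordinate x + v; in that coordinate x is a 1-Lipschitz function. *)
definition singular_set :: "('a::euclidean_space \<Rightarrow> ereal) \<Rightarrow> 'a set" where
  "singular_set \<psi> = (\<Union>(e, q)\<in>Basis \<times> \<rat>. singular_slice \<psi> e q)"

text \<open>Slicing at rational heights, instead of collecting the points with several subgradients
  directly, exhibits the set as a countable union of projections of closed sets.\<close>

lemma singular_set_borel:
  assumes "closed_convex \<psi>"
  shows "singular_set \<psi> \<in> sets borel"
  unfolding singular_set_def singular_slice_def
proof (intro sets.countable_UN' countable_SIGMA countable_finite finite_Basis countable_rat, clarify)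
  fix e :: 'a and q :: real
  show "fst ` (subdifferential \<psi> \<inter> {z. (fst z + snd z) \<bullet> e = q}) \<in> sets borel"
    by (intro closed_image_borel closed_Int closed_subdifferential assms closed_Collect_eq continuous_intros)
qed

lemma unique_subgradient_off_singular_set:
  assumes cc: "closed_convex \<psi>" and x: "x \<notin> singular_set \<psi>"
    and v: "(x, v) \<in> subdifferential \<psi>" and w: "(x, w) \<in> subdifferential \<psi>"
  shows "v = w"
proof (rule ccontr)
  assume "v \<noteq> w"
  then obtain e where e: "e \<in> Basis" "v \<bullet> e \<noteq> w \<bullet> e" using euclidean_eq_iff by blast
  have "\<exists>q\<in>\<rat>. \<exists>t. 0 \<le> t \<and> t \<le> 1 \<and> (x + ((1 - t) *\<^sub>R v + t *\<^sub>R w)) \<bullet> e = q"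
  proof -
    let ?a = "(x + v) \<bullet> e" and ?b = "(x + w) \<bullet> e"
    have ne: "?a \<noteq> ?b" using e by (simp add: inner_add_left)
    then have "\<exists>q\<in>\<rat>. min ?a ?b < q \<and> q < max ?a ?b" by (intro Rats_dense_in_real) auto
    then obtain q where q: "q \<in> \<rat>" "min ?a ?b < q" "q < max ?a ?b" by blast
    \<comment> \<open>The height of \<open>x + ((1 - t) *\<^sub>R v + t *\<^sub>R w)\<close> in
      direction \<open>e\<close> is affine in \<open>t\<close>; this is the parameter at which it
      equals \<open>q\<close>.\<close>
    define t where "t = (q - ?a) / (?b - ?a)"
    have "0 \<le> t" "t \<le> 1"
      using q ne by (auto simp: t_def divide_simps min_def max_def split: if_splits)
    moreover have "t * (?b - ?a) = q - ?a" using ne by (simp add: t_def)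
    then have "(x + ((1 - t) *\<^sub>R v + t *\<^sub>R w)) \<bullet> e = q"
      by (simp add: inner_add_left algebra_simps)
    ultimately show ?thesis using q(1) by blast
  qed
  then obtain q t where q: "q \<in> \<rat>" "0 \<le> t" "t \<le> 1" "(x + ((1 - t) *\<^sub>R v + t *\<^sub>R w)) \<bullet> e = q" by blast
  have "(x, (1 - t) *\<^sub>R v + t *\<^sub>R w) \<in> subdifferential \<psi>"
    by (rule subdifferential_fibre_convex[OF cc v w q(2,3)])
  then have "x \<in> singular_slice \<psi> e q"
    unfolding singular_slice_def using q(4) by (intro image_eqI[of _ _ "(x, (1 - t) *\<^sub>R v + t *\<^sub>R w)"]) auto
  then show False using x e q(1) by (auto simp: singular_set_def)
qed

lemma hausdorff_measure_subset_eq_0: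
  assumes B: "hausdorff_measure s B = 0" and "A \<subseteq> B"
  shows "hausdorff_measure s A = 0"
  unfolding hausdorff_measure_eq_0_iff
proof (intro allI impI)
  fix \<delta> :: real and \<epsilon> :: ennreal assume "\<delta> > 0" "\<epsilon> > 0"
  then obtain U where "B \<subseteq> (\<Union>i::nat. U i)" "\<forall>i. bounded (U i) \<and> diameter (U i) \<le> \<delta>"
      "(\<Sum>i. ennreal (diameter (U i) powr s)) < \<epsilon>"
    using B unfolding hausdorff_measure_eq_0_iff by blast
  then show "\<exists>U. A \<subseteq> (\<Union>i::nat. U i) \<and> (\<forall>i. bounded (U i) \<and> diameter (U i) \<le> \<delta>) \<and>
      (\<Sum>i. ennreal (diameter (U i) powr s)) < \<epsilon>"
    using \<open>A \<subseteq> B\<close> by (intro exI[of _ U]) auto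
qed

lemma hausdorff_measure_countable_UN_eq_0:
  assumes "countable I" "I \<noteq> {}" "\<And>i. i \<in> I \<Longrightarrow> hausdorff_measure s (A i) = 0"
  shows "hausdorff_measure s (\<Union>i\<in>I. A i) = 0"
proof -
  have "(\<Union>i\<in>I. A i) = (\<Union>n. A (from_nat_into I n))"
    using range_from_nat_into[OF assms(2,1)] by (metis image_image)
  then show ?thesis
    by (simp only:) (intro hausdorff_measure_UN_eq_0 assms(3) from_nat_into assms(2))
qed

text \<open>For every exponent above \<open>DIM('a) - 1\<close> each slice is a countable union of
  the bounded slices estimated before, and countable unions keep the measure 0.\<close>

lemma hausdorff_dim_singular_set:
  fixes \<psi> :: "'a::euclidean_space \<Rightarrow> ereal"
  assumes cc: "closed_convex \<psi>"
  shows "hausdorff_dim (singular_set \<psi> - {0}) \<le> ereal (real DIM('a) - 1)"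
proof (rule hausdorff_dim_le)
  show "real DIM('a) - 1 \<ge> 0" using DIM_positive[where 'a='a] by (simp add: Suc_leI)
  fix s assume s: "s > real DIM('a) - 1"
  have slice: "hausdorff_measure s (singular_slice \<psi> e q) = 0" if e: "e \<in> Basis" for e q
  proof (rule hausdorff_measure_subset_eq_0)
    let ?A = "\<lambda>R::nat. {x. \<exists>v. (x, v) \<in> subdifferential \<psi> \<and> (x + v) \<bullet> e = q \<and>
        (\<forall>b\<in>Basis. \<bar>(x + v) \<bullet> b\<bar> \<le> real R)}"
    show "hausdorff_measure s (\<Union>R. ?A R) = 0"
      by (intro hausdorff_measure_UN_eq_0 hausdorff_measure_monotone_slice[OF _ e s]
          subdifferential_monotone[OF cc])
    show "singular_slice \<psi> e q \<subseteq> (\<Union>R. ?A R)"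
    proof
      fix x assume "x \<in> singular_slice \<psi> e q"
      then obtain v where v: "(x, v) \<in> subdifferential \<psi>" "(x + v) \<bullet> e = q"
        by (auto simp: singular_slice_def)
      obtain R :: nat where R: "norm (x + v) \<le> real R" using real_arch_simple by blast
      have "\<bar>(x + v) \<bullet> b\<bar> \<le> real R" if "b \<in> Basis" for b
        using Basis_le_norm[OF that, of "x + v"] R by linarith
      then show "x \<in> (\<Union>R. ?A R)" using v by blast
    qed
  qed
  have "hausdorff_measure s (singular_set \<psi>) = 0"
    unfolding singular_set_def
  proof (rule hausdorff_measure_countable_UN_eq_0)
    show "countable ((Basis :: 'a set) \<times> (\<rat> :: real set))"
      by (intro countable_SIGMA countable_finite finite_Basis countable_rat)
    show "(Basis :: 'a set) \<times> (\<rat> :: real set) \<noteq> {}" using Rats_0 nonempty_Basis by blast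
  qed (use slice in auto)
  then show "hausdorff_measure s (singular_set \<psi> - {0}) = 0"
    by (rule hausdorff_measure_subset_eq_0) auto
qed

subsection \<open>Uniqueness\<close>

lemma zero_coupling_sets:
  assumes "zero_coupling \<mu> \<nu> \<gamma>"
  shows "punctured_measure \<gamma>" "space \<gamma> = - {0}"
    "A \<in> sets borel \<Longrightarrow> 0 \<notin> A \<Longrightarrow> A \<times> UNIV \<in> sets \<gamma>"
    "A \<in> sets borel \<Longrightarrow> 0 \<notin> A \<Longrightarrow> UNIV \<times> A \<in> sets \<gamma>"
    "A \<in> sets borel \<Longrightarrow> 0 \<notin> A \<Longrightarrow> emeasure \<gamma> (A \<times> UNIV) = emeasure \<mu> A"
    "A \<in> sets borel \<Longrightarrow> 0 \<notin> A \<Longrightarrow> emeasure \<gamma> (UNIV \<times> A) = emeasure \<nu> A"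
proof -
  show p: "punctured_measure \<gamma>" using assms by (simp add: zero_coupling_def)
  then show "space \<gamma> = - {0}" by (rule space_punctured)
  show "A \<times> UNIV \<in> sets \<gamma>" "UNIV \<times> A \<in> sets \<gamma>" if "A \<in> sets borel" "0 \<notin> A"
    using that by (auto simp: punctured_sets_iff[OF p] zero_prod_def intro: borel_Times)
  show "emeasure \<gamma> (A \<times> UNIV) = emeasure \<mu> A" "emeasure \<gamma> (UNIV \<times> A) = emeasure \<nu> A"
    if "A \<in> sets borel" "0 \<notin> A"
    using that assms by (auto simp: zero_coupling_def)
qed

text \<open>A pair of norm at least \<open>r\<close> has a coordinate of norm at least
  \<open>r / 2\<close>, so a set away from the origin is covered by two strips whose masses are read
  off from the marginals.\<close>

lemma zero_coupling_M0:
  assumes "\<mu> \<in> M0" "\<nu> \<in> M0" and zc: "zero_coupling \<mu> \<nu> \<gamma>"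
  shows "\<gamma> \<in> M0"
  unfolding M0_def
proof (intro CollectI conjI ballI impI)
  show "punctured_measure \<gamma>" by (rule zero_coupling_sets(1)[OF zc])
  fix B :: "('a \<times> 'a) set" assume B: "B \<in> sets borel" "0 \<notin> closure B"
  then obtain r where r: "r > 0" "ball 0 r \<subseteq> - closure B"
    using openE[of "- closure B" 0] by auto
  define A where "A = {x::'a. r / 2 \<le> norm x}"
  have "closed A" unfolding A_def by (intro closed_Collect_le continuous_intros)
  moreover have "0 \<notin> A" using r by (simp add: A_def)
  ultimately have A: "closed A" "0 \<notin> A" by auto
  then have Ab: "A \<in> sets borel" by simp
  have "z \<in> A \<times> UNIV \<union> UNIV \<times> A" if "z \<in> B" for z
  proof -
    obtain x y where z: "z = (x, y)" by (cases z)
    have "z \<notin> ball 0 r" using that r(2) closure_subset by blast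
    then have "r \<le> norm z" by (simp only: mem_ball dist_0_norm not_less)
    then have "r \<le> norm x + norm y" using norm_Pair_le[of x y] unfolding z by linarith
    then have "x \<in> A \<or> y \<in> A" unfolding A_def mem_Collect_eq by linarith
    then show ?thesis by (auto simp: z)
  qed
  then have "B \<subseteq> A \<times> UNIV \<union> UNIV \<times> A" by blast
  note sub = this
  note m = zero_coupling_sets(3-6)[OF zc Ab A(2)]
  have "emeasure \<gamma> B \<le> emeasure \<gamma> (A \<times> UNIV \<union> UNIV \<times> A)"
    by (rule emeasure_mono[OF sub sets.Un[OF m(1,2)]])
  also have "\<dots> \<le> emeasure \<gamma> (A \<times> UNIV) + emeasure \<gamma> (UNIV \<times> A)"
    by (rule emeasure_subadditive[OF m(1,2)])
  also have "\<dots> = emeasure \<mu> A + emeasure \<nu> A" by (simp only: m(3,4))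
  also have "\<dots> < \<infinity>"
  proof -
    have "0 \<notin> closure A" using A by simp
    then show ?thesis using M0_D(2)[OF assms(1) Ab] M0_D(2)[OF assms(2) Ab] by simp
  qed
  finally show "emeasure \<gamma> B < \<infinity>" .
qed

text \<open>The complement of the support is a union of open null sets; by the Lindelof property
  countably many of them suffice.\<close>

lemma AE_in_spt:
  assumes p: "punctured_measure \<gamma>"
  shows "AE z in \<gamma>. z \<in> spt \<gamma>"
proof -
  let ?F = "{U. open U \<and> emeasure \<gamma> (U - {0}) = 0}"
  obtain F where F: "F \<subseteq> ?F" "countable F" "\<Union>F = \<Union>?F"
    using Lindelof[of ?F] by blast
  have "(\<Union>U\<in>F. U - {0}) \<in> null_sets \<gamma>"
    using F by (intro null_sets_UN' null_setsI) (auto simp: punctured_sets_iff[OF p])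
  moreover have "{z \<in> space \<gamma>. z \<notin> spt \<gamma>} \<subseteq> (\<Union>U\<in>F. U - {0})"
  proof clarify
    fix z assume z: "z \<in> space \<gamma>" "z \<notin> spt \<gamma>"
    then obtain U where "open U" "z \<in> U" "emeasure \<gamma> (U - {0}) = 0"
      by (auto simp: spt_def)
    then have "z \<in> \<Union>F" unfolding F(3) by blast
    then show "z \<in> (\<Union>U\<in>F. U - {0})" using z(1) space_punctured[OF p] by auto
  qed
  ultimately show ?thesis by (rule AE_I')
qed

lemma AE_fst_not_null:
  assumes zc: "zero_coupling \<mu> \<nu> \<gamma>" and A: "A \<in> sets borel" "emeasure \<mu> (A - {0}) = 0"
  shows "AE z in \<gamma>. fst z \<in> A \<longrightarrow> fst z = 0"
proof (rule AE_I')
  show "(A - {0}) \<times> UNIV \<in> null_sets \<gamma>"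
    using zero_coupling_sets(3,5)[OF zc, of "A - {0}"] A by (intro null_setsI) auto
qed auto

text \<open>A property of one coordinate is decided by the marginal and thus passes between
  couplings, except where that coordinate is 0 and the marginal is blind. The map \<open>f\<close>
  stands for either projection.\<close>

lemma AE_marginal_transfer:
  fixes f :: "'b::euclidean_space \<Rightarrow> 'a::euclidean_space"
  assumes p: "punctured_measure \<gamma>1" "punctured_measure \<gamma>2"
    and f: "f \<in> borel_measurable borel" "f 0 = 0"
    and m: "\<And>A. A \<in> sets borel \<Longrightarrow> 0 \<notin> A \<Longrightarrow> emeasure \<gamma>1 (f -` A) = emeasure \<kappa> A"
      "\<And>A. A \<in> sets borel \<Longrightarrow> 0 \<notin> A \<Longrightarrow> emeasure \<gamma>2 (f -` A) = emeasure \<kappa> A"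
    and B: "B \<in> sets borel" and AE: "AE z in \<gamma>1. f z \<in> B"
  shows "AE z in \<gamma>2. f z \<noteq> 0 \<longrightarrow> f z \<in> B" "emeasure \<kappa> (- B - {0}) = 0"
proof -
  let ?N = "f -` (- B - {0})"
  have N: "?N \<in> sets borel" "0 \<notin> ?N" using measurable_sets[OF f(1), of "- B - {0}"] B f(2) by auto
  have mB: "- B - {0} \<in> sets borel" "0 \<notin> - B - {0}" using B by auto
  have "emeasure \<gamma>1 {z \<in> space \<gamma>1. z \<in> ?N} = 0"
    using AE by (intro emeasure_eq_0_AE) (auto elim: eventually_mono)
  moreover have "{z \<in> space \<gamma>1. z \<in> ?N} = ?N" using N(2) by (auto simp: space_punctured[OF p(1)])
  ultimately show 0: "emeasure \<kappa> (- B - {0}) = 0" using m(1)[OF mB] by simp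
  then have "?N \<in> null_sets \<gamma>2"
    using m(2)[OF mB] N by (intro null_setsI) (auto simp: punctured_sets_iff[OF p(2)])
  then show "AE z in \<gamma>2. f z \<noteq> 0 \<longrightarrow> f z \<in> B" by (rule AE_I') auto
qed

lemma AE_fst_transfer:
  assumes zc: "zero_coupling \<mu> \<nu> \<gamma>1" "zero_coupling \<mu> \<nu> \<gamma>2" and B: "B \<in> sets borel"
    and AE: "AE z in \<gamma>1. fst z \<in> B"
  shows "AE z in \<gamma>2. fst z \<noteq> 0 \<longrightarrow> fst z \<in> B" "emeasure \<mu> (- B - {0}) = 0"
proof -
  have f: "(fst :: 'a \<times> 'a \<Rightarrow> 'a) \<in> borel_measurable borel" "fst (0 :: 'a \<times> 'a) = 0"
    by (simp_all add: borel_measurable_continuous_onI continuous_on_fst)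
  have m: "emeasure \<gamma> (fst -` A) = emeasure \<mu> A" if "zero_coupling \<mu> \<nu> \<gamma>" "A \<in> sets borel" "0 \<notin> A" for \<gamma> A
    using zero_coupling_sets(5)[OF that] by (simp add: vimage_fst)
  note zc1 = zero_coupling_sets(1)[OF zc(1)] and zc2 = zero_coupling_sets(1)[OF zc(2)]
  show "AE z in \<gamma>2. fst z \<noteq> 0 \<longrightarrow> fst z \<in> B" "emeasure \<mu> (- B - {0}) = 0"
    by (rule AE_marginal_transfer[OF zc1 zc2 f m[OF zc(1)] m[OF zc(2)] B AE]; assumption)+
qed

lemma AE_snd_transfer:
  assumes zc: "zero_coupling \<mu> \<nu> \<gamma>1" "zero_coupling \<mu> \<nu> \<gamma>2" and B: "B \<in> sets borel"
    and AE: "AE z in \<gamma>1. snd z \<in> B"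
  shows "AE z in \<gamma>2. snd z \<noteq> 0 \<longrightarrow> snd z \<in> B"
proof -
  have f: "(snd :: 'a \<times> 'a \<Rightarrow> 'a) \<in> borel_measurable borel" "snd (0 :: 'a \<times> 'a) = 0"
    by (simp_all add: borel_measurable_continuous_onI continuous_on_snd)
  have m: "emeasure \<gamma> (snd -` A) = emeasure \<nu> A" if "zero_coupling \<mu> \<nu> \<gamma>" "A \<in> sets borel" "0 \<notin> A" for \<gamma> A
    using zero_coupling_sets(6)[OF that] by (simp add: vimage_snd)
  show ?thesis
    by (rule AE_marginal_transfer(1)[OF zero_coupling_sets(1)[OF zc(1)] zero_coupling_sets(1)[OF zc(2)]
          f m[OF zc(1)] m[OF zc(2)] B AE]; assumption)
qed

section \<open>Fenchel duality for normalised potentials\<close>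

definition potential :: "('a::real_normed_vector \<Rightarrow> ereal) \<Rightarrow> 'a \<Rightarrow> real" where
  "potential \<psi> x = real_of_ereal (\<psi> x) - real_of_ereal (\<psi> 0)"

text \<open>The Legendre-Fenchel conjugate of the normalised potential. The supremum runs over the
  domain only, because outside it \<open>potential\<close> has a meaningless finite value.\<close>

definition conjugate :: "('a::real_inner \<Rightarrow> ereal) \<Rightarrow> 'a \<Rightarrow> ereal" where
  "conjugate \<psi> y = (SUP x\<in>{x. \<psi> x < \<infinity>}. ereal (x \<bullet> y - potential \<psi> x))"

lemma potential_measurable:
  fixes \<psi> :: "'a::euclidean_space \<Rightarrow> ereal"
  assumes cc: "closed_convex \<psi>"
  shows "potential \<psi> \<in> borel_measurable borel"
proof -
  have "\<psi> \<in> borel_measurable borel"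
    unfolding borel_measurable_iff_Iic_ereal
  proof
    fix a :: ereal
    show "\<psi> -` {..a} \<inter> space borel \<in> sets borel"
    proof (cases a)
      case (real r)
      have "closed ((\<lambda>x. (x, r)) -` {(x, r::real). \<psi> x \<le> ereal r})"
        by (intro closed_vimage closed_convexD(3)[OF cc] continuous_intros)
      moreover have "(\<lambda>x. (x, r)) -` {(x, r::real). \<psi> x \<le> ereal r} = \<psi> -` {..a} \<inter> space borel"
        using real by auto
      ultimately show ?thesis by simp
    next
      case PInf
      then have "\<psi> -` {..a} \<inter> space borel = UNIV" by auto
      then show ?thesis by simp
    next
      case MInf
      then have "\<psi> -` {..a} \<inter> space borel = {}" using closed_convexD(1)[OF cc] by auto
      then show ?thesis by simp
    qed
  qed
  then show ?thesis unfolding potential_def by measurable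
qed

text \<open>The supremum is over an uncountable family, but its sublevel sets are intersections of
  closed sets.\<close>

lemma conjugate_measurable:
  fixes \<psi> :: "'a::euclidean_space \<Rightarrow> ereal"
  shows "conjugate \<psi> \<in> borel_measurable borel"
  unfolding borel_measurable_iff_Iic_ereal
proof
  fix a :: ereal
  have cl: "closed {y. ereal (x \<bullet> y - potential \<psi> x) \<le> a}" for x
    by (cases a) (auto intro!: closed_Collect_le continuous_intros)
  have eq: "conjugate \<psi> -` {..a} \<inter> space borel
      = (\<Inter>x\<in>{x. \<psi> x < \<infinity>}. {y. ereal (x \<bullet> y - potential \<psi> x) \<le> a})"
    by (auto simp: conjugate_def SUP_le_iff)
  show "conjugate \<psi> -` {..a} \<inter> space borel \<in> sets borel"
    unfolding eq by (intro borel_closed closed_INT ballI cl)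
qed

lemma potential_nonneg:
  assumes cc: "closed_convex \<psi>" and 0: "(0, 0) \<in> subdifferential \<psi>" and x: "\<psi> x < \<infinity>"
  shows "0 \<le> potential \<psi> x"
  using subdifferential_realD[OF cc 0 x] by (simp add: potential_def)

lemma conjugate_0:
  assumes cc: "closed_convex \<psi>" and 0: "(0, 0) \<in> subdifferential \<psi>"
  shows "conjugate \<psi> 0 = 0"
proof (rule antisym)
  show "conjugate \<psi> 0 \<le> 0"
    unfolding conjugate_def using potential_nonneg[OF cc 0] by (intro SUP_least) auto
  have "ereal (0 \<bullet> 0 - potential \<psi> 0) \<le> conjugate \<psi> 0"
    unfolding conjugate_def by (rule SUP_upper2[of 0]) (use subdifferentialD(1)[OF 0] in auto)
  then show "0 \<le> conjugate \<psi> 0" by (simp add: potential_def zero_ereal_def)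
qed

lemma fenchel_young:
  assumes x: "\<psi> x < \<infinity>" and y: "conjugate \<psi> y < \<infinity>"
  shows "x \<bullet> y \<le> potential \<psi> x + real_of_ereal (conjugate \<psi> y)"
proof -
  have "ereal (x \<bullet> y - potential \<psi> x) \<le> conjugate \<psi> y"
    unfolding conjugate_def using x by (intro SUP_upper) auto
  then show ?thesis using y by (cases "conjugate \<psi> y") auto
qed

lemma fenchel_young_eq:
  assumes cc: "closed_convex \<psi>" and xy: "(x, y) \<in> subdifferential \<psi>"
  shows "conjugate \<psi> y < \<infinity>" "potential \<psi> x + real_of_ereal (conjugate \<psi> y) = x \<bullet> y"
proof -
  have "conjugate \<psi> y \<le> ereal (x \<bullet> y - potential \<psi> x)"
    unfolding conjugate_def
  proof (rule SUP_least)
    fix z assume "z \<in> {x. \<psi> x < \<infinity>}"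
    then show "ereal (z \<bullet> y - potential \<psi> z) \<le> ereal (x \<bullet> y - potential \<psi> x)"
      using subdifferential_realD[OF cc xy, of z] by (simp add: potential_def inner_diff_left)
  qed
  moreover have "ereal (x \<bullet> y - potential \<psi> x) \<le> conjugate \<psi> y"
    unfolding conjugate_def using subdifferentialD(1)[OF xy] by (intro SUP_upper) auto
  ultimately have eq: "conjugate \<psi> y = ereal (x \<bullet> y - potential \<psi> x)" by (rule antisym)
  show "conjugate \<psi> y < \<infinity>" "potential \<psi> x + real_of_ereal (conjugate \<psi> y) = x \<bullet> y"
    by (simp_all add: eq)
qed

lemma subdifferential_of_fenchel_young:
  assumes cc: "closed_convex \<psi>" and x: "\<psi> x < \<infinity>" and y: "conjugate \<psi> y < \<infinity>"
    and eq: "potential \<psi> x + real_of_ereal (conjugate \<psi> y) \<le> x \<bullet> y"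
  shows "(x, y) \<in> subdifferential \<psi>"
proof (rule subdifferential_realI[OF cc x])
  fix z assume "\<psi> z < \<infinity>"
  then have "z \<bullet> y \<le> potential \<psi> z + real_of_ereal (conjugate \<psi> y)" by (rule fenchel_young[OF _ y])
  then show "real_of_ereal (\<psi> x) + (z - x) \<bullet> y \<le> real_of_ereal (\<psi> z)"
    using eq by (simp add: potential_def inner_diff_left)
qed

section \<open>Comparison of distributions\<close>

lemma AE_mem_of_emeasure_eq:
  assumes S: "S \<in> sets M" and T: "T \<in> sets M" and AE: "AE z in M. z \<in> S \<longrightarrow> z \<in> T"
    and eq: "emeasure M S = emeasure M T" and fin: "emeasure M S < \<infinity>"
  shows "AE z in M. z \<in> T \<longrightarrow> z \<in> S"
proof (rule AE_I')
  have "emeasure M (S \<inter> T) = emeasure M S"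
    by (rule emeasure_eq_AE) (use AE S T in \<open>auto elim: eventually_mono\<close>)
  moreover have "emeasure M (T - S \<inter> T) = emeasure M T - emeasure M (S \<inter> T)"
    using S T fin eq calculation by (intro emeasure_Diff) (auto simp: less_top)
  ultimately have "emeasure M (T - S \<inter> T) = 0" using eq fin by (simp add: less_top)
  then show "T - S \<inter> T \<in> null_sets M" using S T by (intro null_setsI) auto
qed auto

(* Comparing distributions: if u <= v holds for one coupling and v <= u for the other, then
   u and v have the same upper level sets at positive heights, so both inequalities are equalities. *)
lemma positive_parts_eq:
  fixes u v :: "'a::euclidean_space \<Rightarrow> real"
  assumes zc: "zero_coupling \<mu> \<nu> \<gamma>1" "zero_coupling \<mu> \<nu> \<gamma>2"
    and meas: "u \<in> borel_measurable borel" "v \<in> borel_measurable borel" and zero: "u 0 = 0" "v 0 = 0"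
    and le: "AE z in \<gamma>1. u (fst z) \<le> v (snd z)" and ge: "AE z in \<gamma>2. v (snd z) \<le> u (fst z)"
    and fin: "\<And>t. t > 0 \<Longrightarrow> emeasure \<mu> {x. t < u x} < \<infinity>"
  shows "AE z in \<gamma>1. max 0 (u (fst z)) = max 0 (v (snd z))"
    "AE z in \<gamma>2. max 0 (u (fst z)) = max 0 (v (snd z))"
proof -
  have levels: "AE z in \<gamma>1. t < v (snd z) \<longrightarrow> t < u (fst z)" "AE z in \<gamma>2. t < u (fst z) \<longrightarrow> t < v (snd z)"
    if t: "t > 0" for t
  proof -
    let ?F = "{x. t < u x}" and ?G = "{y. t < v y}"
    have F: "?F \<in> sets borel" "0 \<notin> ?F" and G: "?G \<in> sets borel" "0 \<notin> ?G"
      using meas zero t by auto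
    note f1 = zero_coupling_sets(3,5)[OF zc(1) F] and f2 = zero_coupling_sets(3,5)[OF zc(2) F]
      and g1 = zero_coupling_sets(4,6)[OF zc(1) G] and g2 = zero_coupling_sets(4,6)[OF zc(2) G]
    have sub1: "AE z in \<gamma>1. z \<in> ?F \<times> UNIV \<longrightarrow> z \<in> UNIV \<times> ?G" using le by eventually_elim auto
    have sub2: "AE z in \<gamma>2. z \<in> UNIV \<times> ?G \<longrightarrow> z \<in> ?F \<times> UNIV" using ge by eventually_elim auto
    have "emeasure \<mu> ?F \<le> emeasure \<nu> ?G"
      using emeasure_mono_AE[OF sub1 g1(1)] unfolding f1 g1 .
    moreover have "emeasure \<nu> ?G \<le> emeasure \<mu> ?F"
      using emeasure_mono_AE[OF sub2 f2(1)] unfolding f2 g2 .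
    ultimately have eq: "emeasure \<mu> ?F = emeasure \<nu> ?G" by (rule antisym)
    have "AE z in \<gamma>1. z \<in> UNIV \<times> ?G \<longrightarrow> z \<in> ?F \<times> UNIV"
      by (rule AE_mem_of_emeasure_eq[OF f1(1) g1(1) sub1]) (use eq fin[OF t] f1 g1 in simp_all)
    then show "AE z in \<gamma>1. t < v (snd z) \<longrightarrow> t < u (fst z)" by eventually_elim auto
    have "AE z in \<gamma>2. z \<in> ?F \<times> UNIV \<longrightarrow> z \<in> UNIV \<times> ?G"
      by (rule AE_mem_of_emeasure_eq[OF g2(1) f2(1) sub2]) (use eq fin[OF t] f2 g2 in simp_all)
    then show "AE z in \<gamma>2. t < u (fst z) \<longrightarrow> t < v (snd z)" by eventually_elim auto
  qed
  \<comment> \<open>Rational heights keep the exceptional sets countable in number, and a rational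
    strictly between \<open>max 0 a\<close> and \<open>b\<close> suffices to refute
    \<open>max 0 a < b\<close>.\<close>
  have rat: "countable {t\<in>\<rat>. t > (0::real)}" by (rule countable_subset[OF _ countable_rat]) auto
  have squeeze: "max 0 a = max 0 b" if "a \<le> b" "\<forall>t\<in>{t\<in>\<rat>. t > 0}. t < b \<longrightarrow> t < a" for a b :: real
  proof -
    have "b \<le> max 0 a"
    proof (rule ccontr)
      assume "\<not> b \<le> max 0 a"
      then have "max 0 a < b" by (rule not_le_imp_less)
      then obtain t where "t \<in> \<rat>" "max 0 a < t" "t < b" using Rats_dense_in_real by blast
      then show False using that(2) by force
    qed
    then show ?thesis using that(1) by auto
  qed
  have "AE z in \<gamma>1. \<forall>t\<in>{t\<in>\<rat>. t > 0}. t < v (snd z) \<longrightarrow> t < u (fst z)"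
    unfolding AE_ball_countable[OF rat] using levels(1) by blast
  then show "AE z in \<gamma>1. max 0 (u (fst z)) = max 0 (v (snd z))"
    using le by eventually_elim (rule squeeze)
  have "AE z in \<gamma>2. \<forall>t\<in>{t\<in>\<rat>. t > 0}. t < u (fst z) \<longrightarrow> t < v (snd z)"
    unfolding AE_ball_countable[OF rat] using levels(2) by blast
  then show "AE z in \<gamma>2. max 0 (u (fst z)) = max 0 (v (snd z))"
    using ge by eventually_elim (rule squeeze[symmetric])
qed

text \<open>Makes Fenchel-Young for the potential of one coupling applicable along the other. The
  couplings share their marginals, so coordinates of points of \<gamma>' lie almost everywhere in
  the projections of the subdifferential; coordinates equal to 0 are covered by
  \<open>(0, 0)\<close>.\<close>

lemma AE_finite_potential:
  fixes \<psi> :: "'a::euclidean_space \<Rightarrow> ereal"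
  assumes zc: "zero_coupling \<mu> \<nu> \<gamma>" "zero_coupling \<mu> \<nu> \<gamma>'" and cc: "closed_convex \<psi>"
    and AE: "AE z in \<gamma>. z \<in> subdifferential \<psi>" and 0: "(0, 0) \<in> subdifferential \<psi>"
  shows "AE z in \<gamma>'. \<psi> (fst z) < \<infinity> \<and> conjugate \<psi> (snd z) < \<infinity>"
proof -
  have cl: "closed (subdifferential \<psi>)" by (rule closed_subdifferential[OF cc])
  have "AE z in \<gamma>'. fst z \<noteq> 0 \<longrightarrow> fst z \<in> fst ` subdifferential \<psi>"
    by (rule AE_fst_transfer(1)[OF zc closed_image_borel[OF cl]])
      (use AE in \<open>auto elim: eventually_mono intro!: continuous_intros\<close>)
  moreover have "AE z in \<gamma>'. snd z \<noteq> 0 \<longrightarrow> snd z \<in> snd ` subdifferential \<psi>"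
    by (rule AE_snd_transfer[OF zc closed_image_borel[OF cl]])
      (use AE in \<open>auto elim: eventually_mono intro!: continuous_intros\<close>)
  ultimately show ?thesis
  proof eventually_elim
    case (elim z)
    have "\<psi> (fst z) < \<infinity>"
    proof (cases "fst z = 0")
      case False
      then obtain y where "(fst z, y) \<in> subdifferential \<psi>" using elim(1) by auto
      then show ?thesis by (rule subdifferentialD(1))
    qed (use subdifferentialD(1)[OF 0] in simp)
    moreover have "conjugate \<psi> (snd z) < \<infinity>"
    proof (cases "snd z = 0")
      case False
      then obtain x where "(x, snd z) \<in> subdifferential \<psi>" using elim(2) by auto
      then show ?thesis by (rule fenchel_young_eq(1)[OF cc])
    qed (use conjugate_0[OF cc 0] in simp)
    ultimately show ?case ..
  qed
qed

(* Where the potential exceeds t > 0, so does the inner product x . y along the coupling, which keeps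
   (x, y) away from the origin although x itself may approach it. *)
lemma level_set_finite:
  fixes \<psi> \<psi>' :: "'a::euclidean_space \<Rightarrow> ereal"
  assumes M0: "\<mu> \<in> M0" "\<nu> \<in> M0" and zc: "zero_coupling \<mu> \<nu> \<gamma>"
    and cc: "closed_convex \<psi>" "closed_convex \<psi>'"
    and 0: "(0, 0) \<in> subdifferential \<psi>" "(0, 0) \<in> subdifferential \<psi>'"
    and AE: "AE z in \<gamma>. z \<in> subdifferential \<psi>" "AE z in \<gamma>. \<psi>' (fst z) < \<infinity>"
    and t: "t > 0"
  shows "emeasure \<mu> {x. t < potential \<psi> x - potential \<psi>' x} < \<infinity>"
proof -
  let ?F = "{x. t < potential \<psi> x - potential \<psi>' x}"
  let ?C = "{z :: 'a \<times> 'a. t \<le> fst z \<bullet> snd z}"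
  have F: "?F \<in> sets borel" "0 \<notin> ?F"
    using potential_measurable[OF cc(1)] potential_measurable[OF cc(2)] t by (auto simp: potential_def[of _ 0])
  have C: "closed ?C" by (intro closed_Collect_le continuous_intros)
  have C0: "0 \<notin> ?C" using t by simp
  have "AE z in \<gamma>. z \<in> ?F \<times> UNIV \<longrightarrow> z \<in> ?C"
    using AE
  proof eventually_elim
    case (elim z)
    have "potential \<psi> (fst z) \<le> fst z \<bullet> snd z"
      using subdifferential_realD[OF cc(1) _ subdifferentialD(1)[OF 0(1)], of "fst z" "snd z"] elim(1)
      by (simp add: potential_def)
    then show ?case using potential_nonneg[OF cc(2) 0(2) elim(2)] by auto
  qed
  then have "emeasure \<gamma> (?F \<times> UNIV) \<le> emeasure \<gamma> ?C"
    by (rule emeasure_mono_AE) (use C C0 in \<open>simp add: punctured_sets_iff[OF zero_coupling_sets(1)[OF zc]]\<close>)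
  also have "\<dots> < \<infinity>"
    using C C0 by (intro M0_D(2)[OF zero_coupling_M0[OF M0 zc]]) auto
  finally show ?thesis using zero_coupling_sets(5)[OF zc F] by simp
qed

lemma AE_in_other_subdifferential:
  fixes \<psi>1 \<psi>2 :: "'a::euclidean_space \<Rightarrow> ereal"
  assumes M0: "\<mu> \<in> M0" "\<nu> \<in> M0" and zc: "zero_coupling \<mu> \<nu> \<gamma>1" "zero_coupling \<mu> \<nu> \<gamma>2"
    and cc: "closed_convex \<psi>1" "closed_convex \<psi>2"
    and 0: "(0, 0) \<in> subdifferential \<psi>1" "(0, 0) \<in> subdifferential \<psi>2"
    and AE: "AE z in \<gamma>1. z \<in> subdifferential \<psi>1" "AE z in \<gamma>2. z \<in> subdifferential \<psi>2"
  shows "AE z in \<gamma>1. z \<in> subdifferential \<psi>2"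
proof -
  define c1 where "c1 y = real_of_ereal (conjugate \<psi>1 y)" for y
  define c2 where "c2 y = real_of_ereal (conjugate \<psi>2 y)" for y
  define u where "u x = potential \<psi>1 x - potential \<psi>2 x" for x
  define v where "v y = c2 y - c1 y" for y
  have mu: "u \<in> borel_measurable borel"
    unfolding u_def using potential_measurable[OF cc(1)] potential_measurable[OF cc(2)] by measurable
  have mv: "v \<in> borel_measurable borel"
    unfolding v_def c1_def c2_def using conjugate_measurable by measurable
  have u0: "u 0 = 0" by (simp add: u_def potential_def)
  have v0: "v 0 = 0" by (simp add: v_def c1_def c2_def conjugate_0[OF cc(1) 0(1)] conjugate_0[OF cc(2) 0(2)])
  note fin1 = AE_finite_potential[OF zc(2,1) cc(2) AE(2) 0(2)]
  note fin2 = AE_finite_potential[OF zc(1,2) cc(1) AE(1) 0(1)]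
  \<comment> \<open>Along \<gamma>1 Fenchel-Young is an equality for \<psi>1 and an inequality for
    \<psi>2; subtracting eliminates the inner product.\<close>
  have le: "AE z in \<gamma>1. u (fst z) \<le> v (snd z)"
    using AE(1) fin1
  proof eventually_elim
    case (elim z)
    then show ?case
      using fenchel_young[of \<psi>2 "fst z" "snd z"] fenchel_young_eq(2)[OF cc(1), of "fst z" "snd z"]
      by (simp add: u_def v_def c1_def c2_def)
  qed
  have ge: "AE z in \<gamma>2. v (snd z) \<le> u (fst z)"
    using AE(2) fin2
  proof eventually_elim
    case (elim z)
    then show ?case
      using fenchel_young[of \<psi>1 "fst z" "snd z"] fenchel_young_eq(2)[OF cc(2), of "fst z" "snd z"]
      by (simp add: u_def v_def c1_def c2_def)
  qed
  have "AE z in \<gamma>1. max 0 (u (fst z)) = max 0 (v (snd z))"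
  proof (rule positive_parts_eq(1)[OF zc mu mv u0 v0 le ge])
    show "emeasure \<mu> {x. t < u x} < \<infinity>" if "t > 0" for t
      unfolding u_def
      by (rule level_set_finite[OF M0 zc(1) cc 0 AE(1) _ that]) (use fin1 in \<open>auto elim: eventually_mono\<close>)
  qed
  \<comment> \<open>The comparison sees only positive parts. Reversing the signs turns both
    inequalities around, so exchanging the couplings makes it applicable to the negative
    parts.\<close>
  moreover have "AE z in \<gamma>1. max 0 (- u (fst z)) = max 0 (- v (snd z))"
  proof (rule positive_parts_eq(2)[OF zc(2,1), of "\<lambda>x. - u x" "\<lambda>y. - v y"])
    show "emeasure \<mu> {x. t < - u x} < \<infinity>" if "t > 0" for t
      using level_set_finite[OF M0 zc(2) cc(2,1) 0(2,1) AE(2) _ that] fin2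
      by (auto elim: eventually_mono simp: u_def)
  qed (use mu mv u0 v0 le ge in \<open>auto elim: eventually_mono\<close>)
  ultimately show ?thesis using AE(1) fin1
  proof eventually_elim
    case (elim z)
    then have "u (fst z) = v (snd z)" by (auto simp: max_def split: if_splits)
    moreover have "(fst z, snd z) \<in> subdifferential \<psi>1" using elim(3) by simp
    ultimately have "potential \<psi>2 (fst z) + c2 (snd z) \<le> fst z \<bullet> snd z"
      using fenchel_young_eq(2)[OF cc(1), of "fst z" "snd z"] by (simp add: u_def v_def c1_def)
    then have "(fst z, snd z) \<in> subdifferential \<psi>2"
      using elim(4) unfolding c2_def by (intro subdifferential_of_fenchel_young[OF cc(2)]) auto
    then show ?case by simp
  qed
qed

section \<open>Couplings carried by a common graph\<close>

lemma AE_off_singular_set: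
  fixes \<psi> :: "'a::euclidean_space \<Rightarrow> ereal"
  assumes zc: "zero_coupling \<mu> \<nu> \<gamma>" and van: "vanishes_on_codim_one \<mu>" and cc: "closed_convex \<psi>"
  shows "AE z in \<gamma>. fst z \<in> singular_set \<psi> \<longrightarrow> fst z = 0"
proof (rule AE_fst_not_null[OF zc singular_set_borel[OF cc]])
  show "emeasure \<mu> (singular_set \<psi> - {0}) = 0"
    by (rule van[unfolded vanishes_on_codim_one_def, rule_format])
      (use singular_set_borel[OF cc] hausdorff_dim_singular_set[OF cc] in auto)
qed

text \<open>Off the singular set, \<open>T\<close> has at most one point over each \<open>x\<close>,
  so on \<open>T\<close> the second coordinate lies in \<open>B\<close> exactly when the first lies
  in the projection of the part of \<open>T\<close> over \<open>B\<close>. The resulting value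
  involves \<mu> and \<open>T\<close> but not \<gamma>.\<close>

lemma emeasure_rectangle_graph:
  fixes \<psi> :: "'a::euclidean_space \<Rightarrow> ereal"
  assumes zc: "zero_coupling \<mu> \<nu> \<gamma>" and cc: "closed_convex \<psi>" and T: "T \<subseteq> subdifferential \<psi>" "closed T"
    and AE: "AE z in \<gamma>. z \<in> T" "AE z in \<gamma>. fst z \<in> singular_set \<psi> \<longrightarrow> fst z = 0"
    and A: "A \<in> sets borel" "0 \<notin> A" and B: "closed B"
  shows "emeasure \<gamma> (A \<times> B) = emeasure \<mu> (A \<inter> fst ` (T \<inter> UNIV \<times> B))"
proof -
  let ?P = "fst ` (T \<inter> UNIV \<times> B)"
  have P: "?P \<in> sets borel"
    by (intro closed_image_borel closed_Int T closed_Times closed_UNIV B continuous_intros)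
  have AP: "A \<inter> ?P \<in> sets borel" "0 \<notin> A \<inter> ?P" using A P by auto
  have "emeasure \<gamma> (A \<times> B) = emeasure \<gamma> ((A \<inter> ?P) \<times> UNIV)"
  proof (rule emeasure_eq_AE)
    show "AE z in \<gamma>. z \<in> A \<times> B \<longleftrightarrow> z \<in> (A \<inter> ?P) \<times> UNIV"
      using AE
    proof eventually_elim
      case (elim z)
      have "snd z \<in> B" if fz: "fst z \<in> A" "fst z \<in> ?P"
      proof -
        obtain y where y: "(fst z, y) \<in> T" "y \<in> B" using fz(2) by auto
        have "fst z \<notin> singular_set \<psi>" using elim(2) fz(1) A(2) by auto
        moreover have "(fst z, y) \<in> subdifferential \<psi>" "(fst z, snd z) \<in> subdifferential \<psi>"
          using y(1) elim(1) T(1) by auto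
        ultimately have "y = snd z" by (rule unique_subgradient_off_singular_set[OF cc])
        then show ?thesis using y(2) by simp
      qed
      moreover have "fst z \<in> ?P" if "snd z \<in> B"
        using elim(1) that by (intro image_eqI[of _ _ z]) (auto simp: mem_Times_iff)
      ultimately show ?case by (cases z) auto
    qed
    show "A \<times> B \<in> sets \<gamma>"
      using A B by (auto simp: punctured_sets_iff[OF zero_coupling_sets(1)[OF zc]] zero_prod_def intro: borel_Times)
    show "(A \<inter> ?P) \<times> UNIV \<in> sets \<gamma>" by (rule zero_coupling_sets(3)[OF zc AP])
  qed
  then show ?thesis using zero_coupling_sets(5)[OF zc AP] by simp
qed

text \<open>Rectangles whose first side avoids 0 determine the coupling: if a box avoiding the
  origin has 0 in its first side, its second side \<open>B\<close> avoids 0, and the mass of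
  \<open>{0} \<times> B\<close> is the finite mass \<open>emeasure \<nu> B\<close> minus that of
  \<open>(- {0}) \<times> B\<close>.\<close>

lemma zero_coupling_eqI:
  fixes \<mu> \<nu> :: "'a::euclidean_space measure"
  assumes M0: "\<mu> \<in> M0" "\<nu> \<in> M0" and zc: "zero_coupling \<mu> \<nu> \<gamma>1" "zero_coupling \<mu> \<nu> \<gamma>2"
    and eq: "\<And>A B. A \<in> sets borel \<Longrightarrow> 0 \<notin> A \<Longrightarrow> closed B \<Longrightarrow> emeasure \<gamma>1 (A \<times> B) = emeasure \<gamma>2 (A \<times> B)"
  shows "\<gamma>1 = \<gamma>2"
proof (rule punctured_measure_eqI[OF zero_coupling_sets(1)[OF zc(1)] zero_coupling_sets(1)[OF zc(2)]])
  fix p q :: "'a \<times> 'a" assume 0: "0 \<notin> cbox p q"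
  show "emeasure \<gamma>1 (cbox p q) < \<infinity>"
    using 0 by (intro M0_D(2)[OF zero_coupling_M0[OF M0 zc(1)]]) auto
  define A where "A = cbox (fst p) (fst q)"
  define B where "B = cbox (snd p) (snd q)"
  have box: "cbox p q = A \<times> B" unfolding A_def B_def by (metis cbox_Pair_eq prod.collapse)
  have clA: "closed A" and clB: "closed B" by (auto simp: A_def B_def)
  show "emeasure \<gamma>1 (cbox p q) = emeasure \<gamma>2 (cbox p q)"
  proof (cases "0 \<in> A")
    case False
    then show ?thesis unfolding box using clA clB by (intro eq) auto
  next
    case True
    then have B0: "0 \<notin> B" using 0 box by (auto simp: zero_prod_def)
    have Bb: "B \<in> sets borel" using clB by simp
    have fin: "emeasure \<nu> B < \<infinity>" using B0 clB by (intro M0_D(2)[OF M0(2) Bb]) simp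
    have decomp: "emeasure \<gamma> (A \<times> B) = emeasure \<nu> B - emeasure \<gamma> ((- {0}) \<times> B) + emeasure \<gamma> ((A - {0}) \<times> B)"
      if zc: "zero_coupling \<mu> \<nu> \<gamma>" for \<gamma>
    proof -
      have m: "C \<times> B \<in> sets \<gamma>" if "C \<in> sets borel" for C
        using that Bb B0
        by (auto simp: punctured_sets_iff[OF zero_coupling_sets(1)[OF zc]] zero_prod_def intro: borel_Times)
      have UB: "emeasure \<gamma> (UNIV \<times> B) = emeasure \<nu> B" by (rule zero_coupling_sets(6)[OF zc Bb B0])
      have "emeasure \<gamma> ((- {0}) \<times> B) \<le> emeasure \<gamma> (UNIV \<times> B)" by (intro emeasure_mono m) auto
      then have "emeasure \<gamma> ((- {0}) \<times> B) \<noteq> \<infinity>" using fin UB by auto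
      then have "emeasure \<gamma> (UNIV \<times> B - (- {0}) \<times> B) = emeasure \<nu> B - emeasure \<gamma> ((- {0}) \<times> B)"
        unfolding UB[symmetric] by (intro emeasure_Diff m) auto
      also have "UNIV \<times> B - (- {0}) \<times> B = {0} \<times> B" by auto
      finally have "emeasure \<gamma> ({0} \<times> B) = emeasure \<nu> B - emeasure \<gamma> ((- {0}) \<times> B)" .
      moreover have "emeasure \<gamma> ({0} \<times> B) + emeasure \<gamma> ((A - {0}) \<times> B) = emeasure \<gamma> ({0} \<times> B \<union> (A - {0}) \<times> B)"
        using clA by (intro plus_emeasure m) auto
      moreover have "{0} \<times> B \<union> (A - {0}) \<times> B = A \<times> B" using True by auto
      ultimately show ?thesis by simp
    qed
    have "emeasure \<gamma>1 ((- {0}) \<times> B) = emeasure \<gamma>2 ((- {0}) \<times> B)"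
      "emeasure \<gamma>1 ((A - {0}) \<times> B) = emeasure \<gamma>2 ((A - {0}) \<times> B)"
      using clA clB by (auto intro!: eq)
    then show ?thesis unfolding box decomp[OF zc(1)] decomp[OF zc(2)] by simp
  qed
qed

theorem cyclically_monotone_zero_coupling_unique:
  fixes \<mu> \<nu> :: "'a::euclidean_space measure"
  assumes M0: "\<mu> \<in> M0" "\<nu> \<in> M0" and van: "vanishes_on_codim_one \<mu>"
    and zc: "zero_coupling \<mu> \<nu> \<gamma>1" "zero_coupling \<mu> \<nu> \<gamma>2"
    and cc: "closed_convex \<psi>1" "closed_convex \<psi>2"
    and spt: "spt \<gamma>1 \<subseteq> subdifferential \<psi>1" "spt \<gamma>2 \<subseteq> subdifferential \<psi>2"
    and 0: "(0, 0) \<in> subdifferential \<psi>1" "(0, 0) \<in> subdifferential \<psi>2"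
  shows "AE x in \<mu>. gradient_defined \<psi>1 x \<and> gradient_defined \<psi>2 x \<and> gradient \<psi>1 x = gradient \<psi>2 x"
    and "\<gamma>1 = \<gamma>2"
proof -
  have AE1: "AE z in \<gamma>1. z \<in> subdifferential \<psi>1"
    using AE_in_spt[OF zero_coupling_sets(1)[OF zc(1)]] spt(1) by (auto elim: eventually_mono)
  have AE2: "AE z in \<gamma>2. z \<in> subdifferential \<psi>2"
    using AE_in_spt[OF zero_coupling_sets(1)[OF zc(2)]] spt(2) by (auto elim: eventually_mono)
  \<comment> \<open>Both couplings are carried by this one closed set, so the rectangle formula has
    literally the same right-hand side for each.\<close>
  define T where "T = subdifferential \<psi>1 \<inter> subdifferential \<psi>2"
  have T1: "AE z in \<gamma>1. z \<in> T"
    using AE1 AE_in_other_subdifferential[OF M0 zc cc 0 AE1 AE2] by eventually_elim (simp add: T_def)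
  have T2: "AE z in \<gamma>2. z \<in> T"
    using AE2 AE_in_other_subdifferential[OF M0 zc(2,1) cc(2,1) 0(2,1) AE2 AE1] by eventually_elim (simp add: T_def)
  have clT: "closed T" unfolding T_def by (intro closed_Int closed_subdifferential cc)
  show "\<gamma>1 = \<gamma>2"
  proof (rule zero_coupling_eqI[OF M0 zc])
    fix A B :: "'a set" assume AB: "A \<in> sets borel" "0 \<notin> A" "closed B"
    have "T \<subseteq> subdifferential \<psi>1" by (simp add: T_def)
    note rect = emeasure_rectangle_graph[OF _ cc(1) this clT _ AE_off_singular_set[OF _ van cc(1)] AB]
    show "emeasure \<gamma>1 (A \<times> B) = emeasure \<gamma>2 (A \<times> B)"
      using rect[OF zc(1) T1 zc(1)] rect[OF zc(2) T2 zc(2)] by simp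
  qed
  \<comment> \<open>The point 0 is inserted because the null sets of \<mu> say nothing about pairs
    with first coordinate 0; it is harmless, as \<mu> lives off the origin. Transferring from
    \<gamma>1 to itself below merely reads off the \<mu>-null set.\<close>
  define E where "E = insert 0 (fst ` T - singular_set \<psi>1 - singular_set \<psi>2)"
  have E: "E \<in> sets borel"
  proof -
    have "fst ` T \<in> sets borel" by (rule closed_image_borel[OF clT]) (intro continuous_intros)
    then show ?thesis
      unfolding E_def using singular_set_borel[OF cc(1)] singular_set_borel[OF cc(2)] by auto
  qed
  have "AE z in \<gamma>1. fst z \<in> E"
    using T1 AE_off_singular_set[OF zc(1) van cc(1)] AE_off_singular_set[OF zc(1) van cc(2)]
    by eventually_elim (auto simp: E_def)
  then have "emeasure \<mu> (- E - {0}) = 0" by (rule AE_fst_transfer(2)[OF zc(1,1) E])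
  then have "- E - {0} \<in> null_sets \<mu>"
    using E by (intro null_setsI) (auto simp: punctured_sets_iff[OF M0_D(1)[OF M0(1)]])
  then have "AE x in \<mu>. x \<in> E \<and> x \<noteq> 0"
    by (rule AE_I') (auto simp: space_punctured[OF M0_D(1)[OF M0(1)]])
  then show "AE x in \<mu>. gradient_defined \<psi>1 x \<and> gradient_defined \<psi>2 x \<and> gradient \<psi>1 x = gradient \<psi>2 x"
  proof eventually_elim
    case (elim x)
    then obtain v where v: "(x, v) \<in> subdifferential \<psi>1" "(x, v) \<in> subdifferential \<psi>2"
      and x: "x \<notin> singular_set \<psi>1" "x \<notin> singular_set \<psi>2"
      by (auto simp: E_def T_def)
    have "has_gradient \<psi>1 v x" "has_gradient \<psi>2 v x"
      by (rule has_gradient_of_unique_subgradient[OF cc(1) v(1) unique_subgradient_off_singular_set[OF cc(1) x(1) _ v(1)]], assumption)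
        (rule has_gradient_of_unique_subgradient[OF cc(2) v(2) unique_subgradient_off_singular_set[OF cc(2) x(2) _ v(2)]], assumption)
    then show ?case by (auto simp: gradient_defined_def gradient_eqI)
  qed
qed

text \<open>Otherwise a neighbourhood of the origin is null, so all mass of \<gamma> lies away from
  the origin and is finite; it bounds the masses of both marginals.\<close>

lemma zero_in_spt_of_infinite_mass:
  assumes M0: "\<mu> \<in> M0" "\<nu> \<in> M0" and zc: "zero_coupling \<mu> \<nu> \<gamma>"
    and inf: "emeasure \<mu> (space \<mu>) = \<infinity> \<or> emeasure \<nu> (space \<nu>) = \<infinity>"
  shows "(0, 0) \<in> spt \<gamma>"
proof (rule ccontr)
  assume "(0, 0) \<notin> spt \<gamma>"
  then obtain U where U: "open U" "0 \<in> U" "emeasure \<gamma> (U - {0}) = 0"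
    by (auto simp: spt_def zero_prod_def)
  note p = zero_coupling_sets(1)[OF zc]
  have "closure (- U) = - U" using U(1) by (intro closure_closed) auto
  then have "emeasure \<gamma> (- U) < \<infinity>"
    using U by (intro M0_D(2)[OF zero_coupling_M0[OF M0 zc]]) auto
  moreover have "emeasure \<gamma> (- {0}) \<le> emeasure \<gamma> (U - {0}) + emeasure \<gamma> (- U)"
  proof -
    have eq: "- {0} = (U - {0}) \<union> - U" using U by auto
    have "U - {0} \<in> sets \<gamma>" "- U \<in> sets \<gamma>" using U by (auto simp: punctured_sets_iff[OF p])
    then show ?thesis unfolding eq by (rule emeasure_subadditive)
  qed
  ultimately have fin: "emeasure \<gamma> (- {0}) < \<infinity>" using U(3) by simp
  have c: "- {0::'a} \<in> sets borel" "0 \<notin> - {0::'a}" by auto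
  have le: "emeasure \<gamma> C \<le> emeasure \<gamma> (- {0})" for C
    using emeasure_space[of \<gamma> C] zero_coupling_sets(2)[OF zc] by simp
  have "emeasure \<mu> (space \<mu>) < \<infinity>" "emeasure \<nu> (space \<nu>) < \<infinity>"
    using le[of "(- {0}) \<times> UNIV"] le[of "UNIV \<times> (- {0})"] fin
    unfolding zero_coupling_sets(5)[OF zc c] zero_coupling_sets(6)[OF zc c]
      space_punctured[OF M0_D(1)[OF M0(1)]] space_punctured[OF M0_D(1)[OF M0(2)]]
    by (auto intro: le_less_trans)
  then show False using inf by auto
qed

theorem theorem4p1:
  fixes \<mu> \<nu> :: "'a::euclidean_space measure"
  assumes "\<mu> \<in> M0" and "\<nu> \<in> M0"
    and "vanishes_on_codim_one \<mu>"
  shows "(\<forall>\<gamma>\<^sub>1 \<in> Gamma0cm \<mu> \<nu>. \<forall>\<gamma>\<^sub>2 \<in> Gamma0cm \<mu> \<nu>. \<forall>\<psi>\<^sub>1 \<psi>\<^sub>2.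
            closed_convex \<psi>\<^sub>1 \<longrightarrow> closed_convex \<psi>\<^sub>2 \<longrightarrow>
            spt \<gamma>\<^sub>1 \<subseteq> subdifferential \<psi>\<^sub>1 \<longrightarrow> spt \<gamma>\<^sub>2 \<subseteq> subdifferential \<psi>\<^sub>2 \<longrightarrow>
            (0, 0) \<in> subdifferential \<psi>\<^sub>1 \<inter> subdifferential \<psi>\<^sub>2 \<longrightarrow>
            (AE x in \<mu>. gradient_defined \<psi>\<^sub>1 x \<and> gradient_defined \<psi>\<^sub>2 x \<and>
                        gradient \<psi>\<^sub>1 x = gradient \<psi>\<^sub>2 x) \<and>
            \<gamma>\<^sub>1 = \<gamma>\<^sub>2) \<and>
         (emeasure \<mu> (space \<mu>) = \<infinity> \<or> emeasure \<nu> (space \<nu>) = \<infinity> \<longrightarrow>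
            is_singleton (Gamma0cm \<mu> \<nu>))"
proof (intro conjI ballI allI impI)
  fix \<gamma>1 \<gamma>2 :: "('a \<times> 'a) measure" and \<psi>1 \<psi>2 :: "'a \<Rightarrow> ereal"
  assume *: "\<gamma>1 \<in> Gamma0cm \<mu> \<nu>" "\<gamma>2 \<in> Gamma0cm \<mu> \<nu>" "closed_convex \<psi>1" "closed_convex \<psi>2"
    "spt \<gamma>1 \<subseteq> subdifferential \<psi>1" "spt \<gamma>2 \<subseteq> subdifferential \<psi>2"
    "(0, 0) \<in> subdifferential \<psi>1 \<inter> subdifferential \<psi>2"
  have "zero_coupling \<mu> \<nu> \<gamma>1" "zero_coupling \<mu> \<nu> \<gamma>2" using * by (auto simp: Gamma0cm_def)
  note uniq = cyclically_monotone_zero_coupling_unique[OF assms this *(3-6)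
      IntD1[OF *(7)] IntD2[OF *(7)]]
  show "AE x in \<mu>. gradient_defined \<psi>1 x \<and> gradient_defined \<psi>2 x \<and> gradient \<psi>1 x = gradient \<psi>2 x"
    "\<gamma>1 = \<gamma>2" by (rule uniq)+
next
  assume inf: "emeasure \<mu> (space \<mu>) = \<infinity> \<or> emeasure \<nu> (space \<nu>) = \<infinity>"
  show "is_singleton (Gamma0cm \<mu> \<nu>)"
  proof (rule is_singletonI')
    show "Gamma0cm \<mu> \<nu> \<noteq> {}" by (rule Gamma0cm_nonempty[OF assms(1,2)])
    fix \<gamma>1 \<gamma>2 assume "\<gamma>1 \<in> Gamma0cm \<mu> \<nu>" "\<gamma>2 \<in> Gamma0cm \<mu> \<nu>"
    then have zc: "zero_coupling \<mu> \<nu> \<gamma>1" "zero_coupling \<mu> \<nu> \<gamma>2"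
      and cm: "cyclically_monotone (spt \<gamma>1)" "cyclically_monotone (spt \<gamma>2)"
      by (auto simp: Gamma0cm_def)
    have 0: "(0, 0) \<in> spt \<gamma>1" "(0, 0) \<in> spt \<gamma>2"
      using zero_in_spt_of_infinite_mass[OF assms(1,2) _ inf] zc by blast+
    \<comment> \<open>The origin serves twice: as starting point of the chains in Rockafellar's
      construction and, since the supports lie in the subdifferentials, as their common
      point.\<close>
    obtain \<psi>1 where \<psi>1: "closed_convex \<psi>1" "spt \<gamma>1 \<subseteq> subdifferential \<psi>1"
      using rockafellar[OF cm(1) 0(1)] by blast
    obtain \<psi>2 where \<psi>2: "closed_convex \<psi>2" "spt \<gamma>2 \<subseteq> subdifferential \<psi>2"
      using rockafellar[OF cm(2) 0(2)] by blast
    show "\<gamma>1 = \<gamma>2"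
      using cyclically_monotone_zero_coupling_unique(2)[OF assms zc \<psi>1(1) \<psi>2(1) \<psi>1(2) \<psi>2(2)] 0 \<psi>1(2) \<psi>2(2)
      by blast
  qed
qed

end
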